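(* Let $n\ge 3$ be an integer, let $D_{2^n}$ be the dihedral group of order $2^n$, and let $k$ be a field containing the Galois field $\mathbb{F}_{2^{n-2}}$ of $2^{n-2}$ elements. Then the group algebra $kD_{2^n}$ admits a deformation $[kD_{2^n}]_t$ which is a separable $k((t))$-algebra and which satisfies $$\overline{k((t))}\otimes_{k((t))}[kD_{2^{n}}]_t \;\simeq\;\bigoplus_{i=1}^{2^{n-2}-1}M_2\big(\overline{k((t))}\big)\;\oplus\;\bigoplus_{i=1}^4\overline{k((t))}$$ as $\overline{k((t))}$-algebras. In particular, the dimensions (with multiplicity) of the simple components of $\overline{k((t))}\otimes_{k((t))}[kD_{2^n}]_t$ over $\overline{k((t))}$ are the same as the dimensions of the simple components of $\mathbb{C}D_{2^n}$ over $\mathbb{C}$.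
   Context: All algebras are associative. $k[[t]]$ is the ring of formal power series over $k$, $k((t))$ is its field of fractions, and $\overline{k((t))}$ is an algebraic closure of $k((t))$. Deformation: Let $A$ be a $k$-algebra. Suppose the free $k[[t]]$-module $\Lambda_t:=k[[t]]\otimes_k A$ admits a multiplication (making it a $k[[t]]$-algebra) such that there is an isomorphism of $k$-algebras $A\simeq \Lambda_t/\langle t\Lambda_t\rangle$. Then the $k((t))$-algebra $A_t:=k((t))\otimes_{k[[t]]}\Lambda_t$ is called a deformation of $A$. The dihedral group of order $2^n$ is $D_{2^n}=\langle \sigma,\tau \mid \sigma^{2^{n-1}}=1,\ \tau^2=1,\ \tau\sigma\tau^{-1}=\sigma^{-1}\rangle$. *)

theory Defs
  imports
    Complex_Main
    "HOL-Computational_Algebra.Formal_Laurent_Series"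
    "HOL-Algebra.Algebra"
    "HOL-Algebra.Algebraic_Closure_Type"
    "Jordan_Normal_Form.Missing_VectorSpace"
    "Jordan_Normal_Form.Matrix"
begin

section \<open>Associative algebras\<close>

text \<open>
  Base rings are types of class \<^class>\<open>comm_ring_1\<close>, viewed as structures by
  \<^const>\<open>ring_of_type_algebra\<close>. The locale \<^locale>\<open>algebra\<close> of the library only
  covers commutative algebras.
\<close>

locale assoc_algebra = module R A + ring A for R (structure) and A (structure) +
  assumes smult_mult_left:
      "\<lbrakk>r \<in> carrier R; x \<in> carrier A; y \<in> carrier A\<rbrakk> \<Longrightarrow>
        (r \<odot>\<^bsub>A\<^esub> x) \<otimes>\<^bsub>A\<^esub> y = r \<odot>\<^bsub>A\<^esub> (x \<otimes>\<^bsub>A\<^esub> y)"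
    and smult_mult_right:
      "\<lbrakk>r \<in> carrier R; x \<in> carrier A; y \<in> carrier A\<rbrakk> \<Longrightarrow>
        x \<otimes>\<^bsub>A\<^esub> (r \<odot>\<^bsub>A\<^esub> y) = r \<odot>\<^bsub>A\<^esub> (x \<otimes>\<^bsub>A\<^esub> y)"

definition with_smult :: "('a, 'z) ring_scheme \<Rightarrow> ('r \<Rightarrow> 'a \<Rightarrow> 'a) \<Rightarrow> ('r, 'a) module" where
  "with_smult A s =
    \<lparr>carrier = carrier A, monoid.mult = monoid.mult A,
     one = one A, ring.zero = ring.zero A, add = add A, module.smult = s\<rparr>"

definition algebra_of_hom :: "('r \<Rightarrow> 's::comm_ring_1) \<Rightarrow> ('r, 's) module" where
  "algebra_of_hom \<phi> = with_smult ring_of_type_algebra (\<lambda>r s. \<phi> r * s)"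

definition restrict_scalars :: "('q \<Rightarrow> 'r) \<Rightarrow> ('r, 'a) module \<Rightarrow> ('q, 'a) module" where
  "restrict_scalars \<phi> A = with_smult A (\<lambda>q x. \<phi> q \<odot>\<^bsub>A\<^esub> x)"

definition opposite_algebra :: "('r, 'a) module \<Rightarrow> ('r, 'a) module" where
  "opposite_algebra A = A\<lparr>monoid.mult := \<lambda>x y. y \<otimes>\<^bsub>A\<^esub> x\<rparr>"

definition quotient_algebra :: "('r, 'a) module \<Rightarrow> 'a set \<Rightarrow> ('r, 'a set) module" where
  "quotient_algebra A I = with_smult (A Quot I) (\<lambda>r Y. \<Union>y\<in>Y. I +>\<^bsub>A\<^esub> (r \<odot>\<^bsub>A\<^esub> y))"

definition algebra_hom :: "('r, 'a) module \<Rightarrow> ('r, 'b) module \<Rightarrow> ('a \<Rightarrow> 'b) set" where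
  "algebra_hom A B =
    {h \<in> Ring.ring_hom A B. \<forall>r. \<forall>x \<in> carrier A. h (r \<odot>\<^bsub>A\<^esub> x) = r \<odot>\<^bsub>B\<^esub> h x}"

definition algebra_iso :: "('r, 'a) module \<Rightarrow> ('r, 'b) module \<Rightarrow> bool"
    (infix \<open>\<simeq>\<^sub>a\<^sub>l\<^sub>g\<close> 50) where
  "A \<simeq>\<^sub>a\<^sub>l\<^sub>g B \<longleftrightarrow> (\<exists>h \<in> algebra_hom A B. bij_betw h (carrier A) (carrier B))"

definition matrix_algebra :: "nat \<Rightarrow> ('r::comm_ring_1, 'r mat) module" where
  "matrix_algebra m = with_smult (ring_mat TYPE('r) m ()) (\<cdot>\<^sub>m)"

text \<open>For finite index sets the direct sum is the product of the underlying sets.\<close>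

definition algebra_sum :: "'i set \<Rightarrow> ('i \<Rightarrow> ('r, 'a) module) \<Rightarrow> ('r, 'i \<Rightarrow> 'a) module" where
  "algebra_sum I A =
    \<lparr>carrier = (\<Pi>\<^sub>E i\<in>I. carrier (A i)),
     monoid.mult = (\<lambda>x y. \<lambda>i\<in>I. x i \<otimes>\<^bsub>A i\<^esub> y i),
     one = (\<lambda>i\<in>I. \<one>\<^bsub>A i\<^esub>),
     ring.zero = (\<lambda>i\<in>I. \<zero>\<^bsub>A i\<^esub>),
     add = (\<lambda>x y. \<lambda>i\<in>I. x i \<oplus>\<^bsub>A i\<^esub> y i),
     module.smult = (\<lambda>r x. \<lambda>i\<in>I. r \<odot>\<^bsub>A i\<^esub> x i)\<rparr>"

definition algebra_sum2 :: "('r, 'a) module \<Rightarrow> ('r, 'b) module \<Rightarrow> ('r, 'a \<times> 'b) module"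
    (infixr \<open>\<oplus>\<^sub>a\<^sub>l\<^sub>g\<close> 65) where
  "A \<oplus>\<^sub>a\<^sub>l\<^sub>g B =
    \<lparr>carrier = carrier A \<times> carrier B,
     monoid.mult = (\<lambda>(a, b) (a', b'). (a \<otimes>\<^bsub>A\<^esub> a', b \<otimes>\<^bsub>B\<^esub> b')),
     one = (\<one>\<^bsub>A\<^esub>, \<one>\<^bsub>B\<^esub>),
     ring.zero = (\<zero>\<^bsub>A\<^esub>, \<zero>\<^bsub>B\<^esub>),
     add = (\<lambda>(a, b) (a', b'). (a \<oplus>\<^bsub>A\<^esub> a', b \<oplus>\<^bsub>B\<^esub> b')),
     module.smult = (\<lambda>r (a, b). (r \<odot>\<^bsub>A\<^esub> a, r \<odot>\<^bsub>B\<^esub> b))\<rparr>"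


section \<open>Monoid and group algebras\<close>

definition monoid_algebra :: "('g, 'm) monoid_scheme \<Rightarrow> ('r::comm_ring_1, 'g \<Rightarrow> 'r) module" where
  "monoid_algebra G =
    \<lparr>carrier = {f. finite {x. f x \<noteq> 0} \<and> {x. f x \<noteq> 0} \<subseteq> carrier G},
     monoid.mult = (\<lambda>f g x. \<Sum>(y, z) \<in> {(y, z). f y \<noteq> 0 \<and> g z \<noteq> 0 \<and> y \<otimes>\<^bsub>G\<^esub> z = x}. f y * g z),
     one = (\<lambda>x. if x = \<one>\<^bsub>G\<^esub> then 1 else 0),
     ring.zero = (\<lambda>_. 0),
     add = (\<lambda>f g x. f x + g x),
     module.smult = (\<lambda>r f x. r * f x)\<rparr>"

abbreviation group_algebra :: "'g monoid \<Rightarrow> ('k::field, 'g \<Rightarrow> 'k) module" where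
  "group_algebra G \<equiv> monoid_algebra G"


section \<open>Tensor products\<close>

text \<open>
  The tensor product of the \<open>R\<close>-algebras \<open>A\<close> and \<open>B\<close> is the free abelian group on
  \<open>A \<times> B\<close> modulo the subgroup generated by the bilinearity relations. The free abelian group
  is the additive group of the monoid ring over \<^typ>\<open>int\<close> of the multiplicative monoid
  \<open>A \<times> B\<close>. By distributivity the subgroup is a two-sided ideal of that ring, and the ring
  structure of the quotient is \<open>(a \<otimes> b) (a' \<otimes> b') = a a' \<otimes> b b'\<close>.
\<close>

definition tensor_free :: "('r, 'a) module \<Rightarrow> ('r, 'b) module \<Rightarrow> (int, 'a \<times> 'b \<Rightarrow> int) module" where
  "tensor_free A B = monoid_algebra (A \<times>\<times> B)"

definition tensor_gen :: "'a \<Rightarrow> 'b \<Rightarrow> 'a \<times> 'b \<Rightarrow> int" where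
  "tensor_gen a b = (\<lambda>p. if p = (a, b) then 1 else 0)"

definition tensor_rels :: "('r, 'a) module \<Rightarrow> ('r, 'b) module \<Rightarrow> ('a \<times> 'b \<Rightarrow> int) set" where
  "tensor_rels A B =
     {\<lambda>p. tensor_gen (a \<oplus>\<^bsub>A\<^esub> a') b p - tensor_gen a b p - tensor_gen a' b p | a a' b.
        a \<in> carrier A \<and> a' \<in> carrier A \<and> b \<in> carrier B} \<union>
     {\<lambda>p. tensor_gen a (b \<oplus>\<^bsub>B\<^esub> b') p - tensor_gen a b p - tensor_gen a b' p | a b b'.
        a \<in> carrier A \<and> b \<in> carrier B \<and> b' \<in> carrier B} \<union>
     {\<lambda>p. tensor_gen (r \<odot>\<^bsub>A\<^esub> a) b p - tensor_gen a (r \<odot>\<^bsub>B\<^esub> b) p | r a b.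
        a \<in> carrier A \<and> b \<in> carrier B}"

definition tensor_ideal :: "('r, 'a) module \<Rightarrow> ('r, 'b) module \<Rightarrow> ('a \<times> 'b \<Rightarrow> int) set" where
  "tensor_ideal A B = generate (add_monoid (tensor_free A B)) (tensor_rels A B)"

definition tensor_algebra ::
    "('r, 'a) module \<Rightarrow> ('r, 'b) module \<Rightarrow> ('a \<times> 'b \<Rightarrow> int) set ring" where
  "tensor_algebra A B = tensor_free A B Quot tensor_ideal A B"

definition pure_tensor ::
    "('r, 'a) module \<Rightarrow> ('r, 'b) module \<Rightarrow> 'a \<Rightarrow> 'b \<Rightarrow> ('a \<times> 'b \<Rightarrow> int) set" where
  "pure_tensor A B a b = tensor_ideal A B +>\<^bsub>tensor_free A B\<^esub> tensor_gen a b"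

text \<open>
  \<open>S \<otimes>\<^sub>R A\<close> as an \<open>S\<close>-algebra, for a ring homomorphism \<open>\<phi> : R \<rightarrow> S\<close>; the scalar \<open>s\<close> acts as
  multiplication by \<open>s \<otimes> 1\<close>, that is \<open>s (s' \<otimes> a) = s s' \<otimes> a\<close>.
\<close>

definition base_change ::
    "('r \<Rightarrow> 's::comm_ring_1) \<Rightarrow> ('r, 'a) module \<Rightarrow> ('s, ('s \<times> 'a \<Rightarrow> int) set) module" where
  "base_change \<phi> A =
    (let S = algebra_of_hom \<phi>; T = tensor_algebra S A
     in with_smult T (\<lambda>s z. pure_tensor S A s \<one>\<^bsub>A\<^esub> \<otimes>\<^bsub>T\<^esub> z))"


section \<open>Separable algebras\<close>

text \<open>
  \<open>A\<close> is separable over its base ring if the multiplication map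
  \<open>\<mu> : A \<otimes> A\<^sup>o\<^sup>p \<rightarrow> A\<close>, \<open>a \<otimes> b \<mapsto> a b\<close>, has a section \<open>\<sigma>\<close> that is a homomorphism of
  \<open>A\<close>-bimodules, i.e. if \<open>A\<close> is projective over \<open>A \<otimes> A\<^sup>o\<^sup>p\<close>. The bimodule structure
  \<open>a (x \<otimes> y) b = a x \<otimes> y b\<close> of \<open>A \<otimes> A\<close> is left multiplication by \<open>a \<otimes> b\<close> in \<open>A \<otimes> A\<^sup>o\<^sup>p\<close>.
\<close>

definition separable_algebra :: "('r, 'a) module \<Rightarrow> bool" where
  "separable_algebra A \<longleftrightarrow>
    (let E = tensor_algebra A (opposite_algebra A); pt = pure_tensor A (opposite_algebra A)
     in \<exists>\<mu> \<sigma>.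
       \<mu> \<in> hom (add_monoid E) (add_monoid A) \<and>
       (\<forall>a \<in> carrier A. \<forall>b \<in> carrier A. \<mu> (pt a b) = a \<otimes>\<^bsub>A\<^esub> b) \<and>
       \<sigma> \<in> hom (add_monoid A) (add_monoid E) \<and>
       (\<forall>a \<in> carrier A. \<forall>x \<in> carrier A. \<forall>b \<in> carrier A.
          \<sigma> (a \<otimes>\<^bsub>A\<^esub> x \<otimes>\<^bsub>A\<^esub> b) = pt a b \<otimes>\<^bsub>E\<^esub> \<sigma> x) \<and>
       (\<forall>x \<in> carrier A. \<mu> (\<sigma> x) = x))"


section \<open>Deformations\<close>

text \<open>
  \<open>k[[t]]\<close> and \<open>k((t))\<close> are the types \<^typ>\<open>'k fps\<close> and \<^typ>\<open>'k fls\<close>. The following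
  confirms that the latter is the field of fractions of the former.
\<close>

lemma fls_eq_fps_quotient:
  fixes x :: "'k::field fls"
  obtains f g :: "'k fps" where "g \<noteq> 0" "x = fps_to_fls f / fps_to_fls g"
proof
  define N where "N = nat (- fls_subdegree x)"
  show "fps_X ^ N \<noteq> (0 :: 'k fps)" by simp
  have "fls_X ^ N * x = fps_to_fls (fls_regpart (fls_X ^ N * x))"
    by (cases "x = 0") (simp_all add: N_def fls_regpart_to_fls_trivial fls_X_power_times_conv_shift)
  then show "x = fps_to_fls (fls_regpart (fls_X ^ N * x)) / fps_to_fls (fps_X ^ N)"
    by (metis fls_X_pow_nonzero fps_X_to_fls fps_to_fls_power nonzero_mult_div_cancel_left)
qed

text \<open>
  The underlying \<open>k[[t]]\<close>-module of \<open>\<Lambda>\<close> is \<open>k[[t]] \<otimes>\<^sub>k A\<close>; multiplication \<open>m\<close> and unit \<open>e\<close>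
  are new.
\<close>

definition is_deformation ::
    "('k::field, 'a) module \<Rightarrow>
     ('k fls, ('k fls \<times> ('k fps \<times> 'a \<Rightarrow> int) set \<Rightarrow> int) set) module \<Rightarrow> bool" where
  "is_deformation A A\<^sub>t \<longleftrightarrow>
    (\<exists>m e \<Lambda>.
       \<Lambda> = (base_change fps_const A)\<lparr>monoid.mult := m, one := e\<rparr> \<and>
       assoc_algebra ring_of_type_algebra \<Lambda> \<and>
       A \<simeq>\<^sub>a\<^sub>l\<^sub>g restrict_scalars fps_const
            (quotient_algebra \<Lambda> (Idl\<^bsub>\<Lambda>\<^esub> {fps_X \<odot>\<^bsub>\<Lambda>\<^esub> x | x. x \<in> carrier \<Lambda>})) \<and>
       A\<^sub>t = base_change fps_to_fls \<Lambda>)"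


section \<open>Simple components\<close>

text \<open>
  The simple components of a semisimple algebra are its minimal nonzero two-sided ideals.
\<close>

definition simple_components :: "('r, 'a) module \<Rightarrow> 'a set set" where
  "simple_components A =
    {I. ideal I A \<and> I \<noteq> {\<zero>\<^bsub>A\<^esub>} \<and> (\<forall>J. ideal J A \<and> J \<noteq> {\<zero>\<^bsub>A\<^esub>} \<and> J \<subseteq> I \<longrightarrow> J = I)}"

definition subspace_dim :: "('k::field, 'a) module \<Rightarrow> 'a set \<Rightarrow> nat" where
  "subspace_dim A I = vectorspace.dim ring_of_type_algebra (A\<lparr>carrier := I\<rparr>)"


section \<open>Dihedral groups\<close>

text \<open>
  \<open>\<langle>\<sigma>, \<tau> | \<sigma>\<^bsup>2^(n-1)\<^esup> = 1, \<tau>\<^sup>2 = 1, \<tau> \<sigma> \<tau>\<^sup>-\<^sup>1 = \<sigma>\<^sup>-\<^sup>1\<rangle>\<close> has order \<open>2^n\<close>, so a group of that order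
  with generators satisfying the relations is isomorphic to it.
\<close>

definition is_dihedral :: "nat \<Rightarrow> 'g monoid \<Rightarrow> bool" where
  "is_dihedral n D \<longleftrightarrow>
    group D \<and> Coset.order D = 2 ^ n \<and>
    (\<exists>\<sigma> \<in> carrier D. \<exists>\<tau> \<in> carrier D.
       generate D {\<sigma>, \<tau>} = carrier D \<and>
       \<sigma> [^]\<^bsub>D\<^esub> (2 ^ (n - 1) :: nat) = \<one>\<^bsub>D\<^esub> \<and>
       \<tau> [^]\<^bsub>D\<^esub> (2 :: nat) = \<one>\<^bsub>D\<^esub> \<and>
       \<tau> \<otimes>\<^bsub>D\<^esub> \<sigma> \<otimes>\<^bsub>D\<^esub> inv\<^bsub>D\<^esub> \<tau> = inv\<^bsub>D\<^esub> \<sigma>)"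

text \<open>The pair \<open>(i, b)\<close> stands for \<open>\<sigma>\<^sup>i \<tau>\<^sup>b\<close>; dihedral groups of order \<open>2^n\<close> exist.\<close>

definition dihedral_pairs :: "nat \<Rightarrow> (int \<times> bool) monoid" where
  "dihedral_pairs n = \<lparr>carrier = {0..<2 ^ (n - 1)} \<times> UNIV,
    monoid.mult = (\<lambda>(i, b) (j, c). ((if b then i - j else i + j) mod 2 ^ (n - 1), b \<noteq> c)),
    one = (0, False)\<rparr>"

lemma is_dihedral_example:
  assumes "n \<ge> 1"
  shows "is_dihedral n (dihedral_pairs n)"
proof -
  define m :: int where "m = 2 ^ (n - 1)"
  have m: "m > 0" "m \<ge> 1" by (simp_all add: m_def)
  let ?D = "dihedral_pairs n"
  have car: "carrier ?D = {0..<m} \<times> UNIV" by (simp add: dihedral_pairs_def m_def)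
  have mul: "(i, b) \<otimes>\<^bsub>?D\<^esub> (j, c) = ((if b then i - j else i + j) mod m, b \<noteq> c)" for i j b c
    by (simp add: dihedral_pairs_def m_def)
  have one: "\<one>\<^bsub>?D\<^esub> = (0, False)" by (simp add: dihedral_pairs_def)
  have grp: "group ?D"
  proof (rule groupI)
    fix x y z assume "x \<in> carrier ?D" "y \<in> carrier ?D" "z \<in> carrier ?D"
    show "x \<otimes>\<^bsub>?D\<^esub> y \<otimes>\<^bsub>?D\<^esub> z = x \<otimes>\<^bsub>?D\<^esub> (y \<otimes>\<^bsub>?D\<^esub> z)"
      by (cases x; cases y; cases z) (auto simp: mul mod_simps algebra_simps)
  next
    fix x assume "x \<in> carrier ?D"
    then obtain i b where x: "x = (i, b)" "0 \<le> i" "i < m" by (cases x) (auto simp: car)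
    show "\<exists>y\<in>carrier ?D. y \<otimes>\<^bsub>?D\<^esub> x = \<one>\<^bsub>?D\<^esub>"
      by (rule bexI[of _ "(if b then i else (- i) mod m, b)"])
         (use x m in \<open>auto simp: mul one car mod_simps\<close>)
  qed (use m in \<open>auto simp: car mul one\<close>)
  interpret D: group ?D by (fact grp)
  let ?s = "(1 mod m, False)" and ?t = "(0, True)"
  have s: "?s \<in> carrier ?D" and t: "?t \<in> carrier ?D" using m by (auto simp: car)
  have pow: "?s [^]\<^bsub>?D\<^esub> (k::nat) = (int k mod m, False)" for k
    by (induction k) (auto simp: one mul mod_simps add.commute)
  have inv_s: "inv\<^bsub>?D\<^esub> ?s = ((- 1) mod m, False)"
    by (rule D.inv_equality) (use s m in \<open>auto simp: mul one car mod_simps\<close>)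
  have inv_t: "inv\<^bsub>?D\<^esub> ?t = ?t"
    by (rule D.inv_equality) (use t m in \<open>auto simp: mul one car mod_simps\<close>)
  have "carrier ?D \<subseteq> generate ?D {?s, ?t}"
  proof
    fix x assume "x \<in> carrier ?D"
    then obtain i b where x: "x = (i, b)" "0 \<le> i" "i < m" by (cases x) (auto simp: car)
    have g: "?s [^]\<^bsub>?D\<^esub> (k::nat) \<in> generate ?D {?s, ?t}" for k
    proof (induction k)
      case (Suc k)
      then show ?case by (auto intro: generate.intros)
    qed (auto intro: generate.intros)
    have 1: "(i, False) \<in> generate ?D {?s, ?t}" using g[of "nat i"] x unfolding pow by simp
    moreover have "(i, False) \<otimes>\<^bsub>?D\<^esub> ?t \<in> generate ?D {?s, ?t}"
      by (rule generate.eng[OF 1]) (auto intro: generate.intros)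
    ultimately show "x \<in> generate ?D {?s, ?t}" using x by (cases b) (auto simp: mul)
  qed
  then have "generate ?D {?s, ?t} = carrier ?D"
    using D.generate_incl[of "{?s, ?t}"] s t by auto
  moreover have "Coset.order ?D = 2 ^ n"
    using assms unfolding Coset.order_def car
    by (cases n) (auto simp: m_def card_cartesian_product nat_power_eq)
  moreover have "?s [^]\<^bsub>?D\<^esub> (2 ^ (n - 1) :: nat) = \<one>\<^bsub>?D\<^esub>"
    unfolding pow by (simp add: one m_def)
  moreover have "?t [^]\<^bsub>?D\<^esub> (2 :: nat) = \<one>\<^bsub>?D\<^esub>" 
    by (simp add: numeral_2_eq_2 one mul)
  moreover have "?t \<otimes>\<^bsub>?D\<^esub> ?s \<otimes>\<^bsub>?D\<^esub> inv\<^bsub>?D\<^esub> ?t = inv\<^bsub>?D\<^esub> ?s"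
    unfolding inv_s inv_t by (simp add: mul mod_simps)
  ultimately show ?thesis using grp s t unfolding is_dihedral_def by blast
qed

end

theory Submission
  imports Defs
begin

text \<open>
  Let \<open>q = 2\<^sup>n\<^sup>-\<^sup>2\<close>, \<open>m = q - 1\<close> and let \<open>\<alpha>\<^sub>0 = 0, \<dots>, \<alpha>\<^sub>m\<close> be the elements of the subfield with
  \<open>q\<close> elements. The split algebra \<open>P(R) = M\<^sub>2(R)\<^sup>m \<oplus> R\<^sup>4\<close> over \<open>R = k[[t]]\<close> contains the element \<open>w\<close> that
  is the scalar \<open>w\<^sub>i = t \<alpha>\<^sub>i\<close> in the \<open>i\<close>-th block and \<open>0\<close> in \<open>R\<^sup>4\<close>, and elements \<open>u\<close>, \<open>v\<close> that are
  \<open>(0, 1; w\<^sub>i, w\<^sub>i)\<close> and \<open>(0, 1; 0, 0)\<close> in the \<open>i\<close>-th block and run through \<open>{0, t\<^sup>q} \<times> {0, t\<^sup>q}\<close> in \<open>R\<^sup>4\<close>.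
  They satisfy \<open>w\<^sup>q = t\<^sup>q\<^sup>-\<^sup>1 w\<close>, \<open>u\<^sup>2 = (w + g) u + w\<close>, \<open>v\<^sup>2 = g v\<close>, \<open>v u = u v + w v + w\<close> with
  \<open>g = t (w\<^sup>q\<^sup>-\<^sup>1 + t\<^sup>q\<^sup>-\<^sup>1)\<close>, so the \<open>R\<close>-span \<open>\<Lambda>\<close> of the \<open>4 q = |D|\<close> elements \<open>w\<^sup>e u\<^sup>i v\<^sup>j\<close> is an order.
  Modulo \<open>t\<close> the elements \<open>x = 1 + u\<close> and \<open>y = 1 + v\<close> satisfy the dihedral relations and generate \<open>\<Lambda>/t\<Lambda>\<close>,
  hence \<open>k D \<simeq> \<Lambda>/t\<Lambda>\<close> by dimensions. Over \<open>k((t))\<close> the nodes \<open>w\<^sub>i\<close> are distinct and \<open>t\<^sup>q\<close> is a unit, so a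
  Vandermonde argument shows that \<open>\<Lambda>\<close> spans all of \<open>P(k((t)))\<close>. The underlying module \<open>k[[t]] \<otimes> k D\<close>
  acquires this multiplication through any bijection of bases.
\<close>

text \<open>In \<open>k D\<close> the central element \<open>x + x^-1\<close> is nilpotent of order
  \<open>q\<close>, and \<open>k D\<close> is free of rank 4 over the subalgebra that it generates.
  Only this base ring is deformed: \<open>w^q = 0\<close> becomes \<open>w^q = t^(q-1) w\<close>,
  whose \<open>q\<close> roots lie in \<open>k[[t]]\<close> because \<open>k\<close> contains the
  field with \<open>q\<close> elements. The relations of \<open>u\<close> and \<open>v\<close> are
  those of the dihedral group rewritten with \<open>w = x + x^-1\<close>. At a nonzero node they
  define, over \<open>k((t))\<close>, an algebra of 2 by 2 matrices; over \<open>w = 0\<close> they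
  would leave the commutative algebra with \<open>u^2 = v^2 = 0\<close>, which is not semisimple.
  The correction \<open>g\<close> exists to split that one fibre into four points. It therefore has
  to vanish at every nonzero node, as \<open>w^(q-1) + t^(q-1)\<close> does, and its extra factor
  \<open>t\<close> makes it invisible modulo \<open>t\<close>; this is where the distance
  \<open>t^q\<close> of the four points comes from. Since \<open>w\<close> is divisible by
  \<open>t\<close> in the blocks but not in the order, reductions modulo \<open>t\<close> are
  computed with polynomials in \<open>w\<close>, never entrywise. Placing the order inside a split
  algebra makes associativity automatic.\<close>

lemma ring_of_type_algebra_simps [simp]:
  "carrier ring_of_type_algebra = UNIV"
  "x \<otimes>\<^bsub>ring_of_type_algebra\<^esub> y = x * y"
  "\<one>\<^bsub>ring_of_type_algebra\<^esub> = 1"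
  "\<zero>\<^bsub>ring_of_type_algebra\<^esub> = 0"
  "x \<oplus>\<^bsub>ring_of_type_algebra\<^esub> y = x + y"
  by (simp_all add: ring_of_type_algebra_def)

section \<open>Algebras over a type of scalars\<close>

abbreviation type_algebra :: "('r::comm_ring_1, 'a) module \<Rightarrow> bool" where
  "type_algebra A \<equiv> assoc_algebra ring_of_type_algebra A"

lemma type_algebraI:
  fixes A :: "('r::comm_ring_1, 'a) module"
  assumes "ring A"
    and "\<And>r x. x \<in> carrier A \<Longrightarrow> r \<odot>\<^bsub>A\<^esub> x \<in> carrier A"
    and "\<And>r s x. x \<in> carrier A \<Longrightarrow> (r + s) \<odot>\<^bsub>A\<^esub> x = r \<odot>\<^bsub>A\<^esub> x \<oplus>\<^bsub>A\<^esub> s \<odot>\<^bsub>A\<^esub> x"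
    and "\<And>r x y. \<lbrakk>x \<in> carrier A; y \<in> carrier A\<rbrakk> \<Longrightarrow> r \<odot>\<^bsub>A\<^esub> (x \<oplus>\<^bsub>A\<^esub> y) = r \<odot>\<^bsub>A\<^esub> x \<oplus>\<^bsub>A\<^esub> r \<odot>\<^bsub>A\<^esub> y"
    and "\<And>r s x. x \<in> carrier A \<Longrightarrow> (r * s) \<odot>\<^bsub>A\<^esub> x = r \<odot>\<^bsub>A\<^esub> (s \<odot>\<^bsub>A\<^esub> x)"
    and "\<And>x. x \<in> carrier A \<Longrightarrow> 1 \<odot>\<^bsub>A\<^esub> x = x"
    and "\<And>r x y. \<lbrakk>x \<in> carrier A; y \<in> carrier A\<rbrakk> \<Longrightarrow> (r \<odot>\<^bsub>A\<^esub> x) \<otimes>\<^bsub>A\<^esub> y = r \<odot>\<^bsub>A\<^esub> (x \<otimes>\<^bsub>A\<^esub> y)"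
    and "\<And>r x y. \<lbrakk>x \<in> carrier A; y \<in> carrier A\<rbrakk> \<Longrightarrow> x \<otimes>\<^bsub>A\<^esub> (r \<odot>\<^bsub>A\<^esub> y) = r \<odot>\<^bsub>A\<^esub> (x \<otimes>\<^bsub>A\<^esub> y)"
  shows "type_algebra A"
proof -
  interpret ring A by fact
  show ?thesis
    by (rule assoc_algebra.intro[OF moduleI])
       (use assms in \<open>auto intro!: cring_from_type_algebra ring_axioms abelian_group_axioms
         simp: assoc_algebra_axioms_def\<close>)
qed

lemma type_algebraD:
  fixes A :: "('r::comm_ring_1, 'a) module"
  assumes "type_algebra A"
  shows "ring A" "module ring_of_type_algebra A"
    and "x \<in> carrier A \<Longrightarrow> r \<odot>\<^bsub>A\<^esub> x \<in> carrier A"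
    and "x \<in> carrier A \<Longrightarrow> (r + s) \<odot>\<^bsub>A\<^esub> x = r \<odot>\<^bsub>A\<^esub> x \<oplus>\<^bsub>A\<^esub> s \<odot>\<^bsub>A\<^esub> x"
    and "\<lbrakk>x \<in> carrier A; y \<in> carrier A\<rbrakk> \<Longrightarrow> r \<odot>\<^bsub>A\<^esub> (x \<oplus>\<^bsub>A\<^esub> y) = r \<odot>\<^bsub>A\<^esub> x \<oplus>\<^bsub>A\<^esub> r \<odot>\<^bsub>A\<^esub> y"
    and "x \<in> carrier A \<Longrightarrow> (r * s) \<odot>\<^bsub>A\<^esub> x = r \<odot>\<^bsub>A\<^esub> (s \<odot>\<^bsub>A\<^esub> x)"
    and "x \<in> carrier A \<Longrightarrow> 1 \<odot>\<^bsub>A\<^esub> x = x"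
    and "x \<in> carrier A \<Longrightarrow> 0 \<odot>\<^bsub>A\<^esub> x = \<zero>\<^bsub>A\<^esub>"
    and "r \<odot>\<^bsub>A\<^esub> \<zero>\<^bsub>A\<^esub> = \<zero>\<^bsub>A\<^esub>"
    and "x \<in> carrier A \<Longrightarrow> (- r) \<odot>\<^bsub>A\<^esub> x = \<ominus>\<^bsub>A\<^esub> (r \<odot>\<^bsub>A\<^esub> x)"
    and "\<lbrakk>x \<in> carrier A; y \<in> carrier A\<rbrakk> \<Longrightarrow> (r \<odot>\<^bsub>A\<^esub> x) \<otimes>\<^bsub>A\<^esub> y = r \<odot>\<^bsub>A\<^esub> (x \<otimes>\<^bsub>A\<^esub> y)"
    and "\<lbrakk>x \<in> carrier A; y \<in> carrier A\<rbrakk> \<Longrightarrow> x \<otimes>\<^bsub>A\<^esub> (r \<odot>\<^bsub>A\<^esub> y) = r \<odot>\<^bsub>A\<^esub> (x \<otimes>\<^bsub>A\<^esub> y)"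
proof -
  interpret A: assoc_algebra "ring_of_type_algebra :: 'r ring" A by fact
  show "ring A" "module ring_of_type_algebra A" by unfold_locales
  have a_inv: "\<ominus>\<^bsub>ring_of_type_algebra\<^esub> (r::'r) = - r" for r
    by (rule A.R.minus_equality) auto
  show "x \<in> carrier A \<Longrightarrow> (- r) \<odot>\<^bsub>A\<^esub> x = \<ominus>\<^bsub>A\<^esub> (r \<odot>\<^bsub>A\<^esub> x)"
    using A.smult_l_minus[of r x] by (simp add: a_inv)
qed (use assms assoc_algebra.axioms module.smult_closed module.smult_l_distr module.smult_r_distr
      module.smult_assoc1 module.smult_one module.smult_l_null module.smult_r_null
      assoc_algebra.smult_mult_left assoc_algebra.smult_mult_right
    in \<open>fastforce+\<close>)

section \<open>Monoid algebras\<close>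

lemma monoid_algebra_simps [simp]:
  "carrier (monoid_algebra G) = {f. finite {x. f x \<noteq> 0} \<and> {x. f x \<noteq> 0} \<subseteq> carrier G}"
  "\<one>\<^bsub>monoid_algebra G\<^esub> = (\<lambda>x. if x = \<one>\<^bsub>G\<^esub> then 1 else 0)"
  "\<zero>\<^bsub>monoid_algebra G\<^esub> = (\<lambda>_. 0)"
  "f \<oplus>\<^bsub>monoid_algebra G\<^esub> g = (\<lambda>x. f x + g x)"
  "r \<odot>\<^bsub>monoid_algebra G\<^esub> f = (\<lambda>x. r * f x)"
  by (simp_all add: monoid_algebra_def)

text \<open>Enlarging the index set of the convolution to a finite rectangle that contains the
  supports only adds zero terms. With \<open>S\<close> and \<open>T\<close> free, several products
  can be summed over the same rectangle, which is how distributivity is obtained later.\<close>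

lemma monoid_algebra_mult_apply:
  assumes S: "finite S" "{y. f y \<noteq> 0} \<subseteq> S" and T: "finite T" "{z. g z \<noteq> 0} \<subseteq> T"
  shows "(f \<otimes>\<^bsub>monoid_algebra G\<^esub> g) x =
    (\<Sum>y\<in>S. \<Sum>z\<in>T. if y \<otimes>\<^bsub>G\<^esub> z = x then f y * g z else 0)"
proof -
  have "(f \<otimes>\<^bsub>monoid_algebra G\<^esub> g) x =
     (\<Sum>p\<in>{(y, z). f y \<noteq> 0 \<and> g z \<noteq> 0 \<and> y \<otimes>\<^bsub>G\<^esub> z = x}. f (fst p) * g (snd p))"
    by (simp add: monoid_algebra_def case_prod_unfold)
  also have "\<dots> = (\<Sum>p\<in>S \<times> T. if fst p \<otimes>\<^bsub>G\<^esub> snd p = x then f (fst p) * g (snd p) else 0)"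
    by (rule sum.mono_neutral_cong_left) (use S T in \<open>auto split: if_splits\<close>)
  finally show ?thesis
    by (simp add: sum.cartesian_product case_prod_unfold)
qed

lemma monoid_algebra_mult_supp:
  "{x. (f \<otimes>\<^bsub>monoid_algebra G\<^esub> g) x \<noteq> 0} \<subseteq>
    (\<lambda>(y, z). y \<otimes>\<^bsub>G\<^esub> z) ` ({y. f y \<noteq> 0} \<times> {z. g z \<noteq> 0})"
proof
  fix x assume "x \<in> {x. (f \<otimes>\<^bsub>monoid_algebra G\<^esub> g) x \<noteq> 0}"
  then have "(\<Sum>(y, z)\<in>{(y, z). f y \<noteq> 0 \<and> g z \<noteq> 0 \<and> y \<otimes>\<^bsub>G\<^esub> z = x}. f y * g z) \<noteq> 0"
    by (simp add: monoid_algebra_def)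
  then have "{(y, z). f y \<noteq> 0 \<and> g z \<noteq> 0 \<and> y \<otimes>\<^bsub>G\<^esub> z = x} \<noteq> {}"
    by (metis sum.empty)
  then show "x \<in> (\<lambda>(y, z). y \<otimes>\<^bsub>G\<^esub> z) ` ({y. f y \<noteq> 0} \<times> {z. g z \<noteq> 0})" by auto
qed

text \<open>This pairs a convolution with a test function \<open>\<phi>\<close>. Associativity
  results from two such pairings, the second product entering through \<open>\<phi>\<close>.\<close>

lemma monoid_algebra_mult_sum:
  assumes S: "finite S" "{y. f y \<noteq> 0} \<subseteq> S" and T: "finite T" "{z. g z \<noteq> 0} \<subseteq> T"
    and U: "finite U" "\<And>y z. y \<in> S \<Longrightarrow> z \<in> T \<Longrightarrow> y \<otimes>\<^bsub>G\<^esub> z \<in> U"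
  shows "(\<Sum>x\<in>U. (f \<otimes>\<^bsub>monoid_algebra G\<^esub> g) x * \<phi> x) =
    (\<Sum>y\<in>S. \<Sum>z\<in>T. f y * g z * \<phi> (y \<otimes>\<^bsub>G\<^esub> z))"
proof -
  have "(\<Sum>x\<in>U. (f \<otimes>\<^bsub>monoid_algebra G\<^esub> g) x * \<phi> x) =
     (\<Sum>x\<in>U. \<Sum>y\<in>S. \<Sum>z\<in>T. (if y \<otimes>\<^bsub>G\<^esub> z = x then f y * g z * \<phi> x else 0))"
    by (simp add: monoid_algebra_mult_apply[OF S T] sum_distrib_right if_distrib[of "\<lambda>a. a * _"] cong: if_cong)
  also have "\<dots> = (\<Sum>y\<in>S. \<Sum>z\<in>T. \<Sum>x\<in>U. (if y \<otimes>\<^bsub>G\<^esub> z = x then f y * g z * \<phi> x else 0))"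
    by (subst sum.swap, rule sum.cong[OF refl], subst sum.swap, rule refl)
  also have "\<dots> = (\<Sum>y\<in>S. \<Sum>z\<in>T. f y * g z * \<phi> (y \<otimes>\<^bsub>G\<^esub> z))"
    using U by (intro sum.cong refl) (simp add: sum.delta)
  finally show ?thesis .
qed

lemma (in monoid) monoid_algebra_mult_closed:
  assumes "f \<in> carrier (monoid_algebra G)" "g \<in> carrier (monoid_algebra G)"
  shows "f \<otimes>\<^bsub>monoid_algebra G\<^esub> g \<in> carrier (monoid_algebra G)"
proof -
  note s = monoid_algebra_mult_supp[where f = f and g = g and G = G]
  have "finite ((\<lambda>(y, z). y \<otimes> z) ` ({y. f y \<noteq> 0} \<times> {z. g z \<noteq> 0}))"
    using assms by auto
  moreover have "(\<lambda>(y, z). y \<otimes> z) ` ({y. f y \<noteq> 0} \<times> {z. g z \<noteq> 0}) \<subseteq> carrier G"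
    using assms by auto
  ultimately show ?thesis using s by (auto intro: finite_subset)
qed

text \<open>Both bracketings are brought to the triple sum over the three supports; \<open>V\<close>
  and \<open>W\<close> are finite sets containing the supports of the two inner products.\<close>

lemma (in monoid) monoid_algebra_assoc:
  assumes f: "f \<in> carrier (monoid_algebra G)" and g: "g \<in> carrier (monoid_algebra G)"
    and h: "h \<in> carrier (monoid_algebra G)"
  shows "f \<otimes>\<^bsub>monoid_algebra G\<^esub> g \<otimes>\<^bsub>monoid_algebra G\<^esub> h = f \<otimes>\<^bsub>monoid_algebra G\<^esub> (g \<otimes>\<^bsub>monoid_algebra G\<^esub> h)"
proof
  fix x
  define S T U where STU: "S = {y. f y \<noteq> 0}" "T = {y. g y \<noteq> 0}" "U = {y. h y \<noteq> 0}"
  have fin: "finite S" "finite T" "finite U" and sub: "S \<subseteq> carrier G" "T \<subseteq> carrier G" "U \<subseteq> carrier G"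
    using f g h by (auto simp: STU)
  define V W where "V = (\<lambda>(y, z). y \<otimes> z) ` (S \<times> T)" "W = (\<lambda>(y, z). y \<otimes> z) ` (T \<times> U)"
  have fin': "finite V" "finite W" using fin by (auto simp: V_W_def)
  have V: "{x. (f \<otimes>\<^bsub>monoid_algebra G\<^esub> g) x \<noteq> 0} \<subseteq> V"
    and W: "{x. (g \<otimes>\<^bsub>monoid_algebra G\<^esub> h) x \<noteq> 0} \<subseteq> W"
    unfolding V_W_def STU by (rule monoid_algebra_mult_supp)+
  have "(f \<otimes>\<^bsub>monoid_algebra G\<^esub> g \<otimes>\<^bsub>monoid_algebra G\<^esub> h) x =
    (\<Sum>v\<in>V. (f \<otimes>\<^bsub>monoid_algebra G\<^esub> g) v * (\<Sum>u\<in>U. if v \<otimes> u = x then h u else 0))"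
    by (subst monoid_algebra_mult_apply[OF fin'(1) V fin(3), of h])
       (auto simp: STU sum_distrib_left intro!: sum.cong)
  also have "\<dots> = (\<Sum>s\<in>S. \<Sum>t\<in>T. f s * g t * (\<Sum>u\<in>U. if s \<otimes> t \<otimes> u = x then h u else 0))"
    by (rule monoid_algebra_mult_sum) (use fin fin' in \<open>auto simp: STU V_W_def\<close>)
  also have "\<dots> = (\<Sum>s\<in>S. f s * (\<Sum>t\<in>T. \<Sum>u\<in>U. g t * h u * (if s \<otimes> (t \<otimes> u) = x then 1 else 0)))"
  proof (intro sum.cong refl)
    fix s assume s: "s \<in> S"
    have "f s * g t * (\<Sum>u\<in>U. if s \<otimes> t \<otimes> u = x then h u else 0) =
        f s * (\<Sum>u\<in>U. g t * h u * (if s \<otimes> (t \<otimes> u) = x then 1 else 0))" if t: "t \<in> T" for t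
    proof -
      have "s \<otimes> t \<otimes> u = s \<otimes> (t \<otimes> u)" if "u \<in> U" for u
        using s t that sub by (intro m_assoc) auto
      then show ?thesis
        by (simp add: sum_distrib_left mult.assoc if_distrib cong: if_cong)
    qed
    then show "(\<Sum>t\<in>T. f s * g t * (\<Sum>u\<in>U. if s \<otimes> t \<otimes> u = x then h u else 0)) =
        f s * (\<Sum>t\<in>T. \<Sum>u\<in>U. g t * h u * (if s \<otimes> (t \<otimes> u) = x then 1 else 0))"
      by (simp add: sum_distrib_left)
  qed
  also have "\<dots> = (\<Sum>s\<in>S. f s * (\<Sum>w\<in>W. (g \<otimes>\<^bsub>monoid_algebra G\<^esub> h) w * (if s \<otimes> w = x then 1 else 0)))"
  proof (rule sum.cong[OF refl])
    fix s
    have "(\<Sum>w\<in>W. (g \<otimes>\<^bsub>monoid_algebra G\<^esub> h) w * (if s \<otimes> w = x then 1 else 0)) =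
        (\<Sum>t\<in>T. \<Sum>u\<in>U. g t * h u * (if s \<otimes> (t \<otimes> u) = x then 1 else 0))"
      by (rule monoid_algebra_mult_sum) (use fin fin' in \<open>auto simp: STU V_W_def\<close>)
    then show "f s * (\<Sum>t\<in>T. \<Sum>u\<in>U. g t * h u * (if s \<otimes> (t \<otimes> u) = x then 1 else 0)) =
        f s * (\<Sum>w\<in>W. (g \<otimes>\<^bsub>monoid_algebra G\<^esub> h) w * (if s \<otimes> w = x then 1 else 0))"
      by simp
  qed
  also have "\<dots> = (f \<otimes>\<^bsub>monoid_algebra G\<^esub> (g \<otimes>\<^bsub>monoid_algebra G\<^esub> h)) x"
    by (subst monoid_algebra_mult_apply[OF fin(1) _ fin'(2) W, of f])
       (auto simp: STU sum_distrib_left if_distrib intro!: sum.cong)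
  finally show "(f \<otimes>\<^bsub>monoid_algebra G\<^esub> g \<otimes>\<^bsub>monoid_algebra G\<^esub> h) x = (f \<otimes>\<^bsub>monoid_algebra G\<^esub> (g \<otimes>\<^bsub>monoid_algebra G\<^esub> h)) x" .
qed

definition monomial :: "'g \<Rightarrow> 'r::comm_ring_1 \<Rightarrow> 'g \<Rightarrow> 'r" where
  "monomial x c = (\<lambda>y. if y = x then c else 0)"

lemma monomial_same [simp]: "monomial x c x = c"
  by (simp add: monomial_def)

lemma monomial_supp [simp]: "{x. monomial g c x \<noteq> 0} = (if c = 0 then {} else {g})"
  by (auto simp: monomial_def)

lemma monomial_closed: "g \<in> carrier G \<Longrightarrow> monomial g c \<in> carrier (monoid_algebra G)"
  by simp

lemma monomial_mult:
  "monomial g c \<otimes>\<^bsub>monoid_algebra G\<^esub> monomial h d = monomial (g \<otimes>\<^bsub>G\<^esub> h) (c * d)"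
  by (rule ext, subst monoid_algebra_mult_apply[of "{g}" _ "{h}"]) (auto simp: monomial_def)

lemma (in monoid) monoid_algebra:
  "type_algebra (monoid_algebra G :: ('r::comm_ring_1, 'a \<Rightarrow> 'r) module)"
proof -
  let ?A = "monoid_algebra G :: ('r, 'a \<Rightarrow> 'r) module"
  have fin: "finite {x. f x + g x \<noteq> 0}" if "finite {x. f x \<noteq> 0}" "finite {x. g x \<noteq> 0}" for f g :: "'a \<Rightarrow> 'r"
    by (rule finite_subset[OF _ finite_UnI[OF that]]) auto
  have fin': "finite {x. r * f x \<noteq> 0}" if "finite {x. f x \<noteq> 0}" for r and f :: "'a \<Rightarrow> 'r"
    by (rule finite_subset[OF _ that]) auto
  have ag: "abelian_group ?A"
  proof (rule abelian_groupI)
    fix f assume "f \<in> carrier ?A"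
    then show "\<exists>g\<in>carrier ?A. g \<oplus>\<^bsub>?A\<^esub> f = \<zero>\<^bsub>?A\<^esub>"
      by (intro bexI[of _ "\<lambda>x. - f x"]) auto
  next
    fix f g assume "f \<in> carrier ?A" "g \<in> carrier ?A"
    then show "f \<oplus>\<^bsub>?A\<^esub> g \<in> carrier ?A"
      by (auto intro!: fin) (metis (mono_tags, lifting) add.right_neutral mem_Collect_eq subsetD)
  qed (auto simp: add.assoc add.commute)
  have one: "\<one>\<^bsub>?A\<^esub> = monomial \<one> 1" by (simp add: monomial_def)
  have l_one: "\<one>\<^bsub>?A\<^esub> \<otimes>\<^bsub>?A\<^esub> f = f" if f: "f \<in> carrier ?A" for f
  proof
    fix x
    have "(\<one>\<^bsub>?A\<^esub> \<otimes>\<^bsub>?A\<^esub> f) x = (\<Sum>z\<in>{z. f z \<noteq> 0}. if \<one> \<otimes> z = x then f z else 0)"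
      unfolding one using f by (subst monoid_algebra_mult_apply[of "{\<one>}" _ "{z. f z \<noteq> 0}"]) (auto cong: if_cong)
    also have "\<dots> = (\<Sum>z\<in>{z. f z \<noteq> 0}. if z = x then f z else 0)"
      using f by (intro sum.cong refl) (auto simp: subset_iff)
    finally show "(\<one>\<^bsub>?A\<^esub> \<otimes>\<^bsub>?A\<^esub> f) x = f x" using f by simp
  qed
  have r_one: "f \<otimes>\<^bsub>?A\<^esub> \<one>\<^bsub>?A\<^esub> = f" if f: "f \<in> carrier ?A" for f
  proof
    fix x
    have "(f \<otimes>\<^bsub>?A\<^esub> \<one>\<^bsub>?A\<^esub>) x = (\<Sum>z\<in>{z. f z \<noteq> 0}. if z \<otimes> \<one> = x then f z else 0)"
      unfolding one using f by (subst monoid_algebra_mult_apply[of "{z. f z \<noteq> 0}" _ "{\<one>}"]) (auto cong: if_cong)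
    also have "\<dots> = (\<Sum>z\<in>{z. f z \<noteq> 0}. if z = x then f z else 0)"
      using f by (intro sum.cong refl) (auto simp: subset_iff)
    finally show "(f \<otimes>\<^bsub>?A\<^esub> \<one>\<^bsub>?A\<^esub>) x = f x" using f by simp
  qed
  have mult: "(f \<otimes>\<^bsub>?A\<^esub> g) x = (\<Sum>y\<in>S. \<Sum>z\<in>T. if y \<otimes> z = x then f y * g z else 0)"
    if "finite S" "{y. f y \<noteq> 0} \<subseteq> S" "finite T" "{z. g z \<noteq> 0} \<subseteq> T" for f g S T x
    using that by (rule monoid_algebra_mult_apply)
  have r_distr: "f \<otimes>\<^bsub>?A\<^esub> (g \<oplus>\<^bsub>?A\<^esub> h) = f \<otimes>\<^bsub>?A\<^esub> g \<oplus>\<^bsub>?A\<^esub> f \<otimes>\<^bsub>?A\<^esub> h"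
    and l_distr: "(g \<oplus>\<^bsub>?A\<^esub> h) \<otimes>\<^bsub>?A\<^esub> f = g \<otimes>\<^bsub>?A\<^esub> f \<oplus>\<^bsub>?A\<^esub> h \<otimes>\<^bsub>?A\<^esub> f"
    if f: "f \<in> carrier ?A" and g: "g \<in> carrier ?A" and h: "h \<in> carrier ?A" for f g h
  proof -
    define S T where "S = {x. f x \<noteq> 0}" "T = {x. g x \<noteq> 0} \<union> {x. h x \<noteq> 0}"
    have "finite S" "finite T" "{x. f x \<noteq> 0} \<subseteq> S" "{x. g x \<noteq> 0} \<subseteq> T" "{x. h x \<noteq> 0} \<subseteq> T"
      "{x. g x + h x \<noteq> 0} \<subseteq> T"
      using f g h by (auto simp: S_T_def)
    note * = mult[OF this(1,3,2,4)] mult[OF this(1,3,2,5)] mult[OF this(1,3,2,6)]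
      mult[OF this(2,4,1,3)] mult[OF this(2,5,1,3)] mult[OF this(2,6,1,3)]
    show "f \<otimes>\<^bsub>?A\<^esub> (g \<oplus>\<^bsub>?A\<^esub> h) = f \<otimes>\<^bsub>?A\<^esub> g \<oplus>\<^bsub>?A\<^esub> f \<otimes>\<^bsub>?A\<^esub> h"
      "(g \<oplus>\<^bsub>?A\<^esub> h) \<otimes>\<^bsub>?A\<^esub> f = g \<otimes>\<^bsub>?A\<^esub> f \<oplus>\<^bsub>?A\<^esub> h \<otimes>\<^bsub>?A\<^esub> f"
      by (auto simp: * sum.distrib[symmetric] algebra_simps intro!: ext sum.cong)
  qed
  have one_closed: "\<one>\<^bsub>?A\<^esub> \<in> carrier ?A" by auto
  have "monoid ?A"
    by (rule monoidI) (fact monoid_algebra_mult_closed one_closed monoid_algebra_assoc l_one r_one)+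
  with ag have "ring ?A"
    by (rule ringI) (rule l_distr r_distr; assumption)+
  moreover have "(r \<odot>\<^bsub>?A\<^esub> f) \<otimes>\<^bsub>?A\<^esub> g = r \<odot>\<^bsub>?A\<^esub> (f \<otimes>\<^bsub>?A\<^esub> g)"
    "f \<otimes>\<^bsub>?A\<^esub> (r \<odot>\<^bsub>?A\<^esub> g) = r \<odot>\<^bsub>?A\<^esub> (f \<otimes>\<^bsub>?A\<^esub> g)"
    if f: "f \<in> carrier ?A" and g: "g \<in> carrier ?A" for f g r
  proof -
    define S T where "S = {x. f x \<noteq> 0}" "T = {x. g x \<noteq> 0}"
    have "finite S" "finite T" "{x. f x \<noteq> 0} \<subseteq> S" "{x. g x \<noteq> 0} \<subseteq> T" "{x. r * g x \<noteq> 0} \<subseteq> T"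
      "{x. r * f x \<noteq> 0} \<subseteq> S"
      using f g by (auto simp: S_T_def)
    note * = mult[OF this(1,3,2,4)] mult[OF this(1,3,2,5)] mult[OF this(1,6,2,4)]
    show "(r \<odot>\<^bsub>?A\<^esub> f) \<otimes>\<^bsub>?A\<^esub> g = r \<odot>\<^bsub>?A\<^esub> (f \<otimes>\<^bsub>?A\<^esub> g)"
      "f \<otimes>\<^bsub>?A\<^esub> (r \<odot>\<^bsub>?A\<^esub> g) = r \<odot>\<^bsub>?A\<^esub> (f \<otimes>\<^bsub>?A\<^esub> g)"
      by (auto simp: * sum_distrib_left algebra_simps intro!: ext sum.cong)
  qed
  ultimately show ?thesis
    by (intro type_algebraI) (auto simp: algebra_simps intro!: fin')
qed

lemma monomial_induct [consumes 1, case_names zero monomial add]: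
  assumes f: "f \<in> carrier (monoid_algebra G)"
    and zero: "P (\<lambda>_. 0)"
    and mono: "\<And>x c. x \<in> carrier G \<Longrightarrow> P (monomial x c)"
    and add: "\<And>f g. f \<in> carrier (monoid_algebra G) \<Longrightarrow> g \<in> carrier (monoid_algebra G) \<Longrightarrow>
      P f \<Longrightarrow> P g \<Longrightarrow> P (\<lambda>x. f x + g x)"
  shows "P f"
proof -
  have "P f" if "finite S" "{x. f x \<noteq> 0} \<subseteq> S" "S \<subseteq> carrier G" for S and f
    using that
  proof (induction S arbitrary: f rule: finite_induct)
    case empty
    then have "f = (\<lambda>_. 0)" by auto
    then show ?case using zero by simp
  next
    case (insert a S)
    define g where "g = f(a := 0)"
    have eq: "f = (\<lambda>x. g x + monomial a (f a) x)"
      by (auto simp: g_def monomial_def)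
    have supp: "{x. g x \<noteq> 0} \<subseteq> S"
      using insert by (auto simp: g_def)
    then have "P g" using insert by auto
    then have "P (\<lambda>x. g x + monomial a (f a) x)"
      using insert supp by (intro add mono monomial_closed) (auto intro: finite_subset)
    then show ?case using eq by simp
  qed
  from this[of "{x. f x \<noteq> 0}" f] f show ?thesis by auto
qed

text \<open>An integer coefficient is reached from 0 by steps of 1 and -1, so only generators and
  their negatives have to be treated. This is the induction principle of the free abelian
  group.\<close>

lemma int_monoid_algebra_induct [consumes 1, case_names zero gen uminus add]:
  fixes f :: "'g \<Rightarrow> int"
  assumes f: "f \<in> carrier (monoid_algebra G)"
    and zero: "P (\<lambda>_. 0)"
    and gen: "\<And>x. x \<in> carrier G \<Longrightarrow> P (monomial x 1)"
    and uminus: "\<And>x. x \<in> carrier G \<Longrightarrow> P (monomial x (- 1))"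
    and add: "\<And>f g. f \<in> carrier (monoid_algebra G) \<Longrightarrow> g \<in> carrier (monoid_algebra G) \<Longrightarrow>
      P f \<Longrightarrow> P g \<Longrightarrow> P (\<lambda>x. f x + g x)"
  shows "P f"
  using f
proof (induction rule: monomial_induct)
  case (monomial x c)
  show ?case
  proof (induction c rule: int_induct[where k = 0])
    case base
    then show ?case using zero by (simp add: monomial_def)
  next
    case (step1 i)
    have "monomial x (i + 1) = (\<lambda>y. monomial x i y + monomial x 1 y)" by (auto simp: monomial_def)
    then show ?case using add[OF _ _ step1(2) gen] monomial by simp
  next
    case (step2 i)
    have "monomial x (i - 1) = (\<lambda>y. monomial x i y + monomial x (- 1) y)" by (auto simp: monomial_def)
    then show ?case using add[OF _ _ step2(2) uminus] monomial by simp
  qed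
qed (use zero add in auto)

section \<open>Tensor products\<close>

lemma tensor_gen_eq_monomial: "tensor_gen a b = monomial (a, b) 1"
  by (simp add: tensor_gen_def monomial_def)

text \<open>Universal property of the free abelian group. The target is written multiplicatively, so
  an integer combination becomes a product of integer powers, taken over the finite support.\<close>

lemma (in comm_group) ex_hom_from_free_abelian:
  assumes f: "f \<in> carrier M \<rightarrow> carrier G"
  obtains h where "h \<in> hom (add_monoid (monoid_algebra M :: (int, _) module)) G"
    and "\<And>x. x \<in> carrier M \<Longrightarrow> h (monomial x 1) = f x"
proof
  let ?M = "monoid_algebra M :: (int, _) module"
  define h where "h p = (\<Otimes>x\<in>{x. p x \<noteq> 0}. f x [^] (p x :: int))" for p
  have h_eq: "h p = (\<Otimes>x\<in>S. f x [^] p x)"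
    if "finite S" "{x. p x \<noteq> 0} \<subseteq> S" "S \<subseteq> carrier M" for p S
    unfolding h_def using that f by (intro finprod_mono_neutral_cong_left) auto
  show "h \<in> hom (add_monoid ?M) G"
  proof (rule homI)
    fix p assume "p \<in> carrier (add_monoid ?M)"
    then show "h p \<in> carrier G" unfolding h_def using f by (intro finprod_closed) auto
  next
    fix p q assume pq: "p \<in> carrier (add_monoid ?M)" "q \<in> carrier (add_monoid ?M)"
    define S where "S = {x. p x \<noteq> 0} \<union> {x. q x \<noteq> 0}"
    have S: "finite S" "S \<subseteq> carrier M" using pq by (auto simp: S_def)
    have "h (\<lambda>x. p x + q x) = (\<Otimes>x\<in>S. f x [^] (p x + q x))"
      by (rule h_eq) (use S in \<open>auto simp: S_def\<close>)
    also have "\<dots> = (\<Otimes>x\<in>S. f x [^] p x \<otimes> f x [^] q x)"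
      by (rule finprod_cong') (use S f in \<open>auto simp: int_pow_mult Pi_iff subset_iff\<close>)
    also have "\<dots> = (\<Otimes>x\<in>S. f x [^] p x) \<otimes> (\<Otimes>x\<in>S. f x [^] q x)"
      by (rule finprod_multf) (use S f in auto)
    also have "\<dots> = h p \<otimes> h q"
      by (subst (1 2) h_eq[of S]) (use S in \<open>auto simp: S_def\<close>)
    finally show "h (p \<otimes>\<^bsub>add_monoid ?M\<^esub> q) = h p \<otimes> h q" by simp
  qed
  show "h (monomial x 1) = f x" if x: "x \<in> carrier M" for x
  proof -
    have "h (monomial x 1) = (\<Otimes>y\<in>{x}. f y [^] (monomial x 1 y :: int))"
      by (rule h_eq) (use x in auto)
    also have "\<dots> = f x" using x f by (auto simp: Pi_iff)
    finally show ?thesis .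
  qed
qed

lemma carrier_FactRing: "carrier (R Quot I) = (\<lambda>x. I +>\<^bsub>R\<^esub> x) ` carrier R"
  by (auto simp: FactRing_def A_RCOSETS_def RCOSETS_def a_r_coset_def)

locale tensor_product =
  A: assoc_algebra "ring_of_type_algebra :: 'r::comm_ring_1 ring" A +
  B: assoc_algebra "ring_of_type_algebra :: 'r::comm_ring_1 ring" B
  for A :: "('r::comm_ring_1, 'a) module" and B :: "('r, 'b) module"
begin

abbreviation "F \<equiv> tensor_free A B"
abbreviation "I \<equiv> tensor_ideal A B"
abbreviation "E \<equiv> tensor_algebra A B"
abbreviation "pt \<equiv> pure_tensor A B"

lemma monoid_prod: "monoid (A \<times>\<times> B)"
  by (intro DirProd_monoid A.monoid_axioms B.monoid_axioms)

sublocale F: assoc_algebra "ring_of_type_algebra :: int ring" F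
  unfolding tensor_free_def by (rule monoid.monoid_algebra[OF monoid_prod])

lemma gen_closed [simp]: "a \<in> carrier A \<Longrightarrow> b \<in> carrier B \<Longrightarrow> tensor_gen a b \<in> carrier F"
  by (simp add: tensor_free_def tensor_gen_eq_monomial)

lemma gen_mult: "tensor_gen a b \<otimes>\<^bsub>F\<^esub> tensor_gen a' b' = tensor_gen (a \<otimes>\<^bsub>A\<^esub> a') (b \<otimes>\<^bsub>B\<^esub> b')"
  by (simp add: tensor_free_def tensor_gen_eq_monomial monomial_mult)

lemma F_uminus: "f \<in> carrier F \<Longrightarrow> \<ominus>\<^bsub>F\<^esub> f = (\<lambda>p. - f p)"
  by (rule F.minus_equality) (auto simp: tensor_free_def)

lemma F_minus:
  "f \<in> carrier F \<Longrightarrow> g \<in> carrier F \<Longrightarrow> f \<ominus>\<^bsub>F\<^esub> g = (\<lambda>p. f p - g p)"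
  by (simp add: a_minus_def F_uminus) (simp add: tensor_free_def)

lemma F_minus3:
  assumes "f \<in> carrier F" "g \<in> carrier F" "h \<in> carrier F"
  shows "f \<ominus>\<^bsub>F\<^esub> g \<ominus>\<^bsub>F\<^esub> h = (\<lambda>p. f p - g p - h p)"
proof -
  have "f \<ominus>\<^bsub>F\<^esub> g \<ominus>\<^bsub>F\<^esub> h = (\<lambda>p. (f \<ominus>\<^bsub>F\<^esub> g) p - h p)"
    using assms by (intro F_minus F.minus_closed)
  then show ?thesis using assms by (simp add: F_minus)
qed

lemma free_induct [consumes 1, case_names zero gen uminus add]:
  assumes "f \<in> carrier F" and "P \<zero>\<^bsub>F\<^esub>"
    and gen: "\<And>a b. a \<in> carrier A \<Longrightarrow> b \<in> carrier B \<Longrightarrow> P (tensor_gen a b)"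
    and uminus: "\<And>a b. a \<in> carrier A \<Longrightarrow> b \<in> carrier B \<Longrightarrow> P (\<ominus>\<^bsub>F\<^esub> tensor_gen a b)"
    and "\<And>f g. f \<in> carrier F \<Longrightarrow> g \<in> carrier F \<Longrightarrow> P f \<Longrightarrow> P g \<Longrightarrow> P (f \<oplus>\<^bsub>F\<^esub> g)"
  shows "P f"
  using assms(1) unfolding tensor_free_def
proof (induction rule: int_monoid_algebra_induct)
  case (gen x)
  then show ?case using assms(3) by (auto simp: tensor_gen_eq_monomial)
next
  case (uminus x)
  then have "tensor_gen (fst x) (snd x) \<in> carrier F" by (intro gen_closed) auto
  then have "\<ominus>\<^bsub>F\<^esub> tensor_gen (fst x) (snd x) = monomial x (- 1)"
    by (subst F_uminus) (auto simp: tensor_gen_eq_monomial monomial_def)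
  then show ?case using uminus assms(4)[of "fst x" "snd x"] by auto
next
  case (add f g)
  then show ?case using assms(5)[of f g] by (simp add: tensor_free_def)
qed (use assms(2) in \<open>simp add: tensor_free_def\<close>)

lemma rels_cases:
  assumes "r \<in> tensor_rels A B"
  obtains
    a a' b where "a \<in> carrier A" "a' \<in> carrier A" "b \<in> carrier B"
      "r = tensor_gen (a \<oplus>\<^bsub>A\<^esub> a') b \<ominus>\<^bsub>F\<^esub> tensor_gen a b \<ominus>\<^bsub>F\<^esub> tensor_gen a' b"
  | a b b' where "a \<in> carrier A" "b \<in> carrier B" "b' \<in> carrier B"
      "r = tensor_gen a (b \<oplus>\<^bsub>B\<^esub> b') \<ominus>\<^bsub>F\<^esub> tensor_gen a b \<ominus>\<^bsub>F\<^esub> tensor_gen a b'"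
  | s a b where "a \<in> carrier A" "b \<in> carrier B"
      "r = tensor_gen (s \<odot>\<^bsub>A\<^esub> a) b \<ominus>\<^bsub>F\<^esub> tensor_gen a (s \<odot>\<^bsub>B\<^esub> b)"
proof -
  have "(\<exists>a a' b. a \<in> carrier A \<and> a' \<in> carrier A \<and> b \<in> carrier B \<and>
        r = (\<lambda>p. tensor_gen (a \<oplus>\<^bsub>A\<^esub> a') b p - tensor_gen a b p - tensor_gen a' b p)) \<or>
     (\<exists>a b b'. a \<in> carrier A \<and> b \<in> carrier B \<and> b' \<in> carrier B \<and>
        r = (\<lambda>p. tensor_gen a (b \<oplus>\<^bsub>B\<^esub> b') p - tensor_gen a b p - tensor_gen a b' p)) \<or>
     (\<exists>s a b. a \<in> carrier A \<and> b \<in> carrier B \<and>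
        r = (\<lambda>p. tensor_gen (s \<odot>\<^bsub>A\<^esub> a) b p - tensor_gen a (s \<odot>\<^bsub>B\<^esub> b) p))"
    using assms unfolding tensor_rels_def by blast
  then show thesis
  proof (elim disjE exE conjE)
    fix a a' b
    assume "a \<in> carrier A" "a' \<in> carrier A" "b \<in> carrier B"
      "r = (\<lambda>p. tensor_gen (a \<oplus>\<^bsub>A\<^esub> a') b p - tensor_gen a b p - tensor_gen a' b p)"
    then show thesis by (intro that(1)[of a a' b]) (simp_all add: F_minus3)
  next
    fix a b b'
    assume "a \<in> carrier A" "b \<in> carrier B" "b' \<in> carrier B"
      "r = (\<lambda>p. tensor_gen a (b \<oplus>\<^bsub>B\<^esub> b') p - tensor_gen a b p - tensor_gen a b' p)"
    then show thesis by (intro that(2)[of a b b']) (simp_all add: F_minus3)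
  next
    fix s a b
    assume "a \<in> carrier A" "b \<in> carrier B"
      "r = (\<lambda>p. tensor_gen (s \<odot>\<^bsub>A\<^esub> a) b p - tensor_gen a (s \<odot>\<^bsub>B\<^esub> b) p)"
    then show thesis by (intro that(3)[of a b s]) (simp_all add: F_minus)
  qed
qed

lemma rels_add_left:
  "a \<in> carrier A \<Longrightarrow> a' \<in> carrier A \<Longrightarrow> b \<in> carrier B \<Longrightarrow>
    tensor_gen (a \<oplus>\<^bsub>A\<^esub> a') b \<ominus>\<^bsub>F\<^esub> tensor_gen a b \<ominus>\<^bsub>F\<^esub> tensor_gen a' b \<in> tensor_rels A B"
  unfolding tensor_rels_def by (simp add: F_minus3) blast

lemma rels_add_right:
  "a \<in> carrier A \<Longrightarrow> b \<in> carrier B \<Longrightarrow> b' \<in> carrier B \<Longrightarrow>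
    tensor_gen a (b \<oplus>\<^bsub>B\<^esub> b') \<ominus>\<^bsub>F\<^esub> tensor_gen a b \<ominus>\<^bsub>F\<^esub> tensor_gen a b' \<in> tensor_rels A B"
  unfolding tensor_rels_def by (simp add: F_minus3) blast

lemma rels_smult:
  "a \<in> carrier A \<Longrightarrow> b \<in> carrier B \<Longrightarrow>
    tensor_gen (s \<odot>\<^bsub>A\<^esub> a) b \<ominus>\<^bsub>F\<^esub> tensor_gen a (s \<odot>\<^bsub>B\<^esub> b) \<in> tensor_rels A B"
  unfolding tensor_rels_def by (simp add: F_minus) blast

lemma rels_closed: "r \<in> tensor_rels A B \<Longrightarrow> r \<in> carrier F"
  by (erule rels_cases) simp_all

lemma F_diff_distrib:
  "x \<in> carrier F \<Longrightarrow> y \<in> carrier F \<Longrightarrow> z \<in> carrier F \<Longrightarrow> x \<otimes>\<^bsub>F\<^esub> (y \<ominus>\<^bsub>F\<^esub> z) = x \<otimes>\<^bsub>F\<^esub> y \<ominus>\<^bsub>F\<^esub> x \<otimes>\<^bsub>F\<^esub> z"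
  "x \<in> carrier F \<Longrightarrow> y \<in> carrier F \<Longrightarrow> z \<in> carrier F \<Longrightarrow> (y \<ominus>\<^bsub>F\<^esub> z) \<otimes>\<^bsub>F\<^esub> x = y \<otimes>\<^bsub>F\<^esub> x \<ominus>\<^bsub>F\<^esub> z \<otimes>\<^bsub>F\<^esub> x"
  by (simp_all add: a_minus_def F.r_distr F.l_distr F.r_minus F.l_minus)

text \<open>Multiplying a bilinearity relation by a pure generator gives a relation of the same
  kind, because multiplication in \<open>A\<close> and in \<open>B\<close> is distributive and
  commutes with scalars. This is the reason why the subgroup of relations is an ideal.\<close>

lemma gen_mult_rels:
  assumes "r \<in> tensor_rels A B" "a \<in> carrier A" "b \<in> carrier B"
  shows "tensor_gen a b \<otimes>\<^bsub>F\<^esub> r \<in> tensor_rels A B" "r \<otimes>\<^bsub>F\<^esub> tensor_gen a b \<in> tensor_rels A B"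
  using assms(1)
  by (cases rule: rels_cases; use assms(2,3) in \<open>simp add: F_diff_distrib gen_mult A.r_distr
    A.l_distr B.r_distr B.l_distr A.smult_mult_left A.smult_mult_right B.smult_mult_left B.smult_mult_right
    rels_add_left rels_add_right rels_smult\<close>)+

lemma ideal_subgroup: "subgroup I (add_monoid F)"
  unfolding tensor_ideal_def
  by (rule group.generate_is_subgroup) (use rels_closed in \<open>auto simp: F.add.is_group\<close>)

lemma additive_subgroup_ideal: "additive_subgroup I F"
  by (rule additive_subgroup.intro) (rule ideal_subgroup)

text \<open>Two inductions: the ring element is built from generators, where
  \<open>gen_mult_rels\<close> applies, and the element of the subgroup is built from
  relations.\<close>

lemma ideal_tensor_ideal: "ideal I F"
proof -
  interpret I: additive_subgroup I F by (rule additive_subgroup_ideal)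
  have rel: "x \<otimes>\<^bsub>F\<^esub> r \<in> I \<and> r \<otimes>\<^bsub>F\<^esub> x \<in> I" if x: "x \<in> carrier F" and r: "r \<in> tensor_rels A B" for x r
    using x
  proof (induction rule: free_induct)
    case zero
    then show ?case using r rels_closed by simp
  next
    case (gen a b)
    then show ?case
      using gen_mult_rels[OF r gen] by (auto simp: tensor_ideal_def intro: generate.incl)
  next
    case (uminus a b)
    have "tensor_gen a b \<otimes>\<^bsub>F\<^esub> r \<in> I" "r \<otimes>\<^bsub>F\<^esub> tensor_gen a b \<in> I"
      using gen_mult_rels[OF r uminus] by (auto simp: tensor_ideal_def intro: generate.incl)
    then show ?case using uminus rels_closed[OF r] by (simp add: F.l_minus F.r_minus)
  next
    case (add f g)
    then show ?case using rels_closed[OF r] by (simp add: F.l_distr F.r_distr)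
  qed
  have "x \<otimes>\<^bsub>F\<^esub> i \<in> I \<and> i \<otimes>\<^bsub>F\<^esub> x \<in> I" if i: "i \<in> I" and x: "x \<in> carrier F" for i x
    using i unfolding tensor_ideal_def
  proof (induction rule: generate.induct)
    case one
    then show ?case using x I.zero_closed by (simp add: tensor_ideal_def)
  next
    case (incl r)
    then show ?case using rel x by (simp add: tensor_ideal_def)
  next
    case (inv r)
    have "inv\<^bsub>add_monoid F\<^esub> r = \<ominus>\<^bsub>F\<^esub> r" by (simp add: a_inv_def)
    then show ?case
      using rel[OF x inv] x rels_closed[OF inv] I.a_inv_closed
      by (simp add: F.l_minus F.r_minus tensor_ideal_def)
  next
    case (eng h1 h2)
    have "h1 \<in> carrier F" "h2 \<in> carrier F"
      using eng(1,2) I.a_Hcarr by (auto simp: tensor_ideal_def)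
    then show ?case
      using eng x I.a_closed by (simp add: F.l_distr F.r_distr tensor_ideal_def)
  qed
  then show ?thesis
    by (intro idealI F.ring_axioms ideal_subgroup) auto
qed

sublocale I: ideal I F by (rule ideal_tensor_ideal)

sublocale E: ring E
  unfolding tensor_algebra_def by (rule I.quotient_is_ring)

sublocale coset: ring_hom_ring F E "(+>\<^bsub>F\<^esub>) I"
  unfolding tensor_algebra_def by (rule I.rcos_ring_hom_ring)

lemma coset_eqI:
  "f \<in> carrier F \<Longrightarrow> g \<in> carrier F \<Longrightarrow> f \<ominus>\<^bsub>F\<^esub> g \<in> I \<Longrightarrow> I +>\<^bsub>F\<^esub> f = I +>\<^bsub>F\<^esub> g"
  using F.quotient_eq_iff_same_a_r_cos[OF ideal_tensor_ideal] by blast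

lemma rels_in_ideal: "r \<in> tensor_rels A B \<Longrightarrow> r \<in> I"
  unfolding tensor_ideal_def by (rule generate.incl)

lemma pt_closed [simp, intro]: "a \<in> carrier A \<Longrightarrow> b \<in> carrier B \<Longrightarrow> pt a b \<in> carrier E"
  unfolding pure_tensor_def by simp

lemma pt_add_left:
  assumes "a \<in> carrier A" "a' \<in> carrier A" "b \<in> carrier B"
  shows "pt (a \<oplus>\<^bsub>A\<^esub> a') b = pt a b \<oplus>\<^bsub>E\<^esub> pt a' b"
proof -
  have "I +>\<^bsub>F\<^esub> tensor_gen (a \<oplus>\<^bsub>A\<^esub> a') b = I +>\<^bsub>F\<^esub> (tensor_gen a b \<oplus>\<^bsub>F\<^esub> tensor_gen a' b)"
    using rels_in_ideal[OF rels_add_left[OF assms]] assms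
    by (intro coset_eqI) (simp_all add: a_minus_def F.minus_add F.a_assoc)
  then show ?thesis using assms by (simp add: pure_tensor_def)
qed

lemma pt_add_right:
  assumes "a \<in> carrier A" "b \<in> carrier B" "b' \<in> carrier B"
  shows "pt a (b \<oplus>\<^bsub>B\<^esub> b') = pt a b \<oplus>\<^bsub>E\<^esub> pt a b'"
proof -
  have "I +>\<^bsub>F\<^esub> tensor_gen a (b \<oplus>\<^bsub>B\<^esub> b') = I +>\<^bsub>F\<^esub> (tensor_gen a b \<oplus>\<^bsub>F\<^esub> tensor_gen a b')"
    using rels_in_ideal[OF rels_add_right[OF assms]] assms
    by (intro coset_eqI) (simp_all add: a_minus_def F.minus_add F.a_assoc)
  then show ?thesis using assms by (simp add: pure_tensor_def)
qed

lemma pt_smult: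
  "a \<in> carrier A \<Longrightarrow> b \<in> carrier B \<Longrightarrow> pt (s \<odot>\<^bsub>A\<^esub> a) b = pt a (s \<odot>\<^bsub>B\<^esub> b)"
  unfolding pure_tensor_def using rels_in_ideal[OF rels_smult]
  by (intro coset_eqI) simp_all

lemma pt_mult:
  assumes "a \<in> carrier A" "a' \<in> carrier A" "b \<in> carrier B" "b' \<in> carrier B"
  shows "pt a b \<otimes>\<^bsub>E\<^esub> pt a' b' = pt (a \<otimes>\<^bsub>A\<^esub> a') (b \<otimes>\<^bsub>B\<^esub> b')"
  using assms coset.hom_mult[of "tensor_gen a b" "tensor_gen a' b'"]
  by (simp add: pure_tensor_def gen_mult del: coset.hom_mult)

lemma pt_one: "pt \<one>\<^bsub>A\<^esub> \<one>\<^bsub>B\<^esub> = \<one>\<^bsub>E\<^esub>"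
proof -
  have "\<one>\<^bsub>F\<^esub> = tensor_gen \<one>\<^bsub>A\<^esub> \<one>\<^bsub>B\<^esub>" by (simp add: tensor_free_def tensor_gen_def)
  then show ?thesis using coset.hom_one by (simp add: pure_tensor_def)
qed

lemma pt_zero_left: "b \<in> carrier B \<Longrightarrow> pt \<zero>\<^bsub>A\<^esub> b = \<zero>\<^bsub>E\<^esub>"
  using pt_add_left[of "\<zero>\<^bsub>A\<^esub>" "\<zero>\<^bsub>A\<^esub>" b] by simp

lemma pt_uminus_left: "a \<in> carrier A \<Longrightarrow> b \<in> carrier B \<Longrightarrow> pt (\<ominus>\<^bsub>A\<^esub> a) b = \<ominus>\<^bsub>E\<^esub> pt a b"
  using pt_add_left[of "\<ominus>\<^bsub>A\<^esub> a" a b] by (intro E.minus_equality[symmetric]) (auto simp: pt_zero_left A.l_neg)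

lemma tensor_cases:
  assumes "z \<in> carrier E"
  obtains f where "f \<in> carrier F" "z = I +>\<^bsub>F\<^esub> f"
proof -
  have "carrier E = (\<lambda>f. I +>\<^bsub>F\<^esub> f) ` carrier F"
    unfolding tensor_algebra_def by (rule carrier_FactRing)
  then show thesis using assms that by blast
qed

text \<open>Zero and negatives need no case of their own, since \<open>0 = 0 \<otimes> 0\<close> and
  \<open>-(a \<otimes> b) = (-a) \<otimes> b\<close> are pure tensors.\<close>

lemma tensor_induct [consumes 1, case_names pure add]:
  assumes z: "z \<in> carrier E"
    and pure: "\<And>a b. a \<in> carrier A \<Longrightarrow> b \<in> carrier B \<Longrightarrow> P (pt a b)"
    and add: "\<And>x y. x \<in> carrier E \<Longrightarrow> y \<in> carrier E \<Longrightarrow> P x \<Longrightarrow> P y \<Longrightarrow> P (x \<oplus>\<^bsub>E\<^esub> y)"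
  shows "P z"
proof -
  obtain f where f: "f \<in> carrier F" "z = I +>\<^bsub>F\<^esub> f"
    using z by (rule tensor_cases)
  from f(1) have "P (I +>\<^bsub>F\<^esub> f)"
  proof (induction rule: free_induct)
    case zero
    then show ?case using pure[of "\<zero>\<^bsub>A\<^esub>" "\<zero>\<^bsub>B\<^esub>"] by (simp add: pt_zero_left)
  next
    case (gen a b)
    then show ?case using pure[of a b] by (simp add: pure_tensor_def)
  next
    case (uminus a b)
    then show ?case using pure[of "\<ominus>\<^bsub>A\<^esub> a" b] by (simp add: pt_uminus_left) (simp add: pure_tensor_def)
  next
    case (add f g)
    then show ?case using assms(3)[of "I +>\<^bsub>F\<^esub> f" "I +>\<^bsub>F\<^esub> g"] by simp
  qed
  then show ?thesis using f by simp
qed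

text \<open>Universal property of the tensor product: a balanced biadditive map kills the three
  kinds of relations, hence the subgroup that they generate, and so its extension to the free group
  factors through the quotient.\<close>

lemma ex_tensor_hom:
  assumes C: "comm_group C"
    and closed: "\<And>a b. a \<in> carrier A \<Longrightarrow> b \<in> carrier B \<Longrightarrow> f a b \<in> carrier C"
    and add_left: "\<And>a a' b. a \<in> carrier A \<Longrightarrow> a' \<in> carrier A \<Longrightarrow> b \<in> carrier B \<Longrightarrow>
      f (a \<oplus>\<^bsub>A\<^esub> a') b = f a b \<otimes>\<^bsub>C\<^esub> f a' b"
    and add_right: "\<And>a b b'. a \<in> carrier A \<Longrightarrow> b \<in> carrier B \<Longrightarrow> b' \<in> carrier B \<Longrightarrow>
      f a (b \<oplus>\<^bsub>B\<^esub> b') = f a b \<otimes>\<^bsub>C\<^esub> f a b'"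
    and smult: "\<And>s a b. a \<in> carrier A \<Longrightarrow> b \<in> carrier B \<Longrightarrow> f (s \<odot>\<^bsub>A\<^esub> a) b = f a (s \<odot>\<^bsub>B\<^esub> b)"
  obtains h where "h \<in> hom (add_monoid E) C"
    and "\<And>a b. a \<in> carrier A \<Longrightarrow> b \<in> carrier B \<Longrightarrow> h (pt a b) = f a b"
proof -
  interpret C: comm_group C by fact
  obtain h0 where h0: "h0 \<in> hom (add_monoid F) C"
    and h0_gen: "\<And>a b. a \<in> carrier A \<Longrightarrow> b \<in> carrier B \<Longrightarrow> h0 (tensor_gen a b) = f a b"
  proof (rule C.ex_hom_from_free_abelian)
    show "case_prod f \<in> carrier (A \<times>\<times> B) \<rightarrow> carrier C" using closed by auto
    fix h assume h: "h \<in> hom (add_monoid (monoid_algebra (A \<times>\<times> B) :: (int, _) module)) C"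
      "\<And>x. x \<in> carrier (A \<times>\<times> B) \<Longrightarrow> h (monomial x 1) = (case x of (a, b) \<Rightarrow> f a b)"
    show thesis
    proof (rule that)
      show "h \<in> hom (add_monoid F) C" using h(1) unfolding tensor_free_def .
      show "h (tensor_gen a b) = f a b" if "a \<in> carrier A" "b \<in> carrier B" for a b
        using h(2)[of "(a, b)"] that by (simp add: tensor_gen_eq_monomial)
    qed
  qed
  interpret h0: group_hom "add_monoid F" C h0
    by (intro group_hom.intro group_hom_axioms.intro h0 F.add.is_group C.is_group)
  have h0_minus: "h0 (x \<ominus>\<^bsub>F\<^esub> y) = h0 x \<otimes>\<^bsub>C\<^esub> inv\<^bsub>C\<^esub> h0 y" if "x \<in> carrier F" "y \<in> carrier F" for x y
    using that h0.hom_mult[of x "\<ominus>\<^bsub>F\<^esub> y"] h0.hom_inv[of y] by (simp add: a_minus_def a_inv_def)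
  have cancel: "x \<otimes>\<^bsub>C\<^esub> y \<otimes>\<^bsub>C\<^esub> inv\<^bsub>C\<^esub> x \<otimes>\<^bsub>C\<^esub> inv\<^bsub>C\<^esub> y = \<one>\<^bsub>C\<^esub>"
    if "x \<in> carrier C" "y \<in> carrier C" for x y
    using that by (metis C.inv_closed C.inv_mult C.m_assoc C.m_closed C.r_inv)
  have rel: "h0 r = \<one>\<^bsub>C\<^esub>" if "r \<in> tensor_rels A B" for r
    using that
    by (cases rule: rels_cases)
       (simp_all add: h0_minus h0_gen add_left add_right smult closed cancel)
  have I: "i \<in> carrier F \<and> h0 i = \<one>\<^bsub>C\<^esub>" if "i \<in> I" for i
    using that unfolding tensor_ideal_def
  proof (induction rule: generate.induct)
    case (inv r)
    then show ?case using rels_closed[OF inv] rel[OF inv] h0.hom_inv[of r]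
      by simp
  qed (use rel rels_closed h0.hom_mult h0.hom_one in auto)
  \<comment> \<open>The value is read off from an arbitrary representative of the coset; it is
    independent of the choice because \<open>h0\<close> is trivial on the ideal.\<close>
  define h where "h Z = h0 (SOME p. p \<in> Z)" for Z
  have h: "h (I +>\<^bsub>F\<^esub> p) = h0 p" if p: "p \<in> carrier F" for p
  proof -
    have "p \<in> I +>\<^bsub>F\<^esub> p" by (rule I.a_rcos_self[OF p])
    then have "(SOME q. q \<in> I +>\<^bsub>F\<^esub> p) \<in> I +>\<^bsub>F\<^esub> p"
      by (rule someI[of "\<lambda>q. q \<in> I +>\<^bsub>F\<^esub> p"])
    then obtain i where "i \<in> I" "(SOME q. q \<in> I +>\<^bsub>F\<^esub> p) = i \<oplus>\<^bsub>F\<^esub> p"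
      by (auto simp: a_r_coset_def')
    then show ?thesis using I[of i] p h0.hom_mult[of i p] h0.hom_closed[of p] by (simp add: h_def)
  qed
  have "h \<in> hom (add_monoid E) C"
  proof (rule homI)
    fix x assume "x \<in> carrier (add_monoid E)"
    then obtain p where "p \<in> carrier F" "x = I +>\<^bsub>F\<^esub> p"
      using tensor_cases[of x thesis] by auto
    then show "h x \<in> carrier C" using h0.hom_closed[of p] by (simp add: h)
  next
    fix x y assume "x \<in> carrier (add_monoid E)" "y \<in> carrier (add_monoid E)"
    then obtain p q where "p \<in> carrier F" "x = I +>\<^bsub>F\<^esub> p" "q \<in> carrier F" "y = I +>\<^bsub>F\<^esub> q"
      using tensor_cases[of x thesis] tensor_cases[of y thesis] by auto
    then show "h (x \<otimes>\<^bsub>add_monoid E\<^esub> y) = h x \<otimes>\<^bsub>C\<^esub> h y"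
      using h[of "p \<oplus>\<^bsub>F\<^esub> q"] h0.hom_mult[of p q] by (simp add: h)
  qed
  moreover have "h (pt a b) = f a b" if "a \<in> carrier A" "b \<in> carrier B" for a b
    using that by (simp add: pure_tensor_def h h0_gen)
  ultimately show ?thesis by (rule that)
qed

end

section \<open>Linear combinations and bases\<close>

lemma hom_finsum:
  assumes "abelian_group A" "abelian_group B" "h \<in> hom (add_monoid A) (add_monoid B)"
    and f: "f \<in> I \<rightarrow> carrier A"
  shows "h (\<Oplus>\<^bsub>A\<^esub>i\<in>I. f i) = (\<Oplus>\<^bsub>B\<^esub>i\<in>I. h (f i))"
proof -
  interpret A: abelian_group A by fact
  interpret B: abelian_group B by fact
  interpret h: abelian_group_hom A B h
    by (rule abelian_group_homI)
       (use assms A.a_group B.a_group A.abelian_group_axioms B.abelian_group_axioms in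
         \<open>auto intro!: group_hom.intro group_hom_axioms.intro\<close>)
  show ?thesis using f by (induction I rule: infinite_finite_induct) (auto simp: Pi_iff)
qed

definition lin_comb :: "('r, 'a) module \<Rightarrow> 'i set \<Rightarrow> ('i \<Rightarrow> 'a) \<Rightarrow> ('i \<Rightarrow> 'r) \<Rightarrow> 'a" where
  "lin_comb A I b c = (\<Oplus>\<^bsub>A\<^esub>i\<in>I. c i \<odot>\<^bsub>A\<^esub> b i)"

text \<open>Bases are indexed families over a commutative ring and not subsets of a vector space, so
  that one index set can be carried along \<open>k\<close>, \<open>k[[t]]\<close>,
  \<open>k((t))\<close> and its closure. Coefficients outside the index set are left arbitrary,
  hence uniqueness is claimed on it only.\<close>

definition basis_family :: "('r::zero, 'a) module \<Rightarrow> 'i set \<Rightarrow> ('i \<Rightarrow> 'a) \<Rightarrow> bool" where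
  "basis_family A I b \<longleftrightarrow> finite I \<and> b \<in> I \<rightarrow> carrier A \<and>
     (\<forall>x\<in>carrier A. \<exists>c. x = lin_comb A I b c) \<and>
     (\<forall>c. lin_comb A I b c = \<zero>\<^bsub>A\<^esub> \<longrightarrow> (\<forall>i\<in>I. c i = 0))"

lemma basis_familyD:
  assumes "basis_family A I b"
  shows "finite I" "b \<in> I \<rightarrow> carrier A" "i \<in> I \<Longrightarrow> b i \<in> carrier A"
    and "x \<in> carrier A \<Longrightarrow> \<exists>c. x = lin_comb A I b c"
    and "lin_comb A I b c = \<zero>\<^bsub>A\<^esub> \<Longrightarrow> i \<in> I \<Longrightarrow> c i = 0"
  using assms by (auto simp: basis_family_def)

context
  fixes A :: "('r::comm_ring_1, 'a) module"
  assumes A: "type_algebra A"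
begin

interpretation A: assoc_algebra "ring_of_type_algebra :: 'r ring" A by (rule A)

lemma type_algebra_abelian_group: "abelian_group A" by (rule A.abelian_group_axioms)

lemma lin_comb_closed [intro]: "b \<in> I \<rightarrow> carrier A \<Longrightarrow> lin_comb A I b c \<in> carrier A"
  unfolding lin_comb_def by (rule A.finsum_closed) auto

lemma lin_comb_add:
  assumes "b \<in> I \<rightarrow> carrier A"
  shows "lin_comb A I b (\<lambda>i. c i + d i) = lin_comb A I b c \<oplus>\<^bsub>A\<^esub> lin_comb A I b d"
proof -
  have "lin_comb A I b (\<lambda>i. c i + d i) = (\<Oplus>\<^bsub>A\<^esub>i\<in>I. c i \<odot>\<^bsub>A\<^esub> b i \<oplus>\<^bsub>A\<^esub> d i \<odot>\<^bsub>A\<^esub> b i)"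
    unfolding lin_comb_def using assms
    by (intro A.finsum_cong') (auto simp: Pi_iff type_algebraD(4)[OF A])
  also have "\<dots> = lin_comb A I b c \<oplus>\<^bsub>A\<^esub> lin_comb A I b d"
    unfolding lin_comb_def using assms by (intro A.finsum_addf) auto
  finally show ?thesis .
qed

lemma lin_comb_smult:
  assumes "b \<in> I \<rightarrow> carrier A"
  shows "lin_comb A I b (\<lambda>i. r * c i) = r \<odot>\<^bsub>A\<^esub> lin_comb A I b c"
proof -
  have "(\<lambda>x. r \<odot>\<^bsub>A\<^esub> x) \<in> hom (add_monoid A) (add_monoid A)"
    by (rule homI) (auto simp: type_algebraD(5)[OF A])
  then have "r \<odot>\<^bsub>A\<^esub> lin_comb A I b c = (\<Oplus>\<^bsub>A\<^esub>i\<in>I. r \<odot>\<^bsub>A\<^esub> (c i \<odot>\<^bsub>A\<^esub> b i))"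
    unfolding lin_comb_def using assms
    by (intro hom_finsum A.abelian_group_axioms) auto
  also have "\<dots> = lin_comb A I b (\<lambda>i. r * c i)"
    unfolding lin_comb_def using assms
    by (intro A.finsum_cong') (auto simp: Pi_iff type_algebraD(6)[OF A])
  finally show ?thesis by simp
qed

lemma lin_comb_uminus:
  assumes "b \<in> I \<rightarrow> carrier A"
  shows "lin_comb A I b (\<lambda>i. - c i) = \<ominus>\<^bsub>A\<^esub> lin_comb A I b c"
  using lin_comb_smult[OF assms, of "- 1" c] lin_comb_closed[OF assms]
    type_algebraD(10)[OF A, of "lin_comb A I b c" 1] by (simp add: type_algebraD(7)[OF A])

lemma lin_comb_diff:
  assumes "b \<in> I \<rightarrow> carrier A"
  shows "lin_comb A I b (\<lambda>i. c i - d i) = lin_comb A I b c \<ominus>\<^bsub>A\<^esub> lin_comb A I b d"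
  using lin_comb_add[OF assms, of c "\<lambda>i. - d i"] lin_comb_uminus[OF assms, of d]
  by (simp add: a_minus_def)

lemma lin_comb_cong:
  assumes "b \<in> I \<rightarrow> carrier A" "\<And>i. i \<in> I \<Longrightarrow> c i = d i" "\<And>i. i \<in> I \<Longrightarrow> b i = b' i"
  shows "lin_comb A I b c = lin_comb A I b' d"
  unfolding lin_comb_def using assms by (intro A.finsum_cong') (auto simp: Pi_iff)

lemma lin_comb_delta:
  assumes "finite I" "i \<in> I" "b \<in> I \<rightarrow> carrier A"
  shows "lin_comb A I b (\<lambda>j. if j = i then r else 0) = r \<odot>\<^bsub>A\<^esub> b i"
proof -
  have "lin_comb A I b (\<lambda>j. if j = i then r else 0) =
      (\<Oplus>\<^bsub>A\<^esub>j\<in>I. if i = j then r \<odot>\<^bsub>A\<^esub> b j else \<zero>\<^bsub>A\<^esub>)"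
    unfolding lin_comb_def using assms
    by (intro A.finsum_cong') (auto simp: Pi_iff type_algebraD(8)[OF A])
  also have "\<dots> = r \<odot>\<^bsub>A\<^esub> b i"
    using assms by (intro A.finsum_singleton) auto
  finally show ?thesis .
qed

lemma lin_comb_unique:
  assumes b: "basis_family A I b" and eq: "lin_comb A I b c = lin_comb A I b d" and "i \<in> I"
  shows "c i = d i"
proof -
  note bc = basis_familyD(2)[OF b]
  have "lin_comb A I b (\<lambda>i. c i - d i) = \<zero>\<^bsub>A\<^esub>"
    using eq lin_comb_closed[OF bc, of d]
    by (simp add: lin_comb_diff[OF bc] a_minus_def A.r_neg)
  then show ?thesis using basis_familyD(5)[OF b _ \<open>i \<in> I\<close>] by force
qed

end

text \<open>Stated for maps that are semilinear along \<open>\<phi>\<close>: the identity gives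
  linear maps, a change of scalars gives maps such as
  \<open>a \<mapsto> 1 \<otimes> a\<close>.\<close>

lemma lin_comb_image:
  assumes A: "type_algebra A" and B: "type_algebra B"
    and h: "h \<in> hom (add_monoid A) (add_monoid B)"
    and smult: "\<And>r x. x \<in> carrier A \<Longrightarrow> h (r \<odot>\<^bsub>A\<^esub> x) = \<phi> r \<odot>\<^bsub>B\<^esub> h x"
    and b: "b \<in> I \<rightarrow> carrier A"
  shows "h (lin_comb A I b c) = lin_comb B I (\<lambda>i. h (b i)) (\<lambda>i. \<phi> (c i))"
proof -
  have hc: "h x \<in> carrier B" if "x \<in> carrier A" for x using hom_in_carrier[OF h] that by simp
  have "h (lin_comb A I b c) = (\<Oplus>\<^bsub>B\<^esub>i\<in>I. h (c i \<odot>\<^bsub>A\<^esub> b i))"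
    unfolding lin_comb_def using b type_algebraD(3)[OF A]
    by (intro hom_finsum[OF _ _ h] type_algebra_abelian_group A B) auto
  also have "\<dots> = lin_comb B I (\<lambda>i. h (b i)) (\<lambda>i. \<phi> (c i))"
  proof -
    interpret B: ring B by (rule type_algebraD(1)[OF B])
    show ?thesis unfolding lin_comb_def using b hc type_algebraD(3)[OF B] smult
      by (intro B.finsum_cong') (auto simp: Pi_iff)
  qed
  finally show ?thesis .
qed

text \<open>Independence of the images recovers the coefficients of a preimage, so a family that
  merely spans the source is a basis and the map is bijective. For tensor products this is the
  useful direction: spanning families are evident there, while independence is not.\<close>

lemma bij_betw_of_basis:
  assumes A: "type_algebra A" and B: "type_algebra B"
    and h: "h \<in> hom (add_monoid A) (add_monoid B)"
    and smult: "\<And>r x. x \<in> carrier A \<Longrightarrow> h (r \<odot>\<^bsub>A\<^esub> x) = r \<odot>\<^bsub>B\<^esub> h x"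
    and b: "b \<in> I \<rightarrow> carrier A" and span: "\<And>x. x \<in> carrier A \<Longrightarrow> \<exists>c. x = lin_comb A I b c"
    and basis: "basis_family B I (\<lambda>i. h (b i))"
  shows "bij_betw h (carrier A) (carrier B)" "basis_family A I b"
proof -
  have img: "h (lin_comb A I b c) = lin_comb B I (\<lambda>i. h (b i)) c" for c
    using lin_comb_image[OF A B h, of "\<lambda>r. r"] smult b by simp
  have inj: "inj_on h (carrier A)"
  proof (rule inj_onI)
    fix x y assume xy: "x \<in> carrier A" "y \<in> carrier A" "h x = h y"
    obtain c d where cd: "x = lin_comb A I b c" "y = lin_comb A I b d" using span xy by meson
    have "c i = d i" if "i \<in> I" for i
      using xy(3) that unfolding cd img by (intro lin_comb_unique[OF B basis]) auto
    then show "x = y" unfolding cd by (intro lin_comb_cong[OF A b]) auto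
  qed
  moreover have "h ` carrier A = carrier B"
  proof safe
    fix x assume "x \<in> carrier A" then show "h x \<in> carrier B" using hom_in_carrier[OF h] by simp
  next
    fix y assume "y \<in> carrier B"
    then obtain c where "y = lin_comb B I (\<lambda>i. h (b i)) c" using basis_familyD(4)[OF basis] by blast
    then have "y = h (lin_comb A I b c)" by (simp add: img)
    then show "y \<in> h ` carrier A" using lin_comb_closed[OF A b] by blast
  qed
  ultimately show "bij_betw h (carrier A) (carrier B)" by (simp add: bij_betw_def)
  have "c i = 0" if c: "lin_comb A I b c = \<zero>\<^bsub>A\<^esub>" and i: "i \<in> I" for c i
  proof -
    have "h \<zero>\<^bsub>A\<^esub> = \<zero>\<^bsub>B\<^esub>"
      using group_hom.hom_one[of "add_monoid A" "add_monoid B" h]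
        abelian_group.a_group[OF type_algebra_abelian_group[OF A]]
        abelian_group.a_group[OF type_algebra_abelian_group[OF B]] h
      by (simp add: group_hom_def group_hom_axioms_def)
    then show ?thesis using img[of c] c basis_familyD(5)[OF basis _ i, of c] by simp
  qed
  then show "basis_family A I b"
    unfolding basis_family_def using b span basis_familyD(1)[OF basis] by blast
qed

lemma basis_family_image:
  assumes A: "type_algebra A" and B: "type_algebra B"
    and h: "h \<in> hom (add_monoid A) (add_monoid B)"
    and smult: "\<And>r x. x \<in> carrier A \<Longrightarrow> h (r \<odot>\<^bsub>A\<^esub> x) = r \<odot>\<^bsub>B\<^esub> h x"
    and bij: "bij_betw h (carrier A) (carrier B)"
    and basis: "basis_family A I b"
  shows "basis_family B I (\<lambda>i. h (b i))"
proof -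
  note b = basis_familyD(2)[OF basis]
  have img: "h (lin_comb A I b c) = lin_comb B I (\<lambda>i. h (b i)) c" for c
    using lin_comb_image[OF A B h, of "\<lambda>r. r"] smult b by simp
  have hc: "h x \<in> carrier B" if "x \<in> carrier A" for x using bij that by (auto simp: bij_betw_def)
  have "\<exists>c. y = lin_comb B I (\<lambda>i. h (b i)) c" if "y \<in> carrier B" for y
  proof -
    have "y \<in> h ` carrier A" using bij that by (simp add: bij_betw_def)
    then obtain x where x: "x \<in> carrier A" "y = h x" by blast
    then obtain c where "x = lin_comb A I b c" using basis_familyD(4)[OF basis] by blast
    then show ?thesis using x img by auto
  qed
  moreover have "c i = 0" if c: "lin_comb B I (\<lambda>i. h (b i)) c = \<zero>\<^bsub>B\<^esub>" and i: "i \<in> I" for c i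
  proof -
    interpret A: ring A by (rule type_algebraD(1)[OF A])
    have "h \<zero>\<^bsub>A\<^esub> = \<zero>\<^bsub>B\<^esub>"
      using group_hom.hom_one[of "add_monoid A" "add_monoid B" h]
        abelian_group.a_group[OF type_algebra_abelian_group[OF A]]
        abelian_group.a_group[OF type_algebra_abelian_group[OF B]] h
      by (simp add: group_hom_def group_hom_axioms_def)
    then have "h (lin_comb A I b c) = h \<zero>\<^bsub>A\<^esub>" using c img by simp
    then have "lin_comb A I b c = \<zero>\<^bsub>A\<^esub>"
      using bij lin_comb_closed[OF A b] by (auto simp: bij_betw_def inj_on_def)
    then show ?thesis using basis_familyD(5)[OF basis _ i] by blast
  qed
  ultimately show ?thesis
    unfolding basis_family_def using basis_familyD(1,3)[OF basis] hc by auto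
qed

section \<open>Homomorphisms of algebras\<close>

lemma algebra_homD:
  assumes "h \<in> algebra_hom A B"
  shows "h \<in> hom (add_monoid A) (add_monoid B)" "h \<in> Ring.ring_hom A B"
    "x \<in> carrier A \<Longrightarrow> h x \<in> carrier B"
    "x \<in> carrier A \<Longrightarrow> h (r \<odot>\<^bsub>A\<^esub> x) = r \<odot>\<^bsub>B\<^esub> h x"
    "x \<in> carrier A \<Longrightarrow> y \<in> carrier A \<Longrightarrow> h (x \<oplus>\<^bsub>A\<^esub> y) = h x \<oplus>\<^bsub>B\<^esub> h y"
    "x \<in> carrier A \<Longrightarrow> y \<in> carrier A \<Longrightarrow> h (x \<otimes>\<^bsub>A\<^esub> y) = h x \<otimes>\<^bsub>B\<^esub> h y"
    "h \<one>\<^bsub>A\<^esub> = \<one>\<^bsub>B\<^esub>"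
  using assms by (auto simp: algebra_hom_def Ring.ring_hom_def hom_def)

lemma algebra_homI:
  assumes "\<And>x. x \<in> carrier A \<Longrightarrow> h x \<in> carrier B"
    "\<And>x y. x \<in> carrier A \<Longrightarrow> y \<in> carrier A \<Longrightarrow> h (x \<oplus>\<^bsub>A\<^esub> y) = h x \<oplus>\<^bsub>B\<^esub> h y"
    "\<And>x y. x \<in> carrier A \<Longrightarrow> y \<in> carrier A \<Longrightarrow> h (x \<otimes>\<^bsub>A\<^esub> y) = h x \<otimes>\<^bsub>B\<^esub> h y"
    "h \<one>\<^bsub>A\<^esub> = \<one>\<^bsub>B\<^esub>"
    "\<And>r x. x \<in> carrier A \<Longrightarrow> h (r \<odot>\<^bsub>A\<^esub> x) = r \<odot>\<^bsub>B\<^esub> h x"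
  shows "h \<in> algebra_hom A B"
  using assms by (auto simp: algebra_hom_def Ring.ring_hom_def)

section \<open>Base change\<close>

lemma with_smult_simps [simp]:
  "carrier (with_smult A s) = carrier A"
  "x \<otimes>\<^bsub>with_smult A s\<^esub> y = x \<otimes>\<^bsub>A\<^esub> y"
  "\<one>\<^bsub>with_smult A s\<^esub> = \<one>\<^bsub>A\<^esub>"
  "\<zero>\<^bsub>with_smult A s\<^esub> = \<zero>\<^bsub>A\<^esub>"
  "x \<oplus>\<^bsub>with_smult A s\<^esub> y = x \<oplus>\<^bsub>A\<^esub> y"
  "r \<odot>\<^bsub>with_smult A s\<^esub> x = s r x"
  by (simp_all add: with_smult_def)

lemma ring_with_smult:
  assumes "ring A"
  shows "ring (with_smult A s)"
proof -
  interpret ring A by fact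
  have "\<exists>y\<in>carrier A. y \<oplus>\<^bsub>A\<^esub> x = \<zero>\<^bsub>A\<^esub>" if "x \<in> carrier A" for x
    using that l_neg by blast
  then show ?thesis
    by (intro ringI abelian_groupI monoidI) (auto simp: a_ac m_assoc l_distr r_distr)
qed

lemma algebra_of_hom:
  assumes "comm_ring_hom \<phi>"
  shows "type_algebra (algebra_of_hom \<phi> :: ('r::comm_ring_1, 's::comm_ring_1) module)"
proof -
  interpret comm_ring_hom \<phi> by fact
  show ?thesis
    by (rule type_algebraI)
       (auto simp: algebra_of_hom_def hom_distribs algebra_simps intro!: ring_with_smult)
qed

locale base_change_algebra = \<phi>: comm_ring_hom \<phi> +
  base: assoc_algebra "ring_of_type_algebra :: 'r::comm_ring_1 ring" A
  for \<phi> :: "'r::comm_ring_1 \<Rightarrow> 's::comm_ring_1" and A :: "('r, 'a) module"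
begin

sublocale tensor_product "algebra_of_hom \<phi>" A
  by (intro tensor_product.intro algebra_of_hom \<phi>.comm_ring_hom_axioms base.assoc_algebra_axioms)

abbreviation "AS \<equiv> base_change \<phi> A"

lemma base_change_simps [simp]:
  "carrier AS = carrier E" "x \<otimes>\<^bsub>AS\<^esub> y = x \<otimes>\<^bsub>E\<^esub> y" "\<one>\<^bsub>AS\<^esub> = \<one>\<^bsub>E\<^esub>" "\<zero>\<^bsub>AS\<^esub> = \<zero>\<^bsub>E\<^esub>"
  "x \<oplus>\<^bsub>AS\<^esub> y = x \<oplus>\<^bsub>E\<^esub> y" "s \<odot>\<^bsub>AS\<^esub> x = pt s \<one>\<^bsub>A\<^esub> \<otimes>\<^bsub>E\<^esub> x"
  by (simp_all add: base_change_def Let_def)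

lemma S_simps [simp]:
  "carrier (algebra_of_hom \<phi>) = UNIV" "x \<otimes>\<^bsub>algebra_of_hom \<phi>\<^esub> y = x * y"
  "\<one>\<^bsub>algebra_of_hom \<phi>\<^esub> = 1" "\<zero>\<^bsub>algebra_of_hom \<phi>\<^esub> = 0" "x \<oplus>\<^bsub>algebra_of_hom \<phi>\<^esub> y = x + y"
  "r \<odot>\<^bsub>algebra_of_hom \<phi>\<^esub> y = \<phi> r * y"
  by (simp_all add: algebra_of_hom_def)

text \<open>A scalar \<open>s\<close> acts as left multiplication by \<open>s \<otimes> 1\<close>.
  It can be moved past the left factor of a product only because these elements are central, which
  holds since the new scalars commute.\<close>

lemma pt_central:
  assumes "z \<in> carrier E"
  shows "z \<otimes>\<^bsub>E\<^esub> pt s \<one>\<^bsub>A\<^esub> = pt s \<one>\<^bsub>A\<^esub> \<otimes>\<^bsub>E\<^esub> z"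
  using assms
proof (induction rule: tensor_induct)
  case (pure s' a)
  then show ?case by (simp add: pt_mult mult.commute)
next
  case (add x y)
  then show ?case by (simp add: E.l_distr E.r_distr)
qed

lemma type_algebra_base_change: "type_algebra AS"
proof (rule type_algebraI)
  show "ring AS" unfolding base_change_def Let_def by (rule ring_with_smult) (rule E.ring_axioms)
next
  fix r s x assume x: "x \<in> carrier AS"
  show "(r + s) \<odot>\<^bsub>AS\<^esub> x = r \<odot>\<^bsub>AS\<^esub> x \<oplus>\<^bsub>AS\<^esub> s \<odot>\<^bsub>AS\<^esub> x"
    using x pt_add_left[of r s "\<one>\<^bsub>A\<^esub>"] by (simp add: E.l_distr)
  show "(r * s) \<odot>\<^bsub>AS\<^esub> x = r \<odot>\<^bsub>AS\<^esub> (s \<odot>\<^bsub>AS\<^esub> x)"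
    using x pt_mult[of r s "\<one>\<^bsub>A\<^esub>" "\<one>\<^bsub>A\<^esub>"] by (simp add: E.m_assoc[symmetric])
next
  fix x assume "x \<in> carrier AS"
  then show "1 \<odot>\<^bsub>AS\<^esub> x = x" using pt_one by simp
next
  fix r x y assume "x \<in> carrier AS" "y \<in> carrier AS"
  then show "x \<otimes>\<^bsub>AS\<^esub> (r \<odot>\<^bsub>AS\<^esub> y) = r \<odot>\<^bsub>AS\<^esub> (x \<otimes>\<^bsub>AS\<^esub> y)"
    by (simp add: pt_central E.m_assoc[symmetric])
qed (simp_all add: E.r_distr E.m_assoc)

lemma pt_scalar: "a \<in> carrier A \<Longrightarrow> pt s (r \<odot>\<^bsub>A\<^esub> a) = pt (\<phi> r * s) a"
  using pt_smult[of s a r] by simp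

text \<open>Universal property of extension of scalars. The homomorphism exists additively by
  \<open>ex_tensor_hom\<close>; multiplicativity is checked on pure tensors, where it amounts to
  moving scalars past \<open>j\<close>.\<close>

lemma ex_base_change_hom:
  assumes B: "type_algebra B" and j: "j \<in> Ring.ring_hom A B"
    and smult: "\<And>r x. x \<in> carrier A \<Longrightarrow> j (r \<odot>\<^bsub>A\<^esub> x) = \<phi> r \<odot>\<^bsub>B\<^esub> j x"
  obtains h where "h \<in> algebra_hom AS B" "\<And>s a. a \<in> carrier A \<Longrightarrow> h (pt s a) = s \<odot>\<^bsub>B\<^esub> j a"
proof -
  interpret B: assoc_algebra "ring_of_type_algebra :: 's ring" B by (rule B)
  note BD = type_algebraD[OF B]
  have jc: "a \<in> carrier A \<Longrightarrow> j a \<in> carrier B" for a using j by (auto simp: Ring.ring_hom_def)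
  have j_hom: "j (a \<oplus>\<^bsub>A\<^esub> b) = j a \<oplus>\<^bsub>B\<^esub> j b" "j (a \<otimes>\<^bsub>A\<^esub> b) = j a \<otimes>\<^bsub>B\<^esub> j b" "j \<one>\<^bsub>A\<^esub> = \<one>\<^bsub>B\<^esub>"
    if "a \<in> carrier A" "b \<in> carrier A" for a b
    using j that by (auto simp: Ring.ring_hom_def)
  obtain h where h: "h \<in> hom (add_monoid E) (add_monoid B)"
    and h_pt: "\<And>s a. a \<in> carrier A \<Longrightarrow> h (pt s a) = s \<odot>\<^bsub>B\<^esub> j a"
  proof (rule ex_tensor_hom[of "add_monoid B" "\<lambda>s a. s \<odot>\<^bsub>B\<^esub> j a"])
    show "comm_group (add_monoid B)" by (rule B.a_comm_group)
  next
    fix s a r assume "a \<in> carrier A"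
    then show "(r \<odot>\<^bsub>algebra_of_hom \<phi>\<^esub> s) \<odot>\<^bsub>B\<^esub> j a = s \<odot>\<^bsub>B\<^esub> j (r \<odot>\<^bsub>A\<^esub> a)"
      by (simp add: smult jc BD(6)[symmetric] mult.commute)
  qed (use that in \<open>auto simp: jc j_hom BD(4,5)\<close>)
  have h_add: "h (x \<oplus>\<^bsub>E\<^esub> y) = h x \<oplus>\<^bsub>B\<^esub> h y" and h_closed: "h x \<in> carrier B"
    if "x \<in> carrier E" "y \<in> carrier E" for x y
    using h that by (auto simp: hom_def)
  have comm: "r \<odot>\<^bsub>B\<^esub> (r' \<odot>\<^bsub>B\<^esub> x) = r' \<odot>\<^bsub>B\<^esub> (r \<odot>\<^bsub>B\<^esub> x)" if "x \<in> carrier B" for r r' x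
    using that by (simp add: BD(6)[symmetric] mult.commute)
  have h_mult: "h (x \<otimes>\<^bsub>E\<^esub> y) = h x \<otimes>\<^bsub>B\<^esub> h y" if "x \<in> carrier E" "y \<in> carrier E" for x y
    using that
  proof (induction x rule: tensor_induct)
    case (pure s a)
    from \<open>y \<in> carrier E\<close> show ?case
    proof (induction y rule: tensor_induct)
      case (pure s' a')
      then show ?case using \<open>a \<in> carrier A\<close>
        by (simp add: pt_mult h_pt j_hom jc BD(3,6,11,12) comm[of _ s s'])
    next
      case (add y z)
      then show ?case using pure
        by (simp add: E.r_distr h_add h_closed B.r_distr)
    qed
  next
    case (add x z)
    then show ?case by (simp add: E.l_distr h_add h_closed[of _ x] B.l_distr)
  qed
  have "h \<in> algebra_hom AS B"
  proof (rule algebra_homI)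
    show "h \<one>\<^bsub>AS\<^esub> = \<one>\<^bsub>B\<^esub>"
      using h_pt[of "\<one>\<^bsub>A\<^esub>" 1] pt_one j_hom(3)[of "\<one>\<^bsub>A\<^esub>" "\<one>\<^bsub>A\<^esub>"] by (simp add: BD(7))
  next
    fix r x assume x: "x \<in> carrier AS"
    have "h (pt r \<one>\<^bsub>A\<^esub>) = r \<odot>\<^bsub>B\<^esub> \<one>\<^bsub>B\<^esub>"
      using h_pt[of "\<one>\<^bsub>A\<^esub>" r] j_hom(3)[of "\<one>\<^bsub>A\<^esub>" "\<one>\<^bsub>A\<^esub>"] by simp
    then show "h (r \<odot>\<^bsub>AS\<^esub> x) = r \<odot>\<^bsub>B\<^esub> h x"
      using x by (simp add: h_mult BD(11) h_closed)
  qed (auto simp: h_add h_mult h_closed)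
  then show thesis using h_pt that by blast
qed

text \<open>The elements \<open>1 \<otimes> b i\<close> span the base change, and their images
  \<open>j (b i)\<close> form a basis, so \<open>bij_betw_of_basis\<close> gives bijectivity and
  freeness together. Every extension of scalars in the proof is identified in this way, from a basis
  that stays a basis in a concrete algebra over the larger ring.\<close>

theorem base_change_iso:
  assumes B: "type_algebra B" and j: "j \<in> Ring.ring_hom A B"
    and smult: "\<And>r x. x \<in> carrier A \<Longrightarrow> j (r \<odot>\<^bsub>A\<^esub> x) = \<phi> r \<odot>\<^bsub>B\<^esub> j x"
    and basis: "basis_family A N b" "basis_family B N (\<lambda>i. j (b i))"
  obtains h where "h \<in> algebra_hom AS B" "bij_betw h (carrier AS) (carrier B)"
    "\<And>s a. a \<in> carrier A \<Longrightarrow> h (pt s a) = s \<odot>\<^bsub>B\<^esub> j a"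
    "basis_family AS N (\<lambda>i. pt 1 (b i))"
proof -
  obtain h where h: "h \<in> algebra_hom AS B"
    and h_pt: "\<And>s a. a \<in> carrier A \<Longrightarrow> h (pt s a) = s \<odot>\<^bsub>B\<^esub> j a"
    using ex_base_change_hom[OF B j smult] by blast
  note b = basis_familyD(2)[OF basis(1)]
  have pt1: "pt 1 \<in> hom (add_monoid A) (add_monoid AS)"
    by (rule homI) (auto simp: pt_add_right)
  have pt1_smult: "pt 1 (r \<odot>\<^bsub>A\<^esub> x) = \<phi> r \<odot>\<^bsub>AS\<^esub> pt 1 x" if "x \<in> carrier A" for r x
    using that by (simp add: pt_scalar pt_mult)
  have img: "pt 1 (lin_comb A N b c) = lin_comb AS N (\<lambda>i. pt 1 (b i)) (\<lambda>i. \<phi> (c i))" for c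
    by (rule lin_comb_image[OF base.assoc_algebra_axioms type_algebra_base_change pt1 _ b])
       (rule pt1_smult)
  have pt1b: "(\<lambda>i. pt 1 (b i)) \<in> N \<rightarrow> carrier AS" using b by auto
  have span: "\<exists>c. x = lin_comb AS N (\<lambda>i. pt 1 (b i)) c" if "x \<in> carrier AS" for x
    using that unfolding base_change_simps
  proof (induction rule: tensor_induct)
    case (pure s a)
    then obtain c where c: "a = lin_comb A N b c" using basis_familyD(4)[OF basis(1)] by blast
    have "pt s a = s \<odot>\<^bsub>AS\<^esub> pt 1 a" using pure by (simp add: pt_mult)
    also have "\<dots> = lin_comb AS N (\<lambda>i. pt 1 (b i)) (\<lambda>i. s * \<phi> (c i))"
      unfolding c img by (rule lin_comb_smult[OF type_algebra_base_change pt1b, symmetric])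
    finally show ?case by blast
  next
    case (add x y)
    then obtain c d where "x = lin_comb AS N (\<lambda>i. pt 1 (b i)) c" "y = lin_comb AS N (\<lambda>i. pt 1 (b i)) d"
      by blast
    then have "x \<oplus>\<^bsub>E\<^esub> y = lin_comb AS N (\<lambda>i. pt 1 (b i)) (\<lambda>i. c i + d i)"
      using lin_comb_add[OF type_algebra_base_change pt1b, of c d] by simp
    then show ?case by blast
  qed
  have "h (pt 1 (b i)) = j (b i)" if "i \<in> N" for i
  proof -
    have "b i \<in> carrier A" using b that by auto
    then show ?thesis using h_pt[of "b i" 1] j type_algebraD(7)[OF B] by (auto simp: Ring.ring_hom_def)
  qed
  moreover have "basis_family B N f" if "\<And>i. i \<in> N \<Longrightarrow> f i = j (b i)" for f
  proof -
    have "lin_comb B N f c = lin_comb B N (\<lambda>i. j (b i)) c" for c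
      by (rule lin_comb_cong[OF B]) (use that basis_familyD(3)[OF basis(2)] in auto)
    then show ?thesis using basis(2) that unfolding basis_family_def by auto
  qed
  ultimately have "basis_family B N (\<lambda>i. h (pt 1 (b i)))" by simp
  note bij_betw_of_basis[OF type_algebra_base_change B algebra_homD(1)[OF h] algebra_homD(4)[OF h]
      pt1b span this]
  then show thesis by (intro that[OF h _ h_pt])
qed

end

section \<open>The split algebra \<open>M\<^sub>2(R)\<^sup>m \<oplus> R\<^sup>4\<close>\<close>

definition split_algebra :: "nat \<Rightarrow> ('r::comm_ring_1, (nat \<Rightarrow> 'r mat) \<times> (nat \<Rightarrow> 'r)) module" where
  "split_algebra m =
    algebra_sum {1..m} (\<lambda>_. matrix_algebra 2) \<oplus>\<^sub>a\<^sub>l\<^sub>g algebra_sum {1..4} (\<lambda>_. algebra_of_hom (\<lambda>c. c))"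

text \<open>Coordinates on the split algebra: \<open>f i r s\<close> is the entry in row
  \<open>r\<close> and column \<open>s\<close> of block \<open>i\<close>, rows and columns counted
  from 0, while blocks and scalar summands are counted from 1. Values outside these ranges are
  discarded, so an identity has to be checked at valid indices only.\<close>

definition split_elem ::
    "nat \<Rightarrow> (nat \<Rightarrow> nat \<Rightarrow> nat \<Rightarrow> 'r) \<Rightarrow> (nat \<Rightarrow> 'r) \<Rightarrow> (nat \<Rightarrow> 'r mat) \<times> (nat \<Rightarrow> 'r)" where
  "split_elem m f z = (\<lambda>i\<in>{1..m}. Matrix.mat 2 2 (\<lambda>(r, s). f i r s), \<lambda>j\<in>{1..4}. z j)"

lemma mat2_mult:
  "Matrix.mat 2 2 f * Matrix.mat 2 2 g =
    Matrix.mat 2 2 (\<lambda>(r, s). f (r, 0) * g (0, s) + f (r, 1) * g (1, s) :: 'r::comm_ring_1)"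
  by (rule eq_matI) (auto simp: scalar_prod_def numeral_2_eq_2)

lemmas split_algebra_defs = split_algebra_def algebra_sum2_def algebra_sum_def matrix_algebra_def
  ring_mat_def algebra_of_hom_def with_smult_def

lemma split_elem_closed [simp, intro]: "split_elem m f z \<in> carrier (split_algebra m)"
  by (auto simp: split_algebra_defs split_elem_def)

lemma split_elem_cases:
  assumes "x \<in> carrier (split_algebra m)"
  obtains f z where "x = split_elem m f z"
proof
  show "x = split_elem m (\<lambda>i r s. fst x i $$ (r, s)) (snd x)"
  proof (rule prod_eqI)
    show "fst x = fst (split_elem m (\<lambda>i r s. fst x i $$ (r, s)) (snd x))"
    proof
      fix i
      show "fst x i = fst (split_elem m (\<lambda>i r s. fst x i $$ (r, s)) (snd x)) i"
      proof (cases "i \<in> {1..m}")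
        case True
        then have "fst x i \<in> carrier_mat 2 2"
          using assms by (auto simp: split_algebra_defs PiE_iff)
        then show ?thesis using True by (intro eq_matI) (auto simp: split_elem_def)
      next
        case False
        then show ?thesis using assms
          by (auto simp: split_algebra_defs split_elem_def PiE_iff extensional_def)
      qed
    qed
    show "snd x = snd (split_elem m (\<lambda>i r s. fst x i $$ (r, s)) (snd x))"
      using assms by (auto simp: split_algebra_defs split_elem_def PiE_iff extensional_def)
  qed
qed

lemma split_elem_eq_iff:
  "split_elem m f z = split_elem m f' z' \<longleftrightarrow>
    (\<forall>i\<in>{1..m}. \<forall>r<2. \<forall>s<2. f i r s = f' i r s) \<and> (\<forall>j\<in>{1..4}. z j = z' j)"
proof -
  have "(\<lambda>i\<in>{1..m}. Matrix.mat 2 2 (\<lambda>(r, s). f i r s)) = (\<lambda>i\<in>{1..m}. Matrix.mat 2 2 (\<lambda>(r, s). f' i r s))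
      \<longleftrightarrow> (\<forall>i\<in>{1..m}. \<forall>r<2. \<forall>s<2. f i r s = f' i r s)"
    by (simp add: fun_eq_iff mat_eq_iff) auto
  moreover have "(\<lambda>j\<in>{1..4}. z j) = (\<lambda>j\<in>{1..4}. z' j) \<longleftrightarrow> (\<forall>j\<in>{1..4}. z j = z' j)"
    by (auto simp: fun_eq_iff)
  ultimately show ?thesis by (simp add: split_elem_def)
qed

lemma split_elem_add:
  "split_elem m f z \<oplus>\<^bsub>split_algebra m\<^esub> split_elem m f' z' =
    split_elem m (\<lambda>i r s. f i r s + f' i r s) (\<lambda>j. z j + z' j)"
  by (auto simp: split_algebra_defs split_elem_def intro!: restrict_ext eq_matI)

lemma split_elem_mult:
  "split_elem m f z \<otimes>\<^bsub>split_algebra m\<^esub> split_elem m f' z' =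
    split_elem m (\<lambda>i r s. f i r 0 * f' i 0 s + f i r 1 * f' i 1 s) (\<lambda>j. z j * z' j)"
  by (auto simp: split_algebra_defs split_elem_def mat2_mult intro!: restrict_ext)

lemma split_elem_one:
  "\<one>\<^bsub>split_algebra m\<^esub> = split_elem m (\<lambda>i r s. if r = s then 1 else 0) (\<lambda>j. 1)"
  by (auto simp: split_algebra_defs split_elem_def intro!: restrict_ext eq_matI)

lemma split_elem_zero: "\<zero>\<^bsub>split_algebra m\<^esub> = split_elem m (\<lambda>i r s. 0) (\<lambda>j. 0)"
  by (auto simp: split_algebra_defs split_elem_def intro!: restrict_ext eq_matI)

lemma split_elem_smult:
  "c \<odot>\<^bsub>split_algebra m\<^esub> split_elem m f z = split_elem m (\<lambda>i r s. c * f i r s) (\<lambda>j. c * z j)"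
  by (auto simp: split_algebra_defs split_elem_def intro!: restrict_ext eq_matI)

lemmas split_elem_simps = split_elem_add split_elem_mult split_elem_one split_elem_zero split_elem_smult

lemma split_elem_cong:
  "(\<And>i r s. i \<in> {1..m} \<Longrightarrow> r < 2 \<Longrightarrow> s < 2 \<Longrightarrow> f i r s = f' i r s) \<Longrightarrow>
   (\<And>j. j \<in> {1..4} \<Longrightarrow> z j = z' j) \<Longrightarrow> split_elem m f z = split_elem m f' z'"
  by (simp add: split_elem_eq_iff)

lemma type_algebra_split_algebra:
  "type_algebra (split_algebra m :: ('r::comm_ring_1, _) module)"
proof -
  let ?P = "split_algebra m :: ('r, _) module"
  have ab: "abelian_group ?P"
  proof (rule abelian_groupI)
    fix x assume "x \<in> carrier ?P"
    then obtain f z where x: "x = split_elem m f z" by (rule split_elem_cases)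
    show "\<exists>y\<in>carrier ?P. y \<oplus>\<^bsub>?P\<^esub> x = \<zero>\<^bsub>?P\<^esub>"
      by (rule bexI[of _ "split_elem m (\<lambda>i r s. - f i r s) (\<lambda>j. - z j)"])
         (auto simp: x split_elem_simps)
  qed (auto elim!: split_elem_cases simp: split_elem_simps ac_simps)
  moreover have "monoid ?P"
    by (rule monoidI)
       (auto elim!: split_elem_cases simp: split_elem_simps split_elem_eq_iff algebra_simps
         dest: less_2_cases)
  ultimately have "ring ?P"
    by (rule ringI) (auto elim!: split_elem_cases simp: split_elem_simps split_elem_eq_iff algebra_simps)
  then show ?thesis
    by (rule type_algebraI)
       (auto elim!: split_elem_cases simp: split_elem_simps split_elem_eq_iff algebra_simps)
qed

lemma lin_comb_split_elem:
  fixes c :: "'i \<Rightarrow> 'r::comm_ring_1"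
  assumes "finite I"
  shows "lin_comb (split_algebra m) I (\<lambda>x. split_elem m (F x) (Z x)) c =
    split_elem m (\<lambda>i r s. \<Sum>x\<in>I. c x * F x i r s) (\<lambda>j. \<Sum>x\<in>I. c x * Z x j)"
proof -
  interpret P: assoc_algebra "ring_of_type_algebra :: 'r ring" "split_algebra m"
    by (rule type_algebra_split_algebra)
  show ?thesis using assms
    by (induction I rule: finite_induct)
       (simp_all add: lin_comb_def split_elem_simps)
qed

definition split_index :: "nat \<Rightarrow> (nat \<times> nat \<times> nat + nat) set" where
  "split_index m = ({1..m} \<times> {..<2} \<times> {..<2}) <+> {1..4}"

definition matrix_unit :: "nat \<Rightarrow> nat \<times> nat \<times> nat + nat \<Rightarrow> (nat \<Rightarrow> 'r::comm_ring_1 mat) \<times> (nat \<Rightarrow> 'r)" where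
  "matrix_unit m x = split_elem m (\<lambda>i r s. if x = Inl (i, r, s) then 1 else 0) (\<lambda>j. if x = Inr j then 1 else 0)"

lemma finite_split_index [simp]: "finite (split_index m)"
  by (simp add: split_index_def)

lemma card_split_index: "card (split_index m) = 4 * m + 4"
  by (simp add: split_index_def card_Plus card_cartesian_product)

lemma lin_comb_matrix_unit:
  "lin_comb (split_algebra m) (split_index m) (matrix_unit m) c =
    split_elem m (\<lambda>i r s. c (Inl (i, r, s))) (\<lambda>j. c (Inr j))"
  unfolding matrix_unit_def lin_comb_split_elem[OF finite_split_index]
  by (intro split_elem_cong) (auto simp: split_index_def if_distrib[of "\<lambda>a. _ * a"] cong: if_cong)

lemma basis_family_split_algebra:
  "basis_family (split_algebra m) (split_index m) (matrix_unit m)"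
  unfolding basis_family_def lin_comb_matrix_unit
proof (intro conjI ballI allI impI)
  fix x :: "(nat \<Rightarrow> 'r::comm_ring_1 mat) \<times> (nat \<Rightarrow> 'r)" assume "x \<in> carrier (split_algebra m)"
  then obtain f z where x: "x = split_elem m f z" by (rule split_elem_cases)
  show "\<exists>c. x = split_elem m (\<lambda>i r s. c (Inl (i, r, s))) (\<lambda>j. c (Inr j))"
    by (rule exI[of _ "case_sum (\<lambda>(i, r, s). f i r s) z"]) (simp add: x)
qed (auto simp: matrix_unit_def split_elem_simps split_elem_eq_iff split_index_def)

text \<open>The entrywise change of scalars, under which an element given by coordinates is embedded
  into the split algebra over a larger ring.\<close>

lemma algebra_hom_map_split_algebra:
  assumes "comm_ring_hom \<phi>"
  obtains j where "j \<in> Ring.ring_hom (split_algebra m) (split_algebra m)"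
    and "\<And>f z. j (split_elem m f z) = split_elem m (\<lambda>i r s. \<phi> (f i r s)) (\<lambda>j. \<phi> (z j))"
proof -
  interpret comm_ring_hom \<phi> by fact
  define j where "j x = split_elem m (\<lambda>i r s. \<phi> (fst x i $$ (r, s))) (\<lambda>k. \<phi> (snd x k))" for x
  have j: "j (split_elem m f z) = split_elem m (\<lambda>i r s. \<phi> (f i r s)) (\<lambda>j. \<phi> (z j))" for f z
    unfolding j_def by (rule split_elem_cong) (auto simp: split_elem_def)
  have "j \<in> Ring.ring_hom (split_algebra m) (split_algebra m)"
    by (rule ring_hom_memI)
       (auto elim!: split_elem_cases simp: j split_elem_simps hom_distribs split_elem_eq_iff)
  then show thesis using j that by blast
qed

section \<open>Algebras of finite groups\<close>

locale finite_monoid = monoid +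
  assumes finite_carrier [simp]: "finite (carrier G)"
begin

lemma monoid_algebra_carrier_iff:
  "f \<in> carrier (monoid_algebra G) \<longleftrightarrow> (\<forall>x. x \<notin> carrier G \<longrightarrow> f x = 0)"
  using finite_subset[of "{x. f x \<noteq> 0}" "carrier G"] by auto

lemma lin_comb_monomial:
  fixes c :: "'a \<Rightarrow> 'r::comm_ring_1"
  shows "lin_comb (monoid_algebra G) (carrier G) (\<lambda>g. monomial g 1) c = (\<lambda>x. if x \<in> carrier G then c x else 0)"
proof -
  let ?A = "monoid_algebra G :: ('r, 'a \<Rightarrow> 'r) module"
  interpret A: assoc_algebra "ring_of_type_algebra :: 'r ring" ?A by (rule monoid_algebra)
  have "finite S \<Longrightarrow> S \<subseteq> carrier G \<Longrightarrow>
      lin_comb ?A S (\<lambda>g. monomial g 1) c = (\<lambda>x. if x \<in> S then c x else 0)" for S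
  proof (induction S rule: finite_induct)
    case empty
    show ?case by (simp add: lin_comb_def)
  next
    case (insert g S)
    have "(\<lambda>g. c g \<odot>\<^bsub>?A\<^esub> monomial g 1) \<in> insert g S \<rightarrow> carrier ?A"
      using insert(4) monomial_closed[of _ G] type_algebraD(3)[OF monoid_algebra]
      by (intro Pi_I) blast
    then have "lin_comb ?A (insert g S) (\<lambda>g. monomial g 1) c =
        c g \<odot>\<^bsub>?A\<^esub> monomial g 1 \<oplus>\<^bsub>?A\<^esub> lin_comb ?A S (\<lambda>g. monomial g 1) c"
      unfolding lin_comb_def using insert(1,2) by (intro A.finsum_insert) auto
    then show ?case using insert by (auto simp: monomial_def fun_eq_iff)
  qed
  then show ?thesis by simp
qed

lemma basis_family_monoid_algebra:
  "basis_family (monoid_algebra G :: ('r::comm_ring_1, 'a \<Rightarrow> 'r) module) (carrier G) (\<lambda>g. monomial g 1)"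
  unfolding basis_family_def lin_comb_monomial
proof (intro conjI ballI allI impI)
  fix f :: "'a \<Rightarrow> 'r" assume "f \<in> carrier (monoid_algebra G)"
  then have "f = (\<lambda>x. if x \<in> carrier G then f x else 0)"
    by (simp add: monoid_algebra_carrier_iff fun_eq_iff del: monoid_algebra_simps(1))
  then show "\<exists>c. f = (\<lambda>x. if x \<in> carrier G then c x else 0)" by (rule exI[of _ f])
next
  fix c :: "'a \<Rightarrow> 'r" and g assume "(\<lambda>x. if x \<in> carrier G then c x else 0) = \<zero>\<^bsub>monoid_algebra G\<^esub>" "g \<in> carrier G"
  then show "c g = 0" by (simp add: fun_eq_iff) metis
qed (simp_all add: monoid_algebra_carrier_iff monomial_def)

lemma ex_monoid_algebra_hom:
  fixes B :: "('r::comm_ring_1, 'c) module"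
  assumes B: "type_algebra B" and \<rho>: "\<rho> \<in> carrier G \<rightarrow> carrier B"
    and mult: "\<And>g h. g \<in> carrier G \<Longrightarrow> h \<in> carrier G \<Longrightarrow> \<rho> (g \<otimes> h) = \<rho> g \<otimes>\<^bsub>B\<^esub> \<rho> h"
    and one: "\<rho> \<one> = \<one>\<^bsub>B\<^esub>"
  shows "lin_comb B (carrier G) \<rho> \<in> algebra_hom (monoid_algebra G) B"
proof -
  let ?A = "monoid_algebra G :: ('r, 'a \<Rightarrow> 'r) module"
  let ?h = "lin_comb B (carrier G) \<rho>"
  interpret A: assoc_algebra "ring_of_type_algebra :: 'r ring" ?A by (rule monoid_algebra)
  interpret B: assoc_algebra "ring_of_type_algebra :: 'r ring" B by (rule B)
  note BD = type_algebraD[OF B]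
  have closed: "?h f \<in> carrier B" for f by (rule lin_comb_closed[OF B \<rho>])
  have h_add: "?h (\<lambda>x. f x + g x) = ?h f \<oplus>\<^bsub>B\<^esub> ?h g" for f g by (rule lin_comb_add[OF B \<rho>])
  have h_zero: "?h (\<lambda>_. 0) = \<zero>\<^bsub>B\<^esub>"
    using lin_comb_smult[OF B \<rho>, of 0 "\<lambda>_. 0"] by (simp add: BD(8) closed)
  have mono: "?h (monomial g c) = c \<odot>\<^bsub>B\<^esub> \<rho> g" if "g \<in> carrier G" for g c
    unfolding monomial_def by (rule lin_comb_delta[OF B _ that \<rho>]) simp
  have \<rho>c: "\<rho> g \<in> carrier B" if "g \<in> carrier G" for g using \<rho> that by auto
  have A_add: "f \<otimes>\<^bsub>?A\<^esub> (\<lambda>x. g x + h x) = (\<lambda>x. (f \<otimes>\<^bsub>?A\<^esub> g) x + (f \<otimes>\<^bsub>?A\<^esub> h) x)"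
    "(\<lambda>x. g x + h x) \<otimes>\<^bsub>?A\<^esub> f = (\<lambda>x. (g \<otimes>\<^bsub>?A\<^esub> f) x + (h \<otimes>\<^bsub>?A\<^esub> f) x)"
    if "f \<in> carrier ?A" "g \<in> carrier ?A" "h \<in> carrier ?A" for f g h
    using A.r_distr[OF that(2,3,1)] A.l_distr[OF that(2,3,1)] by simp_all
  have A_zero: "f \<otimes>\<^bsub>?A\<^esub> (\<lambda>_. 0) = (\<lambda>_. 0)" "(\<lambda>_. 0) \<otimes>\<^bsub>?A\<^esub> f = (\<lambda>_. 0)" if "f \<in> carrier ?A" for f
    using A.r_null[OF that] A.l_null[OF that] by simp_all
  have comm: "r \<odot>\<^bsub>B\<^esub> (r' \<odot>\<^bsub>B\<^esub> x) = r' \<odot>\<^bsub>B\<^esub> (r \<odot>\<^bsub>B\<^esub> x)" if "x \<in> carrier B" for r r' x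
    using that by (simp add: BD(6)[symmetric] mult.commute)
  have h_mult: "?h (f \<otimes>\<^bsub>?A\<^esub> f') = ?h f \<otimes>\<^bsub>B\<^esub> ?h f'" if f: "f \<in> carrier ?A" and f': "f' \<in> carrier ?A" for f f'
    using f
  proof (induction rule: monomial_induct)
    case zero
    then show ?case by (simp only: A_zero[OF f'] h_zero B.l_null[OF closed])
  next
    case (monomial g c)
    from f' show ?case
    proof (induction rule: monomial_induct)
      case zero
      have "monomial g c \<in> carrier ?A" using monomial by (rule monomial_closed)
      then show ?case by (simp only: A_zero h_zero B.r_null[OF closed])
    next
      case (monomial g' c')
      then show ?case using \<open>g \<in> carrier G\<close>
        by (simp add: monomial_mult mono mult \<rho>c BD(3,6,11,12) comm[of _ c c'])
    next
      case (add f1 f2)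
      have "monomial g c \<in> carrier ?A" using monomial by (rule monomial_closed)
      then show ?case
        by (simp only: A_add[OF _ add(1,2)] h_add add(3,4) B.r_distr[OF closed closed closed])
    qed
  next
    case (add f1 f2)
    then show ?case
      by (simp only: A_add[OF f' add(1,2)] h_add add(3,4) B.l_distr[OF closed closed closed])
  qed
  show ?thesis
  proof (rule algebra_homI)
    show "?h \<one>\<^bsub>?A\<^esub> = \<one>\<^bsub>B\<^esub>"
      using mono[of \<one> 1] by (simp add: one BD(7) monomial_def)
  next
    fix r f
    show "?h (r \<odot>\<^bsub>?A\<^esub> f) = r \<odot>\<^bsub>B\<^esub> ?h f"
      using lin_comb_smult[OF B \<rho>, of r f] by simp
  next
    fix f g
    show "?h (f \<oplus>\<^bsub>?A\<^esub> g) = ?h f \<oplus>\<^bsub>B\<^esub> ?h g"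
      using h_add[of f g] by simp
  qed (use closed h_mult in blast)+
qed

lemma ring_hom_map_monoid_algebra:
  fixes \<phi> :: "'r::comm_ring_1 \<Rightarrow> 's::comm_ring_1"
  assumes "comm_ring_hom \<phi>"
  shows "(\<lambda>f x. \<phi> (f x)) \<in> Ring.ring_hom (monoid_algebra G) (monoid_algebra G)"
proof -
  interpret comm_ring_hom \<phi> by fact
  note app = monoid_algebra_mult_apply[OF finite_carrier _ finite_carrier]
  show ?thesis
  proof (rule ring_hom_memI)
    fix f g :: "'a \<Rightarrow> 'r"
    assume fg: "f \<in> carrier (monoid_algebra G)" "g \<in> carrier (monoid_algebra G)"
    have "{x. \<phi> (f x) \<noteq> 0} \<subseteq> {x. f x \<noteq> 0}" for f :: "'a \<Rightarrow> 'r" by auto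
    then have supp: "{x. f x \<noteq> 0} \<subseteq> carrier G" "{x. g x \<noteq> 0} \<subseteq> carrier G"
      "{x. \<phi> (f x) \<noteq> 0} \<subseteq> carrier G" "{x. \<phi> (g x) \<noteq> 0} \<subseteq> carrier G"
      using fg by (simp_all, (meson subset_trans)+)
    show "(\<lambda>x. \<phi> ((f \<otimes>\<^bsub>monoid_algebra G\<^esub> g) x)) =
        (\<lambda>x. \<phi> (f x)) \<otimes>\<^bsub>monoid_algebra G\<^esub> (\<lambda>x. \<phi> (g x))"
      by (rule ext) (simp add: app supp hom_distribs if_distrib[of \<phi>] cong: if_cong)
    show "(\<lambda>x. \<phi> ((f \<oplus>\<^bsub>monoid_algebra G\<^esub> g) x)) =
        (\<lambda>x. \<phi> (f x)) \<oplus>\<^bsub>monoid_algebra G\<^esub> (\<lambda>x. \<phi> (g x))"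
      by (simp add: hom_distribs)
  qed (auto simp: monoid_algebra_carrier_iff simp del: monoid_algebra_simps(1) simp: hom_distribs)
qed

end

section \<open>Dihedral groups\<close>

text \<open>The relation \<open>y x = x\<^sup>-\<^sup>1 y\<close> in a monoid where \<open>x\<close> has the inverse \<open>x\<^sup>N\<^sup>-\<^sup>1\<close>.\<close>

locale dihedral_pair = monoid G for G (structure) +
  fixes N :: nat and x y
  assumes N: "N > 0" and x [simp]: "x \<in> carrier G" and y [simp]: "y \<in> carrier G"
    and x_pow: "x [^] N = \<one>" and y_pow: "y [^] (2 :: nat) = \<one>"
    and twist: "x \<otimes> y \<otimes> x = y"
begin

lemma x_pow_mod: "x [^] (e mod N) = x [^] e"
proof -
  have "x [^] e = x [^] (e mod N + N * (e div N))" by simp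
  also have "\<dots> = x [^] (e mod N) \<otimes> (x [^] N) [^] (e div N)"
    by (simp only: nat_pow_mult[symmetric] nat_pow_pow[OF x] x)
  finally show ?thesis by (simp add: x_pow)
qed

lemma y_pow_mod: "y [^] (l mod 2 :: nat) = y [^] l"
proof -
  have "y [^] l = y [^] (l mod 2 + 2 * (l div 2))" by simp
  also have "\<dots> = y [^] (l mod 2) \<otimes> (y [^] (2::nat)) [^] (l div 2)"
    by (simp only: nat_pow_mult[symmetric] nat_pow_pow[OF y] y)
  finally show ?thesis by (simp add: y_pow)
qed

lemma y_x: "y \<otimes> x = x [^] (N - 1) \<otimes> y"
proof -
  have "x [^] (N - 1) \<otimes> y = x [^] (N - 1) \<otimes> (x \<otimes> (y \<otimes> x))"
    using twist by (simp add: m_assoc)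
  also have "\<dots> = (x [^] (N - 1) \<otimes> x) \<otimes> (y \<otimes> x)" by (simp add: m_assoc)
  also have "x [^] (N - 1) \<otimes> x = x [^] N" using N nat_pow_Suc[of x "N - 1"] by simp
  finally show ?thesis by (simp add: x_pow)
qed

lemma y_x_pow: "y \<otimes> x [^] (e :: nat) = x [^] ((N - 1) * e) \<otimes> y"
proof (induction e)
  case (Suc e)
  have "y \<otimes> x [^] Suc e = (y \<otimes> x [^] e) \<otimes> x" by (simp add: m_assoc)
  also have "\<dots> = x [^] ((N - 1) * e) \<otimes> (y \<otimes> x)" by (simp add: Suc m_assoc)
  also have "\<dots> = (x [^] ((N - 1) * e) \<otimes> x [^] (N - 1)) \<otimes> y" by (simp add: y_x m_assoc)
  finally show ?case by (simp add: nat_pow_mult add.commute)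
qed simp

lemma y_pow_x_pow:
  "y [^] (l :: nat) \<otimes> x [^] (e :: nat) = x [^] (if even l then e else (N - 1) * e) \<otimes> y [^] l"
proof (cases "even l")
  case True
  then have "y [^] (l mod 2) = \<one>" by (simp add: even_iff_mod_2_eq_zero)
  then have "y [^] l = \<one>" by (simp add: y_pow_mod)
  then show ?thesis using True by simp
next
  case False
  then have "l mod 2 = 1" by presburger
  then have "y [^] l = y" using y_pow_mod[of l] by simp
  then show ?thesis using False by (simp add: y_x_pow)
qed

text \<open>The product of two normal forms is a normal form whose exponents depend only on
  \<open>N\<close>. Two dihedral pairs with the same \<open>N\<close>, in whatever monoids,
  therefore multiply by the same rule.\<close>

lemma pow_mult:
  "(x [^] (e :: nat) \<otimes> y [^] (l :: nat)) \<otimes> (x [^] (e' :: nat) \<otimes> y [^] (l' :: nat)) =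
    x [^] (e + (if even l then e' else (N - 1) * e')) \<otimes> y [^] (l + l')"
proof -
  have "(x [^] e \<otimes> y [^] l) \<otimes> (x [^] e' \<otimes> y [^] l') = x [^] e \<otimes> (y [^] l \<otimes> x [^] e') \<otimes> y [^] l'"
    by (simp add: m_assoc)
  also have "\<dots> = (x [^] e \<otimes> x [^] (if even l then e' else (N - 1) * e')) \<otimes> (y [^] l \<otimes> y [^] l')"
    by (simp only: y_pow_x_pow) (simp add: m_assoc)
  finally show ?thesis by (simp add: nat_pow_mult)
qed

end

text \<open>The normal forms are closed under products and contain the generators and their
  inverses, so they exhaust the group. There are \<open>2 N = 2^n\<close> reduced ones, as many as
  group elements, hence no two coincide.\<close>

lemma is_dihedral_generators:
  assumes D: "is_dihedral n D" and n: "n \<ge> 1"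
  obtains \<sigma> \<tau> where "dihedral_pair D (2 ^ (n - 1)) \<sigma> \<tau>"
    and "bij_betw (\<lambda>(e, l). \<sigma> [^]\<^bsub>D\<^esub> e \<otimes>\<^bsub>D\<^esub> \<tau> [^]\<^bsub>D\<^esub> l) ({..<2 ^ (n - 1) :: nat} \<times> {..<2 :: nat}) (carrier D)"
proof -
  define N :: nat where "N = 2 ^ (n - 1)"
  have N: "N > 0" by (simp add: N_def)
  obtain \<sigma> \<tau> where "group D" and ord: "Coset.order D = 2 ^ n"
    and st: "\<sigma> \<in> carrier D" "\<tau> \<in> carrier D" and gen: "generate D {\<sigma>, \<tau>} = carrier D"
    and s: "\<sigma> [^]\<^bsub>D\<^esub> N = \<one>\<^bsub>D\<^esub>" and t: "\<tau> [^]\<^bsub>D\<^esub> (2 :: nat) = \<one>\<^bsub>D\<^esub>"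
    and tst: "\<tau> \<otimes>\<^bsub>D\<^esub> \<sigma> \<otimes>\<^bsub>D\<^esub> inv\<^bsub>D\<^esub> \<tau> = inv\<^bsub>D\<^esub> \<sigma>"
    using D unfolding is_dihedral_def N_def by blast
  interpret group D by fact
  have ts: "\<tau> \<otimes>\<^bsub>D\<^esub> \<sigma> = inv\<^bsub>D\<^esub> \<sigma> \<otimes>\<^bsub>D\<^esub> \<tau>"
    using st tst by (metis inv_solve_right inv_closed m_closed)
  interpret dihedral_pair D N \<sigma> \<tau>
    by unfold_locales
       (use N st s t ts in \<open>simp_all add: m_assoc, simp add: m_assoc[symmetric]\<close>)
  define E where "E = range (\<lambda>(e, l). \<sigma> [^]\<^bsub>D\<^esub> (e :: nat) \<otimes>\<^bsub>D\<^esub> \<tau> [^]\<^bsub>D\<^esub> (l :: nat))"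
  have E: "\<sigma> [^]\<^bsub>D\<^esub> e \<otimes>\<^bsub>D\<^esub> \<tau> [^]\<^bsub>D\<^esub> l \<in> E" for e l :: nat unfolding E_def by auto
  have E_s: "\<sigma> [^]\<^bsub>D\<^esub> e \<in> E" for e :: nat using E[of e 0] by simp
  have E_t: "\<tau> [^]\<^bsub>D\<^esub> l \<in> E" for l :: nat using E[of 0 l] by simp
  have inv_s: "inv\<^bsub>D\<^esub> \<sigma> = \<sigma> [^]\<^bsub>D\<^esub> (N - 1)"
    using N x_pow nat_pow_Suc[of \<sigma> "N - 1"] by (intro inv_equality) simp_all
  have inv_t: "inv\<^bsub>D\<^esub> \<tau> = \<tau>"
    using y_pow by (intro inv_equality) (simp_all add: numeral_2_eq_2)
  have "g \<in> E" if "g \<in> generate D {\<sigma>, \<tau>}" for g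
    using that
  proof (induction rule: generate.induct)
    case one
    show ?case using E[of 0 0] by simp
  next
    case (incl h)
    then show ?case using E_s[of 1] E_t[of 1] by auto
  next
    case (inv h)
    then show ?case using E_s[of "N - 1"] E_t[of 1] by (auto simp: inv_s inv_t)
  next
    case (eng g h)
    then obtain e l e' l' where "g = \<sigma> [^]\<^bsub>D\<^esub> (e :: nat) \<otimes>\<^bsub>D\<^esub> \<tau> [^]\<^bsub>D\<^esub> (l :: nat)"
      "h = \<sigma> [^]\<^bsub>D\<^esub> (e' :: nat) \<otimes>\<^bsub>D\<^esub> \<tau> [^]\<^bsub>D\<^esub> (l' :: nat)"
      by (auto simp: E_def)
    then show ?case by (simp only: pow_mult E)
  qed
  then have sub: "carrier D \<subseteq> E" using gen by blast
  let ?f = "\<lambda>(e, l). \<sigma> [^]\<^bsub>D\<^esub> e \<otimes>\<^bsub>D\<^esub> \<tau> [^]\<^bsub>D\<^esub> l" and ?I = "{..<N} \<times> {..<2 :: nat}"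
  have img: "?f ` ?I = carrier D"
  proof
    show "carrier D \<subseteq> ?f ` ?I"
    proof
      fix g assume "g \<in> carrier D"
      then obtain e l where "g = \<sigma> [^]\<^bsub>D\<^esub> (e :: nat) \<otimes>\<^bsub>D\<^esub> \<tau> [^]\<^bsub>D\<^esub> (l :: nat)" using sub by (auto simp: E_def)
      then have "g = ?f (e mod N, l mod 2)" by (simp add: x_pow_mod y_pow_mod)
      moreover have "(e mod N, l mod 2) \<in> ?I" using N by simp
      ultimately show "g \<in> ?f ` ?I" by blast
    qed
  qed auto
  have "card ?I = N * 2" by (simp add: card_cartesian_product)
  also have "\<dots> = 2 ^ n" unfolding N_def using n by (metis Suc_diff_1 less_eq_Suc_le One_nat_def power_Suc2)
  also have "\<dots> = card (carrier D)" using ord by (simp add: Coset.order_def)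
  finally have "card ?I = card (carrier D)" .
  then have "inj_on ?f ?I" using img by (intro eq_card_imp_inj_on) simp_all
  then have "bij_betw ?f ?I (carrier D)" using img by (simp add: bij_betw_def)
  then show thesis using that[of \<sigma> \<tau>] dihedral_pair_axioms by (simp add: N_def)
qed

text \<open>A form of the universal property of the presentation in which the target is only a
  monoid, such as the multiplicative monoid of a ring. The reduced normal forms of \<open>D\<close>
  are distinct, so a value may be assigned to each, and \<open>pow_mult\<close> on both sides yields
  multiplicativity.\<close>

lemma ex_dihedral_hom:
  assumes D: "dihedral_pair D N \<sigma> \<tau>"
    and bij: "bij_betw (\<lambda>(e, l). \<sigma> [^]\<^bsub>D\<^esub> e \<otimes>\<^bsub>D\<^esub> \<tau> [^]\<^bsub>D\<^esub> l) ({..<N} \<times> {..<2 :: nat}) (carrier D)"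
    and M: "dihedral_pair M N x y"
  obtains \<rho> where "\<rho> \<in> carrier D \<rightarrow> carrier M"
    and "\<And>g h. g \<in> carrier D \<Longrightarrow> h \<in> carrier D \<Longrightarrow> \<rho> (g \<otimes>\<^bsub>D\<^esub> h) = \<rho> g \<otimes>\<^bsub>M\<^esub> \<rho> h"
    and "\<rho> \<one>\<^bsub>D\<^esub> = \<one>\<^bsub>M\<^esub>"
    and "\<And>(e :: nat) (l :: nat). \<rho> (\<sigma> [^]\<^bsub>D\<^esub> e \<otimes>\<^bsub>D\<^esub> \<tau> [^]\<^bsub>D\<^esub> l) = x [^]\<^bsub>M\<^esub> e \<otimes>\<^bsub>M\<^esub> y [^]\<^bsub>M\<^esub> l"
proof -
  interpret D: dihedral_pair D N \<sigma> \<tau> by fact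
  interpret M: dihedral_pair M N x y by fact
  let ?f = "\<lambda>(e, l). \<sigma> [^]\<^bsub>D\<^esub> e \<otimes>\<^bsub>D\<^esub> \<tau> [^]\<^bsub>D\<^esub> l" and ?I = "{..<N} \<times> {..<2 :: nat}"
  define \<rho> where "\<rho> g = (case inv_into ?I ?f g of (e, l) \<Rightarrow> x [^]\<^bsub>M\<^esub> e \<otimes>\<^bsub>M\<^esub> y [^]\<^bsub>M\<^esub> l)" for g
  \<comment> \<open>The definition controls reduced exponents only; both sides are periodic with the
    same periods \<open>N\<close> and 2, which extends the formula to all exponents.\<close>
  have \<rho>: "\<rho> (\<sigma> [^]\<^bsub>D\<^esub> e \<otimes>\<^bsub>D\<^esub> \<tau> [^]\<^bsub>D\<^esub> l) = x [^]\<^bsub>M\<^esub> e \<otimes>\<^bsub>M\<^esub> y [^]\<^bsub>M\<^esub> l" for e l :: nat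
  proof -
    have "inv_into ?I ?f (?f (e mod N, l mod 2)) = (e mod N, l mod 2)"
      using bij D.N by (intro inv_into_f_f) (auto simp: bij_betw_def)
    then have "\<rho> (?f (e mod N, l mod 2)) = x [^]\<^bsub>M\<^esub> (e mod N) \<otimes>\<^bsub>M\<^esub> y [^]\<^bsub>M\<^esub> (l mod 2)"
      by (simp only: \<rho>_def prod.case)
    then show ?thesis by (simp add: D.x_pow_mod D.y_pow_mod M.x_pow_mod M.y_pow_mod)
  qed
  have cases: "\<exists>e l. g = \<sigma> [^]\<^bsub>D\<^esub> (e :: nat) \<otimes>\<^bsub>D\<^esub> \<tau> [^]\<^bsub>D\<^esub> (l :: nat)" if "g \<in> carrier D" for g
  proof -
    have "g \<in> ?f ` ?I" using bij that by (simp add: bij_betw_def)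
    then show ?thesis by auto
  qed
  show thesis
  proof (rule that)
    show "\<rho> (\<sigma> [^]\<^bsub>D\<^esub> e \<otimes>\<^bsub>D\<^esub> \<tau> [^]\<^bsub>D\<^esub> l) = x [^]\<^bsub>M\<^esub> e \<otimes>\<^bsub>M\<^esub> y [^]\<^bsub>M\<^esub> l" for e l :: nat
      by (rule \<rho>)
    show "\<rho> \<in> carrier D \<rightarrow> carrier M" using cases by (force simp: \<rho>)
    show "\<rho> \<one>\<^bsub>D\<^esub> = \<one>\<^bsub>M\<^esub>" using \<rho>[of 0 0] by simp
    fix g h assume "g \<in> carrier D" "h \<in> carrier D"
    then obtain e l e' l' where "g = \<sigma> [^]\<^bsub>D\<^esub> (e :: nat) \<otimes>\<^bsub>D\<^esub> \<tau> [^]\<^bsub>D\<^esub> (l :: nat)"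
      "h = \<sigma> [^]\<^bsub>D\<^esub> (e' :: nat) \<otimes>\<^bsub>D\<^esub> \<tau> [^]\<^bsub>D\<^esub> (l' :: nat)"
      using cases by metis
    then show "\<rho> (g \<otimes>\<^bsub>D\<^esub> h) = \<rho> g \<otimes>\<^bsub>M\<^esub> \<rho> h"
      by (simp only: \<rho> D.pow_mult M.pow_mult)
  qed
qed

section \<open>Separability\<close>

lemma opposite_algebra_simps [simp]:
  "carrier (opposite_algebra A) = carrier A" "x \<otimes>\<^bsub>opposite_algebra A\<^esub> y = y \<otimes>\<^bsub>A\<^esub> x"
  "\<one>\<^bsub>opposite_algebra A\<^esub> = \<one>\<^bsub>A\<^esub>" "\<zero>\<^bsub>opposite_algebra A\<^esub> = \<zero>\<^bsub>A\<^esub>"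
  "x \<oplus>\<^bsub>opposite_algebra A\<^esub> y = x \<oplus>\<^bsub>A\<^esub> y" "r \<odot>\<^bsub>opposite_algebra A\<^esub> x = r \<odot>\<^bsub>A\<^esub> x"
  by (simp_all add: opposite_algebra_def)

lemma type_algebra_opposite:
  assumes A: "type_algebra A"
  shows "type_algebra (opposite_algebra A)"
proof -
  interpret A: ring A by (rule type_algebraD(1)[OF A])
  have "\<exists>y\<in>carrier A. y \<oplus>\<^bsub>A\<^esub> x = \<zero>\<^bsub>A\<^esub>" if "x \<in> carrier A" for x
    using that A.l_neg by blast
  then have "ring (opposite_algebra A)"
    by (intro ringI abelian_groupI monoidI) (auto simp: A.a_ac A.m_assoc A.l_distr A.r_distr)
  then show ?thesis
    by (rule type_algebraI) (simp_all add: type_algebraD[OF A])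
qed

lemma (in abelian_monoid) finsum_swap:
  assumes "finite I" "finite J" "\<And>i j. i \<in> I \<Longrightarrow> j \<in> J \<Longrightarrow> f i j \<in> carrier G"
  shows "(\<Oplus>i\<in>I. \<Oplus>j\<in>J. f i j) = (\<Oplus>j\<in>J. \<Oplus>i\<in>I. f i j)"
  using assms(1,3)
proof (induction I rule: finite_induct)
  case empty
  then show ?case by simp
next
  case (insert a I)
  have "(\<Oplus>i\<in>insert a I. \<Oplus>j\<in>J. f i j) = (\<Oplus>j\<in>J. f a j) \<oplus> (\<Oplus>j\<in>J. \<Oplus>i\<in>I. f i j)"
    using insert by (subst finsum_insert) (auto intro!: finsum_closed)
  also have "\<dots> = (\<Oplus>j\<in>J. f a j \<oplus> (\<Oplus>i\<in>I. f i j))"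
    using insert by (intro finsum_addf[symmetric]) (auto intro!: finsum_closed)
  also have "\<dots> = (\<Oplus>j\<in>J. \<Oplus>i\<in>insert a I. f i j)"
    using insert by (intro finsum_cong' refl) (auto intro!: finsum_closed)
  finally show ?case .
qed

text \<open>
  For dual families \<open>e\<close> and \<open>f\<close>, that is families on which left and right multiplication have
  the same matrix coefficients \<open>c\<close>, the element \<open>\<Sum> e\<^sub>i \<otimes> f\<^sub>i\<close> commutes with \<open>A\<close>.
\<close>

lemma separable_algebraI:
  fixes A :: "('r::comm_ring_1, 'a) module"
  assumes A: "type_algebra A" and I: "finite I"
    and e: "e \<in> I \<rightarrow> carrier A" and f: "f \<in> I \<rightarrow> carrier A"
    and ae: "\<And>a i. a \<in> carrier A \<Longrightarrow> i \<in> I \<Longrightarrow> a \<otimes>\<^bsub>A\<^esub> e i = lin_comb A I e (\<lambda>s. c a s i)"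
    and fa: "\<And>a s. a \<in> carrier A \<Longrightarrow> s \<in> I \<Longrightarrow> f s \<otimes>\<^bsub>A\<^esub> a = lin_comb A I f (\<lambda>i. c a s i)"
    and one: "(\<Oplus>\<^bsub>A\<^esub>i\<in>I. e i \<otimes>\<^bsub>A\<^esub> f i) = \<one>\<^bsub>A\<^esub>"
  shows "separable_algebra A"
proof -
  interpret tensor_product A "opposite_algebra A"
    by (intro tensor_product.intro A type_algebra_opposite)
  have ec: "e i \<in> carrier A" and fc: "f i \<in> carrier A" if "i \<in> I" for i using e f that by auto
  define \<epsilon> where "\<epsilon> = (\<Oplus>\<^bsub>E\<^esub>i\<in>I. pt (e i) (f i))"
  have \<epsilon>c: "\<epsilon> \<in> carrier E" unfolding \<epsilon>_def using ec fc by (intro E.finsum_closed) auto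
  have act: "pt a b \<otimes>\<^bsub>E\<^esub> \<epsilon> = (\<Oplus>\<^bsub>E\<^esub>i\<in>I. pt (a \<otimes>\<^bsub>A\<^esub> e i) (f i \<otimes>\<^bsub>A\<^esub> b))"
    if "a \<in> carrier A" "b \<in> carrier A" for a b
  proof -
    have "pt a b \<otimes>\<^bsub>E\<^esub> \<epsilon> = (\<Oplus>\<^bsub>E\<^esub>i\<in>I. pt a b \<otimes>\<^bsub>E\<^esub> pt (e i) (f i))"
      unfolding \<epsilon>_def using I that ec fc by (intro E.finsum_rdistr) auto
    also have "\<dots> = (\<Oplus>\<^bsub>E\<^esub>i\<in>I. pt (a \<otimes>\<^bsub>A\<^esub> e i) (f i \<otimes>\<^bsub>A\<^esub> b))"
      using that ec fc by (intro E.finsum_cong' refl) (auto simp: pt_mult)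
    finally show ?thesis .
  qed
  have pt_left_hom: "(\<lambda>x. pt x b) \<in> hom (add_monoid A) (add_monoid E)" if "b \<in> carrier A" for b
    using that by (intro homI) (auto simp: pt_add_left)
  have pt_right_hom: "pt a \<in> hom (add_monoid A) (add_monoid E)" if "a \<in> carrier A" for a
    using that pt_add_right[of a] by (intro homI) auto
  \<comment> \<open>The coefficients produced by \<open>a\<close> on the left family are scalars, so
    they cross the tensor sign; after exchanging the sums they assemble to the action of
    \<open>a\<close> on the right family.\<close>
  have comm: "pt a \<one>\<^bsub>A\<^esub> \<otimes>\<^bsub>E\<^esub> \<epsilon> = pt \<one>\<^bsub>A\<^esub> a \<otimes>\<^bsub>E\<^esub> \<epsilon>" if a: "a \<in> carrier A" for a
  proof -
    have "pt (a \<otimes>\<^bsub>A\<^esub> e i) (f i) = (\<Oplus>\<^bsub>E\<^esub>s\<in>I. pt (e s) (c a s i \<odot>\<^bsub>A\<^esub> f i))" if i: "i \<in> I" for i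
    proof -
      have "pt (a \<otimes>\<^bsub>A\<^esub> e i) (f i) = (\<Oplus>\<^bsub>E\<^esub>s\<in>I. pt (c a s i \<odot>\<^bsub>A\<^esub> e s) (f i))"
        unfolding ae[OF a i] lin_comb_def
        using ec fc i
        by (intro hom_finsum[OF A.abelian_group_axioms E.abelian_group_axioms pt_left_hom]) auto
      also have "\<dots> = (\<Oplus>\<^bsub>E\<^esub>s\<in>I. pt (e s) (c a s i \<odot>\<^bsub>A\<^esub> f i))"
      proof (intro E.finsum_cong' refl)
        fix s assume "s \<in> I"
        then show "pt (c a s i \<odot>\<^bsub>A\<^esub> e s) (f i) = pt (e s) (c a s i \<odot>\<^bsub>A\<^esub> f i)"
          using ec fc i pt_smult[of "e s" "f i" "c a s i"] by simp
      qed (use ec fc i in auto)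
      finally show ?thesis .
    qed
    note expand = this
    have "pt a \<one>\<^bsub>A\<^esub> \<otimes>\<^bsub>E\<^esub> \<epsilon> = (\<Oplus>\<^bsub>E\<^esub>i\<in>I. pt (a \<otimes>\<^bsub>A\<^esub> e i) (f i \<otimes>\<^bsub>A\<^esub> \<one>\<^bsub>A\<^esub>))"
      using a by (intro act) auto
    also have "\<dots> = (\<Oplus>\<^bsub>E\<^esub>i\<in>I. \<Oplus>\<^bsub>E\<^esub>s\<in>I. pt (e s) (c a s i \<odot>\<^bsub>A\<^esub> f i))"
      by (intro E.finsum_cong' refl) (use ec fc in \<open>auto simp: expand intro!: E.finsum_closed\<close>)
    also have "\<dots> = (\<Oplus>\<^bsub>E\<^esub>s\<in>I. \<Oplus>\<^bsub>E\<^esub>i\<in>I. pt (e s) (c a s i \<odot>\<^bsub>A\<^esub> f i))"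
      using ec fc I by (intro E.finsum_swap) auto
    also have "\<dots> = (\<Oplus>\<^bsub>E\<^esub>s\<in>I. pt (e s) (f s \<otimes>\<^bsub>A\<^esub> a))"
    proof (intro E.finsum_cong' refl)
      fix s assume s: "s \<in> I"
      show "(\<Oplus>\<^bsub>E\<^esub>i\<in>I. pt (e s) (c a s i \<odot>\<^bsub>A\<^esub> f i)) = pt (e s) (f s \<otimes>\<^bsub>A\<^esub> a)"
        unfolding fa[OF a s] lin_comb_def
        using ec fc s
        by (intro hom_finsum[OF A.abelian_group_axioms E.abelian_group_axioms pt_right_hom, symmetric]) auto
    qed (use a ec fc in auto)
    also have "\<dots> = (\<Oplus>\<^bsub>E\<^esub>i\<in>I. pt (\<one>\<^bsub>A\<^esub> \<otimes>\<^bsub>A\<^esub> e i) (f i \<otimes>\<^bsub>A\<^esub> a))"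
      by (intro E.finsum_cong' refl) (use ec fc a in auto)
    also have "\<dots> = pt \<one>\<^bsub>A\<^esub> a \<otimes>\<^bsub>E\<^esub> \<epsilon>"
      using a by (intro act[symmetric]) auto
    finally show ?thesis .
  qed
  obtain \<mu> where \<mu>: "\<mu> \<in> hom (add_monoid E) (add_monoid A)"
    and \<mu>_pt: "\<And>a b. a \<in> carrier A \<Longrightarrow> b \<in> carrier A \<Longrightarrow> \<mu> (pt a b) = a \<otimes>\<^bsub>A\<^esub> b"
  proof (rule ex_tensor_hom[of "add_monoid A" "\<lambda>a b. a \<otimes>\<^bsub>A\<^esub> b"])
    show "comm_group (add_monoid A)" by (rule A.a_comm_group)
  next
    fix s a b assume "a \<in> carrier A" "b \<in> carrier (opposite_algebra A)"
    then show "(s \<odot>\<^bsub>A\<^esub> a) \<otimes>\<^bsub>A\<^esub> b = a \<otimes>\<^bsub>A\<^esub> (s \<odot>\<^bsub>opposite_algebra A\<^esub> b)"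
      by (simp add: type_algebraD(11,12)[OF A])
  qed (use that in \<open>auto simp: A.l_distr A.r_distr\<close>)
  \<comment> \<open>The section is \<open>x \<mapsto> x \<epsilon>\<close>. It is a bimodule map
    because \<open>\<epsilon>\<close> commutes with \<open>A\<close>, and \<open>one\<close> makes
    it a section of the multiplication.\<close>
  define \<sigma> where "\<sigma> x = pt x \<one>\<^bsub>A\<^esub> \<otimes>\<^bsub>E\<^esub> \<epsilon>" for x
  have "\<sigma> \<in> hom (add_monoid A) (add_monoid E)"
    by (rule homI) (auto simp: \<sigma>_def \<epsilon>c pt_add_left E.l_distr)
  moreover have "\<sigma> (a \<otimes>\<^bsub>A\<^esub> x \<otimes>\<^bsub>A\<^esub> b) = pt a b \<otimes>\<^bsub>E\<^esub> \<sigma> x"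
    if "a \<in> carrier A" "x \<in> carrier A" "b \<in> carrier A" for a x b
  proof -
    have "\<sigma> (a \<otimes>\<^bsub>A\<^esub> x \<otimes>\<^bsub>A\<^esub> b) = pt (a \<otimes>\<^bsub>A\<^esub> x) \<one>\<^bsub>A\<^esub> \<otimes>\<^bsub>E\<^esub> (pt b \<one>\<^bsub>A\<^esub> \<otimes>\<^bsub>E\<^esub> \<epsilon>)"
      using that \<epsilon>c by (simp add: \<sigma>_def pt_mult E.m_assoc[symmetric])
    also have "\<dots> = pt (a \<otimes>\<^bsub>A\<^esub> x) b \<otimes>\<^bsub>E\<^esub> \<epsilon>"
      using that \<epsilon>c by (simp add: comm pt_mult E.m_assoc[symmetric])
    also have "\<dots> = pt a b \<otimes>\<^bsub>E\<^esub> \<sigma> x"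
      using that \<epsilon>c by (simp add: \<sigma>_def pt_mult E.m_assoc[symmetric])
    finally show ?thesis .
  qed
  moreover have "\<mu> (\<sigma> x) = x" if x: "x \<in> carrier A" for x
  proof -
    have "\<mu> (\<sigma> x) = \<mu> (\<Oplus>\<^bsub>E\<^esub>i\<in>I. pt (x \<otimes>\<^bsub>A\<^esub> e i) (f i \<otimes>\<^bsub>A\<^esub> \<one>\<^bsub>A\<^esub>))"
      using x by (simp only: \<sigma>_def act A.one_closed)
    also have "\<dots> = (\<Oplus>\<^bsub>A\<^esub>i\<in>I. \<mu> (pt (x \<otimes>\<^bsub>A\<^esub> e i) (f i \<otimes>\<^bsub>A\<^esub> \<one>\<^bsub>A\<^esub>)))"
      using x ec fc by (intro hom_finsum[OF E.abelian_group_axioms A.abelian_group_axioms \<mu>]) auto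
    also have "\<dots> = (\<Oplus>\<^bsub>A\<^esub>i\<in>I. x \<otimes>\<^bsub>A\<^esub> (e i \<otimes>\<^bsub>A\<^esub> f i))"
      using x ec fc by (intro A.finsum_cong' refl) (auto simp: \<mu>_pt A.m_assoc)
    also have "\<dots> = x \<otimes>\<^bsub>A\<^esub> (\<Oplus>\<^bsub>A\<^esub>i\<in>I. e i \<otimes>\<^bsub>A\<^esub> f i)"
      using I x ec fc by (intro A.finsum_rdistr[symmetric]) auto
    finally show ?thesis using x by (simp add: one)
  qed
  ultimately show ?thesis
    unfolding separable_algebra_def Let_def using \<mu> \<mu>_pt
    by (intro exI[of _ \<mu>] exI[of _ \<sigma>] conjI ballI) simp_all
qed

section \<open>Separability of algebras isomorphic to a split one\<close>

lemma algebra_iso_inverse: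
  assumes A: "type_algebra A" and h: "h \<in> algebra_hom A B" and bij: "bij_betw h (carrier A) (carrier B)"
  obtains g where "g \<in> algebra_hom B A" "bij_betw g (carrier B) (carrier A)"
    "\<And>x. x \<in> carrier A \<Longrightarrow> g (h x) = x" "\<And>y. y \<in> carrier B \<Longrightarrow> h (g y) = y"
proof -
  define g where "g = inv_into (carrier A) h"
  interpret A: ring A by (rule type_algebraD(1)[OF A])
  have gh: "g (h x) = x" if "x \<in> carrier A" for x
    using bij that by (simp add: g_def bij_betw_def)
  have hg: "h (g y) = y" and gc: "g y \<in> carrier A" if "y \<in> carrier B" for y
    using bij that f_inv_into_f[of y h "carrier A"] inv_into_into[of y h "carrier A"]
    by (simp_all add: g_def bij_betw_def)
  note hD = algebra_homD[OF h]
  have eqI: "g y = x" if "x \<in> carrier A" "h x = y" for x y using gh that by blast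
  have "g \<in> algebra_hom B A"
    by (rule algebra_homI)
       (auto intro!: eqI simp: hD hg gc type_algebraD(3)[OF A])
  moreover have "bij_betw g (carrier B) (carrier A)"
    unfolding g_def by (rule bij_betw_inv_into[OF bij])
  ultimately show thesis using that gh hg by blast
qed

text \<open>In each matrix block the separability idempotent is the sum of
  \<open>E r 0 \<otimes> E 0 r\<close> over \<open>r\<close>: the first column under left
  multiplication and the first row under right multiplication both transform by the matrix itself.
  Using a single column avoids dividing by the size 2 of the blocks, which would be impossible in
  characteristic two.\<close>

lemma separable_of_split:
  fixes A :: "('r::comm_ring_1, 'a) module"
  assumes A: "type_algebra A" and h: "h \<in> algebra_hom A (split_algebra m)"
    and bij: "bij_betw h (carrier A) (carrier (split_algebra m))"
  shows "separable_algebra A"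
proof -
  let ?P = "split_algebra m :: ('r, _) module"
  note P = type_algebra_split_algebra[of m, where 'r = 'r]
  interpret A: ring A by (rule type_algebraD(1)[OF A])
  interpret P: ring ?P by (rule type_algebraD(1)[OF P])
  obtain g where g: "g \<in> algebra_hom ?P A" and gh: "\<And>x. x \<in> carrier A \<Longrightarrow> g (h x) = x"
    using algebra_iso_inverse[OF A h bij] by metis
  note gD = algebra_homD[OF g]
  define I where "I = ({1..m} \<times> {..<2 :: nat}) <+> {1..4 :: nat}"
  define e :: "nat \<times> nat + nat \<Rightarrow> _" where "e x = split_elem m (\<lambda>i r s. if x = Inl (i, r) \<and> s = 0 then 1 else 0)
      (\<lambda>j. if x = Inr j then 1 else 0 :: 'r)" for x
  define f :: "nat \<times> nat + nat \<Rightarrow> _" where "f x = split_elem m (\<lambda>i r s. if x = Inl (i, s) \<and> r = 0 then 1 else 0)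
      (\<lambda>j. if x = Inr j then 1 else 0 :: 'r)" for x
  \<comment> \<open>The matrix of left multiplication on the family \<open>e\<close>: block
    diagonal, with the matrix blocks of the element and its four scalars on the diagonal.\<close>
  define c :: "(nat \<Rightarrow> nat \<Rightarrow> nat \<Rightarrow> 'r) \<Rightarrow> (nat \<Rightarrow> 'r) \<Rightarrow> nat \<times> nat + nat \<Rightarrow> nat \<times> nat + nat \<Rightarrow> 'r"
    where "c F z s x = (case (s, x) of (Inl (i, a), Inl (i', b)) \<Rightarrow> if i = i' then F i a b else 0
        | (Inr j, Inr j') \<Rightarrow> if j = j' then z j else 0 | _ \<Rightarrow> 0)" for F z s x
  have I: "finite I" by (simp add: I_def)
  have lc_e: "lin_comb ?P I e d = split_elem m (\<lambda>i r s. if s = 0 then d (Inl (i, r)) else 0) (\<lambda>j. d (Inr j))" for d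
    unfolding e_def lin_comb_split_elem[OF I]
    by (intro split_elem_cong) (auto simp: I_def if_distrib[of "\<lambda>a. _ * a"] cong: if_cong)
  have lc_f: "lin_comb ?P I f d = split_elem m (\<lambda>i r s. if r = 0 then d (Inl (i, s)) else 0) (\<lambda>j. d (Inr j))" for d
    unfolding f_def lin_comb_split_elem[OF I]
    by (intro split_elem_cong) (auto simp: I_def if_distrib[of "\<lambda>a. _ * a"] cong: if_cong)
  have ec: "e \<in> I \<rightarrow> carrier ?P" and fc: "f \<in> I \<rightarrow> carrier ?P" by (auto simp: e_def f_def)
  have ec': "e i \<in> carrier ?P" and fc': "f i \<in> carrier ?P" for i by (simp_all add: e_def f_def)
  have Pe: "split_elem m F z \<otimes>\<^bsub>?P\<^esub> e i = lin_comb ?P I e (\<lambda>s. c F z s i)" if "i \<in> I" for i F z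
    using that unfolding lc_e e_def split_elem_mult
    by (intro split_elem_cong) (auto simp: I_def c_def dest!: less_2_cases split: if_splits)
  have Pf: "f s \<otimes>\<^bsub>?P\<^esub> split_elem m F z = lin_comb ?P I f (\<lambda>i. c F z s i)" if "s \<in> I" for s F z
    using that unfolding lc_f f_def split_elem_mult
    by (intro split_elem_cong) (auto simp: I_def c_def dest!: less_2_cases split: if_splits)
  have "(\<Oplus>\<^bsub>?P\<^esub>i\<in>I. e i \<otimes>\<^bsub>?P\<^esub> f i) =
      lin_comb ?P I (\<lambda>x. split_elem m (\<lambda>i r s. if x = Inl (i, r) \<and> r = s then 1 else 0)
        (\<lambda>j. if x = Inr j then 1 else 0)) (\<lambda>_. 1)"
    unfolding lin_comb_def e_def f_def split_elem_mult split_elem_smult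
    by (intro P.finsum_cong' refl) (auto intro!: split_elem_cong)
  also have "\<dots> = \<one>\<^bsub>?P\<^esub>"
    unfolding lin_comb_split_elem[OF I] split_elem_one
    by (intro split_elem_cong) (auto simp: I_def)
  finally have P1: "(\<Oplus>\<^bsub>?P\<^esub>i\<in>I. e i \<otimes>\<^bsub>?P\<^esub> f i) = \<one>\<^bsub>?P\<^esub>" .
  have img: "g (lin_comb ?P I b d) = lin_comb A I (\<lambda>i. g (b i)) d" if "b \<in> I \<rightarrow> carrier ?P" for b d
    using lin_comb_image[OF P A gD(1), of "\<lambda>r. r"] that gD(4) by simp
  \<comment> \<open>The coefficients must be a function of the algebra element, so coordinates of
    its image are chosen once and for all.\<close>
  define coord where "coord a = (SOME (F, z). h a = split_elem m F z)" for a
  have coord: "h a = split_elem m (fst (coord a)) (snd (coord a))" if a: "a \<in> carrier A" for a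
  proof -
    obtain F z where "h a = split_elem m F z"
      using algebra_homD(3)[OF h a] by (rule split_elem_cases)
    then show ?thesis unfolding coord_def
      by (metis (mono_tags, lifting) case_prod_unfold fst_conv snd_conv someI)
  qed
  show ?thesis
  proof (rule separable_algebraI[OF A I, of "\<lambda>i. g (e i)" "\<lambda>i. g (f i)"
        "\<lambda>a. c (fst (coord a)) (snd (coord a))"])
    show "(\<lambda>i. g (e i)) \<in> I \<rightarrow> carrier A" "(\<lambda>i. g (f i)) \<in> I \<rightarrow> carrier A"
      by (simp_all add: Pi_iff gD(3) ec' fc')
    have "(\<Oplus>\<^bsub>A\<^esub>i\<in>I. g (e i) \<otimes>\<^bsub>A\<^esub> g (f i)) = (\<Oplus>\<^bsub>A\<^esub>i\<in>I. g (e i \<otimes>\<^bsub>?P\<^esub> f i))"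
      by (intro A.finsum_cong' refl) (simp_all add: Pi_iff gD(3,6) ec' fc')
    also have "\<dots> = g (\<Oplus>\<^bsub>?P\<^esub>i\<in>I. e i \<otimes>\<^bsub>?P\<^esub> f i)"
      using ec fc by (intro hom_finsum[OF P.abelian_group_axioms A.abelian_group_axioms gD(1), symmetric]) auto
    finally show "(\<Oplus>\<^bsub>A\<^esub>i\<in>I. g (e i) \<otimes>\<^bsub>A\<^esub> g (f i)) = \<one>\<^bsub>A\<^esub>" by (simp add: P1 gD(7))
  next
    fix a i assume a: "a \<in> carrier A" and i: "i \<in> I"
    have "e i \<in> carrier ?P" "f i \<in> carrier ?P" using ec fc i by auto
    then have *: "a \<otimes>\<^bsub>A\<^esub> g (e i) = g (h a \<otimes>\<^bsub>?P\<^esub> e i)" "g (f i) \<otimes>\<^bsub>A\<^esub> a = g (f i \<otimes>\<^bsub>?P\<^esub> h a)"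
      using a gD(6) gh algebra_homD(3)[OF h] by simp_all
    show "a \<otimes>\<^bsub>A\<^esub> g (e i) = lin_comb A I (\<lambda>i. g (e i)) (\<lambda>s. c (fst (coord a)) (snd (coord a)) s i)"
      unfolding * coord[OF a] Pe[OF i] img[OF ec] ..
    show "g (f i) \<otimes>\<^bsub>A\<^esub> a = lin_comb A I (\<lambda>i. g (f i)) (c (fst (coord a)) (snd (coord a)) i)"
      unfolding * coord[OF a] Pf[OF i] img[OF fc] ..
  qed
qed

section \<open>Dimension\<close>

context
  fixes A :: "('k::field, 'a) module"
  assumes A: "type_algebra A"
begin

interpretation V: vectorspace "ring_of_type_algebra :: 'k ring" A
  by (intro vectorspace.intro type_algebraD(2)[OF A] field_from_type_algebra)

text \<open>A repetition \<open>f i = f j\<close> would give the nontrivial relation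
  \<open>f i - f j = 0\<close>. Injectivity is the bridge from families to sets, for which the
  dimension theory of vector spaces is available.\<close>

lemma inj_on_of_independent:
  assumes I: "finite I" and f: "f \<in> I \<rightarrow> carrier A"
    and indep: "\<forall>c. lin_comb A I f c = \<zero>\<^bsub>A\<^esub> \<longrightarrow> (\<forall>i\<in>I. c i = 0)"
  shows "inj_on f I"
proof (rule inj_onI, rule ccontr)
  fix i j assume ij: "i \<in> I" "j \<in> I" "f i = f j" "i \<noteq> j"
  have "f j \<in> carrier A" using f ij(2) by auto
  then have "lin_comb A I f (\<lambda>k. (if k = i then 1 else 0) - (if k = j then 1 else 0)) = \<zero>\<^bsub>A\<^esub>"
    using ij lin_comb_delta[OF A I _ f, of _ 1]
    by (simp add: lin_comb_diff[OF A f] a_minus_def V.M.r_neg)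
  then show False using indep ij(1,4) by force
qed

lemma lincomb_image:
  assumes "inj_on f I" "f \<in> I \<rightarrow> carrier A"
  shows "V.lincomb a (f ` I) = lin_comb A I f (\<lambda>i. a (f i))"
  unfolding V.lincomb_def lin_comb_def using assms by (intro V.finsum_reindex) auto

lemma lin_comb_in_span:
  assumes "finite I" "f \<in> I \<rightarrow> carrier A"
  shows "lin_comb A I f c \<in> V.span (f ` I)"
proof -
  interpret S: submodule "ring_of_type_algebra :: 'k ring" "V.span (f ` I)" A
    using assms by (intro V.span_is_submodule) auto
  have "f ` I \<subseteq> V.span (f ` I)" using assms by (intro V.in_own_span) auto
  then have mem: "c i \<odot>\<^bsub>A\<^esub> f i \<in> V.span (f ` I)" if "i \<in> I" for i using that by auto
  have "(\<Oplus>\<^bsub>A\<^esub>i\<in>J. c i \<odot>\<^bsub>A\<^esub> f i) \<in> V.span (f ` I)" if "J \<subseteq> I" for J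
    using finite_subset[OF that assms(1)] that
  proof (induction J rule: finite_induct)
    case (insert i J)
    then have "(\<lambda>i. c i \<odot>\<^bsub>A\<^esub> f i) \<in> J \<rightarrow> carrier A" "c i \<odot>\<^bsub>A\<^esub> f i \<in> carrier A"
      using mem S.subset by blast+
    then show ?case using insert mem by (simp add: V.finsum_insert)
  qed simp
  then show ?thesis by (simp add: lin_comb_def)
qed

lemma lin_indpt_image:
  assumes I: "finite I" and f: "f \<in> I \<rightarrow> carrier A"
    and indep: "\<forall>c. lin_comb A I f c = \<zero>\<^bsub>A\<^esub> \<longrightarrow> (\<forall>i\<in>I. c i = 0)"
  shows "V.lin_indpt (f ` I)"
proof (rule V.finite_lin_indpt2)
  show "\<forall>v\<in>f ` I. a v = \<zero>\<^bsub>ring_of_type_algebra\<^esub>" if "V.lincomb a (f ` I) = \<zero>\<^bsub>A\<^esub>" for a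
    using that indep by (auto simp: lincomb_image[OF inj_on_of_independent[OF I f indep] f])
qed (use I f in auto)

lemma basis_image:
  assumes b: "basis_family A I b"
  shows "V.basis (b ` I)" "inj_on b I"
proof -
  note bD = basis_familyD[OF b]
  have indep: "\<forall>c. lin_comb A I b c = \<zero>\<^bsub>A\<^esub> \<longrightarrow> (\<forall>i\<in>I. c i = 0)" using b by (simp add: basis_family_def)
  show "inj_on b I" using bD(1,2) indep by (rule inj_on_of_independent)
  have "V.span (b ` I) = carrier A"
  proof
    show "V.span (b ` I) \<subseteq> carrier A" using bD(2) by (intro V.span_is_subset2) auto
    show "carrier A \<subseteq> V.span (b ` I)" using bD(4) lin_comb_in_span[OF bD(1,2)] by blast
  qed
  then show "V.basis (b ` I)"
    unfolding V.basis_def using bD(2) lin_indpt_image[OF bD(1,2) indep] by auto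
qed

lemma dim_eq_card: "basis_family A I b \<Longrightarrow> V.dim = card I" "basis_family A I b \<Longrightarrow> V.fin_dim"
proof -
  assume b: "basis_family A I b"
  have "V.dim = card (b ` I)"
    by (rule V.dim_basis[OF finite_imageI[OF basis_familyD(1)[OF b]] basis_image(1)[OF b]])
  then show "V.dim = card I" using basis_image(2)[OF b] by (simp add: card_image)
  show "V.fin_dim" unfolding V.fin_dim_def
    using basis_image(1)[OF b] basis_familyD(1)[OF b] unfolding V.basis_def
    by (intro exI[of _ "b ` I"]) simp
qed

lemma basis_family_of_basis:
  assumes I: "finite I" and f: "f \<in> I \<rightarrow> carrier A" "inj_on f I" and basis: "V.basis (f ` I)"
  shows "basis_family A I f"
  unfolding basis_family_def
proof (intro conjI ballI allI impI)
  fix x assume "x \<in> carrier A"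
  then have "x \<in> V.span (f ` I)" using basis by (simp add: V.basis_def)
  then obtain a where "V.lincomb a (f ` I) = x"
    using V.finite_in_span[of "f ` I" x] I f by auto
  then show "\<exists>c. x = lin_comb A I f c" using lincomb_image[OF f(2,1)] by metis
next
  fix c i assume c: "lin_comb A I f c = \<zero>\<^bsub>A\<^esub>" and i: "i \<in> I"
  define a where "a v = c (inv_into I f v)" for v
  have "lin_comb A I f (\<lambda>i. a (f i)) = lin_comb A I f c"
    using f by (intro lin_comb_cong[OF A]) (auto simp: a_def)
  then have "V.lincomb a (f ` I) = \<zero>\<^bsub>A\<^esub>" using c lincomb_image[OF f(2,1)] by simp
  moreover have "V.lin_indpt (f ` I)" using basis by (simp add: V.basis_def)
  ultimately have "a (f i) = 0"
    using V.not_lindepD[of "f ` I" "f ` I" a] I i by auto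
  then show "c i = 0" using f i by (simp add: a_def)
qed (use I f in auto)

lemma basis_family_of_spanning:
  assumes b: "basis_family A J b" and I: "finite I" "card I = card J" and f: "f \<in> I \<rightarrow> carrier A"
    and span: "\<And>x. x \<in> carrier A \<Longrightarrow> \<exists>c. x = lin_comb A I f c"
  shows "basis_family A I f"
proof -
  have gen: "V.span (f ` I) = carrier A"
  proof
    show "V.span (f ` I) \<subseteq> carrier A" using f by (intro V.span_is_subset2) auto
    show "carrier A \<subseteq> V.span (f ` I)" using span lin_comb_in_span[OF I(1) f] by blast
  qed
  have dim: "V.dim = card I" using dim_eq_card(1)[OF b] I by simp
  \<comment> \<open>A generating set has at least as many elements as the dimension, so a spanning
    family of that length cannot repeat a vector.\<close>
  have "card I \<le> card (f ` I)" using V.gen_ge_dim[of "f ` I"] I f gen dim by auto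
  then have inj: "inj_on f I" using I(1) card_image_le[OF I(1), of f] by (simp add: eq_card_imp_inj_on)
  have "V.basis (f ` I)"
    using I f gen dim by (intro V.dim_gen_is_basis) (auto simp: card_image[OF inj])
  then show ?thesis using I f inj by (intro basis_family_of_basis)
qed

lemma basis_family_of_independent:
  assumes b: "basis_family A J b" and I: "finite I" "card I = card J" and f: "f \<in> I \<rightarrow> carrier A"
    and indep: "\<forall>c. lin_comb A I f c = \<zero>\<^bsub>A\<^esub> \<longrightarrow> (\<forall>i\<in>I. c i = 0)"
  shows "basis_family A I f"
proof -
  note inj = inj_on_of_independent[OF I(1) f indep]
  have "V.dim = card I" using dim_eq_card(1)[OF b] I by simp
  then have "V.basis (f ` I)"
    using I f dim_eq_card(2)[OF b] lin_indpt_image[OF I(1) f indep]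
    by (intro V.dim_li_is_basis) (auto simp: card_image[OF inj])
  then show ?thesis using I f inj by (intro basis_family_of_basis)
qed

text \<open>\<open>subspace_dim\<close> measures \<open>S\<close> as a vector space of its own,
  whereas the hypotheses on \<open>b\<close> live in \<open>A\<close>. Span and linear independence
  are the same in both.\<close>

lemma subspace_dim_eqI:
  assumes S: "S \<subseteq> carrier A" "\<zero>\<^bsub>A\<^esub> \<in> S" "\<And>x y. x \<in> S \<Longrightarrow> y \<in> S \<Longrightarrow> x \<oplus>\<^bsub>A\<^esub> y \<in> S"
      "\<And>r x. x \<in> S \<Longrightarrow> r \<odot>\<^bsub>A\<^esub> x \<in> S"
    and I: "finite I" and b: "b \<in> I \<rightarrow> S"
    and span: "\<And>x. x \<in> S \<Longrightarrow> \<exists>c. x = lin_comb A I b c"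
    and indep: "\<forall>c. lin_comb A I b c = \<zero>\<^bsub>A\<^esub> \<longrightarrow> (\<forall>i\<in>I. c i = 0)"
  shows "subspace_dim A S = card I"
proof -
  have bc: "b \<in> I \<rightarrow> carrier A" using b S(1) by auto
  have sub: "submodule (ring_of_type_algebra :: 'k ring) S A"
    using S by unfold_locales auto
  then have "subspace (ring_of_type_algebra :: 'k ring) S A"
    by (intro subspace.intro V.vectorspace_axioms)
  then interpret W: vectorspace "ring_of_type_algebra :: 'k ring" "A\<lparr>carrier := S\<rparr>"
    by (rule V.subspace_is_vs)
  have bS: "b ` I \<subseteq> S" using b by auto
  have "V.span (b ` I) = S"
  proof
    show "V.span (b ` I) \<subseteq> S" using bS sub by (intro V.span_is_subset)
    show "S \<subseteq> V.span (b ` I)" using span lin_comb_in_span[OF I bc] by blast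
  qed
  then have "W.basis (b ` I)"
    unfolding W.basis_def using bS V.span_li_not_depend[OF bS sub] lin_indpt_image[OF I bc indep]
    by auto
  then have "W.dim = card (b ` I)" using I by (intro W.dim_basis) auto
  then show ?thesis
    using inj_on_of_independent[OF I bc indep] by (simp add: subspace_dim_def card_image)
qed

end

section \<open>Simple components of split algebras\<close>

text \<open>The summand with index \<open>k\<close>, where \<open>Inl i\<close> stands for the block
  \<open>i\<close> and \<open>Inr j\<close> for the scalar summand \<open>j\<close>. Vanishing is
  demanded at all other indices, even invalid ones; \<open>component_iff\<close> shows that valid
  indices decide.\<close>

definition component :: "nat \<Rightarrow> nat + nat \<Rightarrow> ((nat \<Rightarrow> 'r::comm_ring_1 mat) \<times> (nat \<Rightarrow> 'r)) set" where
  "component m k = {split_elem m f z |f z.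
     (\<forall>i r s. Inl i \<noteq> k \<longrightarrow> f i r s = 0) \<and> (\<forall>j. Inr j \<noteq> k \<longrightarrow> z j = 0)}"

definition component_index :: "nat \<Rightarrow> (nat + nat) set" where
  "component_index m = {1..m} <+> {1..4}"

lemma component_iff:
  "split_elem m f z \<in> component m k \<longleftrightarrow>
    (\<forall>i\<in>{1..m}. Inl i \<noteq> k \<longrightarrow> (\<forall>r<2. \<forall>s<2. f i r s = 0)) \<and> (\<forall>j\<in>{1..4}. Inr j \<noteq> k \<longrightarrow> z j = 0)"
proof
  assume "split_elem m f z \<in> component m k"
  then show "(\<forall>i\<in>{1..m}. Inl i \<noteq> k \<longrightarrow> (\<forall>r<2. \<forall>s<2. f i r s = 0)) \<and> (\<forall>j\<in>{1..4}. Inr j \<noteq> k \<longrightarrow> z j = 0)"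
    by (auto simp: component_def split_elem_eq_iff)
next
  assume *: "(\<forall>i\<in>{1..m}. Inl i \<noteq> k \<longrightarrow> (\<forall>r<2. \<forall>s<2. f i r s = 0)) \<and> (\<forall>j\<in>{1..4}. Inr j \<noteq> k \<longrightarrow> z j = 0)"
  show "split_elem m f z \<in> component m k"
    unfolding component_def
    by (intro CollectI exI[of _ "\<lambda>i r s. if Inl i = k then f i r s else 0"]
        exI[of _ "\<lambda>j. if Inr j = k then z j else 0"]) (use * in \<open>auto simp: split_elem_eq_iff\<close>)
qed

lemma component_cases:
  assumes "x \<in> component m k"
  obtains f z where "x = split_elem m f z" "\<forall>i r s. Inl i \<noteq> k \<longrightarrow> f i r s = 0" "\<forall>j. Inr j \<noteq> k \<longrightarrow> z j = 0"
proof -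
  obtain f z where "x = split_elem m f z" "\<forall>i r s. Inl i \<noteq> k \<longrightarrow> f i r s = 0" "\<forall>j. Inr j \<noteq> k \<longrightarrow> z j = 0"
    using assms unfolding component_def by blast
  then show thesis by (intro that[of f z]) auto
qed

lemma ideal_component: "ideal (component m k) (split_algebra m :: ('r::comm_ring_1, _) module)"
proof -
  let ?P = "split_algebra m :: ('r, _) module"
  interpret P: ring ?P by (rule type_algebraD(1)[OF type_algebra_split_algebra])
  show ?thesis
  proof (rule idealI[OF P.ring_axioms])
    show "subgroup (component m k) (add_monoid ?P)"
    proof (rule P.add.subgroupI)
      show "component m k \<subseteq> carrier ?P" by (auto simp: component_def)
      have "split_elem m (\<lambda>_ _ _. 0) (\<lambda>_. 0) \<in> component m k" by (simp add: component_iff)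
      then show "component m k \<noteq> {}" by blast
    next
      fix x :: "(nat \<Rightarrow> 'r mat) \<times> (nat \<Rightarrow> 'r)" assume x: "x \<in> component m k"
      then obtain f z where fz: "x = split_elem m f z" "\<forall>i r s. Inl i \<noteq> k \<longrightarrow> f i r s = 0"
        "\<forall>j. Inr j \<noteq> k \<longrightarrow> z j = 0" by (rule component_cases)
      have "\<ominus>\<^bsub>?P\<^esub> x = split_elem m (\<lambda>i r s. - f i r s) (\<lambda>j. - z j)"
        by (rule P.minus_equality) (auto simp: fz(1) split_elem_simps)
      then show "\<ominus>\<^bsub>?P\<^esub> x \<in> component m k" using fz by (simp add: component_iff)
    next
      fix x y :: "(nat \<Rightarrow> 'r mat) \<times> (nat \<Rightarrow> 'r)" assume "x \<in> component m k" "y \<in> component m k"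
      then show "x \<oplus>\<^bsub>?P\<^esub> y \<in> component m k"
        by (elim component_cases) (simp add: split_elem_simps component_iff)
    qed
  next
    fix x y :: "(nat \<Rightarrow> 'r mat) \<times> (nat \<Rightarrow> 'r)"
    assume "x \<in> component m k" and "y \<in> carrier ?P"
    then show "y \<otimes>\<^bsub>?P\<^esub> x \<in> component m k" "x \<otimes>\<^bsub>?P\<^esub> y \<in> component m k"
      by (elim component_cases split_elem_cases; simp add: split_elem_simps component_iff)+
  qed
qed

text \<open>Multiplying by matrix units on both sides isolates one nonzero entry and moves it to any
  position, since \<open>E a r * X * E s b = X r s * E a b\<close>. Division by that entry then
  yields every matrix of the block.\<close>

lemma component_subset_ideal:
  fixes f :: "nat \<Rightarrow> nat \<Rightarrow> nat \<Rightarrow> 'k::field"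
  assumes J: "ideal J (split_algebra m)" and x: "split_elem m f z \<in> J"
  shows "i \<in> {1..m} \<Longrightarrow> r < 2 \<Longrightarrow> s < 2 \<Longrightarrow> f i r s \<noteq> 0 \<Longrightarrow> component m (Inl i) \<subseteq> J"
    and "j \<in> {1..4} \<Longrightarrow> z j \<noteq> 0 \<Longrightarrow> component m (Inr j) \<subseteq> J"
proof -
  let ?P = "split_algebra m :: ('k, _) module"
  interpret J: ideal J ?P by (rule J)
  {
    assume i: "i \<in> {1..m}" and r: "r < 2" and s: "s < 2" and nz: "f i r s \<noteq> 0"
    define W where "W a b c = split_elem m (\<lambda>i' r' s'. if i' = i \<and> r' = a \<and> s' = b then c else 0 :: 'k) (\<lambda>_. 0)" for a b c
    have W: "W a b c \<in> J" for a b c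
    proof -
      have "W a r (c / f i r s) \<otimes>\<^bsub>?P\<^esub> split_elem m f z \<otimes>\<^bsub>?P\<^esub> W s b 1 \<in> J"
        by (intro J.I_r_closed J.I_l_closed x) (auto simp: W_def)
      also have "W a r (c / f i r s) \<otimes>\<^bsub>?P\<^esub> split_elem m f z \<otimes>\<^bsub>?P\<^esub> W s b 1 = W a b c"
        unfolding W_def split_elem_mult using r s nz
        by (intro split_elem_cong) (auto dest!: less_2_cases)
      finally show ?thesis .
    qed
    have "W 0 0 a \<oplus>\<^bsub>?P\<^esub> W 0 1 b \<oplus>\<^bsub>?P\<^esub> (W 1 0 c \<oplus>\<^bsub>?P\<^esub> W 1 1 d) \<in> J" for a b c d
      by (intro additive_subgroup.a_closed[OF J.is_additive_subgroup] W)
    moreover have "split_elem m f' z' =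
        W 0 0 (f' i 0 0) \<oplus>\<^bsub>?P\<^esub> W 0 1 (f' i 0 1) \<oplus>\<^bsub>?P\<^esub> (W 1 0 (f' i 1 0) \<oplus>\<^bsub>?P\<^esub> W 1 1 (f' i 1 1))"
      if "\<forall>i' r s. Inl i' \<noteq> (Inl i :: nat + nat) \<longrightarrow> f' i' r s = 0"
        "\<forall>j. Inr j \<noteq> (Inl i :: nat + nat) \<longrightarrow> z' j = 0" for f' z'
      unfolding W_def split_elem_add using that
      by (intro split_elem_cong) (auto dest!: less_2_cases)
    ultimately show "component m (Inl i) \<subseteq> J"
      by (auto elim!: component_cases)
  }
  {
    assume j: "j \<in> {1..4}" and nz: "z j \<noteq> 0"
    have "split_elem m f' z' \<in> J"
      if *: "\<forall>i' r s. Inl i' \<noteq> (Inr j :: nat + nat) \<longrightarrow> f' i' r s = 0"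
        "\<forall>j'. Inr j' \<noteq> (Inr j :: nat + nat) \<longrightarrow> z' j' = 0" for f' z'
    proof -
      have "split_elem m (\<lambda>_ _ _. 0) (\<lambda>j'. if j' = j then z' j / z j else 0) \<otimes>\<^bsub>?P\<^esub> split_elem m f z \<in> J"
        by (intro J.I_l_closed x) auto
      also have "split_elem m (\<lambda>_ _ _. 0) (\<lambda>j'. if j' = j then z' j / z j else 0) \<otimes>\<^bsub>?P\<^esub> split_elem m f z =
          split_elem m f' z'"
        unfolding split_elem_mult using nz * by (intro split_elem_cong) auto
      finally show ?thesis .
    qed
    then show "component m (Inr j) \<subseteq> J" by (auto elim!: component_cases)
  }
qed

text \<open>The witness has all entries 1 in the summand \<open>k\<close> and 0 elsewhere, hence
  lies in no other component. Injectivity of the enumeration and minimality of the components both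
  come from this.\<close>

lemma component_nonzero:
  fixes m :: nat
  assumes "k \<in> component_index m"
  shows "component m k \<noteq> {\<zero>\<^bsub>split_algebra m :: ('k::field, _) module\<^esub>}"
    and "\<exists>x :: (nat \<Rightarrow> 'k mat) \<times> _. x \<in> component m k \<and> (\<forall>l. x \<in> component m l \<longrightarrow> l = k)"
proof -
  let ?x = "split_elem m (\<lambda>i r s. if Inl i = k then 1 else 0) (\<lambda>j. if Inr j = k then 1 else 0 :: 'k)"
  have x: "?x \<in> component m k" by (simp add: component_iff)
  have ex2: "\<exists>r :: nat. r < 2" by (rule exI[of _ 0]) simp
  have "?x \<noteq> \<zero>\<^bsub>split_algebra m\<^esub>"
    using assms
    by (auto simp: split_elem_zero split_elem_eq_iff component_index_def intro!: exI[of _ "0 :: nat"])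
  then show "component m k \<noteq> {\<zero>\<^bsub>split_algebra m :: ('k, _) module\<^esub>}" using x by blast
  have "l = k" if "?x \<in> component m l" for l
    using that assms ex2 by (auto simp: component_iff component_index_def)
  then show "\<exists>x :: (nat \<Rightarrow> 'k mat) \<times> _. x \<in> component m k \<and> (\<forall>l. x \<in> component m l \<longrightarrow> l = k)"
    using x by blast
qed

lemma inj_on_component:
  "inj_on (component m :: _ \<Rightarrow> ((nat \<Rightarrow> 'k::field mat) \<times> (nat \<Rightarrow> 'k)) set) (component_index m)"
proof (rule inj_onI)
  fix k l assume kl: "k \<in> component_index m"
    "(component m k :: ((nat \<Rightarrow> 'k mat) \<times> (nat \<Rightarrow> 'k)) set) = component m l"
  then show "k = l" using component_nonzero(2)[OF kl(1), where 'k = 'k] by metis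
qed

text \<open>Every nonzero ideal contains a component, and no component contains another; so the
  components are exactly the minimal nonzero ideals.\<close>

lemma simple_components_split_algebra:
  "simple_components (split_algebra m :: ('k::field, _) module) = component m ` component_index m"
proof -
  let ?P = "split_algebra m :: ('k, _) module"
  have ex: "\<exists>k\<in>component_index m. component m k \<subseteq> J" if J: "ideal J ?P" "J \<noteq> {\<zero>\<^bsub>?P\<^esub>}" for J
  proof -
    interpret J: ideal J ?P by (rule J)
    have "\<zero>\<^bsub>?P\<^esub> \<in> J" by (rule additive_subgroup.zero_closed[OF J.is_additive_subgroup])
    then have "\<not> J \<subseteq> {\<zero>\<^bsub>?P\<^esub>}" using J(2) by (metis empty_iff subset_singletonD)
    then obtain x where x: "x \<in> J" "x \<noteq> \<zero>\<^bsub>?P\<^esub>" by auto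
    obtain f z where fz: "x = split_elem m f z" using J.a_Hcarr[OF x(1)] by (rule split_elem_cases)
    have "(\<exists>i\<in>{1..m}. \<exists>r<2. \<exists>s<2. f i r s \<noteq> 0) \<or> (\<exists>j\<in>{1..4}. z j \<noteq> 0)"
      using x(2) by (auto simp: fz split_elem_zero split_elem_eq_iff)
    then show ?thesis
    proof (elim disjE bexE exE conjE)
      fix i r s assume "i \<in> {1..m}" "r < 2" "s < 2" "f i r s \<noteq> 0"
      then have "component m (Inl i) \<subseteq> J" "Inl i \<in> component_index m"
        using component_subset_ideal(1)[OF J(1) x(1)[unfolded fz]] by (auto simp: component_index_def)
      then show ?thesis by blast
    next
      fix j assume "j \<in> {1..4}" "z j \<noteq> 0"
      then have "component m (Inr j) \<subseteq> J" "Inr j \<in> component_index m"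
        using component_subset_ideal(2)[OF J(1) x(1)[unfolded fz]] by (auto simp: component_index_def)
      then show ?thesis by blast
    qed
  qed
  have eq: "k = l" if "k \<in> component_index m" "l \<in> component_index m"
    "(component m k :: ((nat \<Rightarrow> 'k mat) \<times> (nat \<Rightarrow> 'k)) set) \<subseteq> component m l" for k l
    using component_nonzero(2)[OF that(1), where 'k = 'k] that(3) by blast
  show ?thesis
  proof
    show "simple_components ?P \<subseteq> component m ` component_index m"
    proof
      fix J assume J: "J \<in> simple_components ?P"
      then obtain k where k: "k \<in> component_index m" "component m k \<subseteq> J"
        using ex[of J] by (auto simp: simple_components_def)
      then have "component m k = J"
        using J ideal_component component_nonzero(1)[OF k(1)] unfolding simple_components_def by blast
      then show "J \<in> component m ` component_index m" using k by blast
    qed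
    show "component m ` component_index m \<subseteq> simple_components ?P"
    proof
      fix I :: "((nat \<Rightarrow> 'k mat) \<times> (nat \<Rightarrow> 'k)) set"
      assume "I \<in> component m ` component_index m"
      then obtain k where k: "k \<in> component_index m" "I = component m k" by blast
      have "J = I" if J: "ideal J ?P" "J \<noteq> {\<zero>\<^bsub>?P\<^esub>}" "J \<subseteq> I" for J
      proof -
        obtain l where l: "l \<in> component_index m" "component m l \<subseteq> J" using ex[OF J(1,2)] by blast
        then have "l = k" using J(3) k eq by blast
        then show ?thesis using l J(3) k by blast
      qed
      then show "I \<in> simple_components ?P"
        unfolding simple_components_def
        using k ideal_component[of m k] component_nonzero(1)[OF k(1)] by auto
    qed
  qed
qed

text \<open>Preimages under an isomorphism and under its inverse are mutually inverse, monotone, and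
  match the zero ideals, so they preserve minimality among the nonzero ideals.\<close>

lemma simple_components_iso:
  assumes A: "type_algebra A" and B: "type_algebra B"
    and h: "h \<in> algebra_hom A B" and bij: "bij_betw h (carrier A) (carrier B)"
  shows "bij_betw (\<lambda>J. {x \<in> carrier A. h x \<in> J}) (simple_components B) (simple_components A)"
proof -
  obtain g where g: "g \<in> algebra_hom B A" and gh: "\<And>x. x \<in> carrier A \<Longrightarrow> g (h x) = x"
    and hg: "\<And>y. y \<in> carrier B \<Longrightarrow> h (g y) = y"
    using algebra_iso_inverse[OF A h bij] by metis
  interpret h: ring_hom_ring A B h
    by (rule ring_hom_ringI2[OF type_algebraD(1)[OF A] type_algebraD(1)[OF B] algebra_homD(2)[OF h]])
  interpret g: ring_hom_ring B A g
    by (rule ring_hom_ringI2[OF type_algebraD(1)[OF B] type_algebraD(1)[OF A] algebra_homD(2)[OF g]])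
  define F where "F J = {x \<in> carrier A. h x \<in> J}" for J
  define G where "G I = {y \<in> carrier B. g y \<in> I}" for I
  have F: "ideal (F J) A" if "ideal J B" for J unfolding F_def by (rule h.ideal_vimage[OF that])
  have G: "ideal (G I) B" if "ideal I A" for I unfolding G_def by (rule g.ideal_vimage[OF that])
  have sub: "I \<subseteq> carrier R" if "ideal I R" for I and R :: "('x, 'y) ring_scheme"
    using ideal.Icarr[OF that] by blast
  have FG: "F (G I) = I" if "ideal I A" for I
    using sub[OF that] by (auto simp: F_def G_def gh)
  have GF: "G (F J) = J" if "ideal J B" for J
    using sub[OF that] by (auto simp: F_def G_def hg)
  have F0: "F {\<zero>\<^bsub>B\<^esub>} = {\<zero>\<^bsub>A\<^esub>}" and G0: "G {\<zero>\<^bsub>A\<^esub>} = {\<zero>\<^bsub>B\<^esub>}"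
    using GF[OF h.S.zeroideal] FG[OF h.R.zeroideal] gh hg
    by (auto simp: F_def G_def)
  have F_mono: "F J \<subseteq> F J'" if "J \<subseteq> J'" for J J' using that by (auto simp: F_def)
  have G_mono: "G J \<subseteq> G J'" if "J \<subseteq> J'" for J J' using that by (auto simp: G_def)
  have F_simple: "F J \<in> simple_components A" if J: "J \<in> simple_components B" for J
  proof -
    have J': "ideal J B" "J \<noteq> {\<zero>\<^bsub>B\<^esub>}" and
      min: "\<And>J'. ideal J' B \<Longrightarrow> J' \<noteq> {\<zero>\<^bsub>B\<^esub>} \<Longrightarrow> J' \<subseteq> J \<Longrightarrow> J' = J"
      using J by (auto simp: simple_components_def)
    have "F J \<noteq> {\<zero>\<^bsub>A\<^esub>}" using J' GF G0 by metis
    moreover have "I = F J" if "ideal I A" "I \<noteq> {\<zero>\<^bsub>A\<^esub>}" "I \<subseteq> F J" for I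
    proof -
      have "G I = J" using that min[OF G[OF that(1)]] G_mono[OF that(3)] GF[OF J'(1)] FG F0 by metis
      then show ?thesis using FG[OF that(1)] by simp
    qed
    ultimately show ?thesis using F[OF J'(1)] by (auto simp: simple_components_def)
  qed
  have G_simple: "G I \<in> simple_components B" if I: "I \<in> simple_components A" for I
  proof -
    have I': "ideal I A" "I \<noteq> {\<zero>\<^bsub>A\<^esub>}" and
      min: "\<And>J'. ideal J' A \<Longrightarrow> J' \<noteq> {\<zero>\<^bsub>A\<^esub>} \<Longrightarrow> J' \<subseteq> I \<Longrightarrow> J' = I"
      using I by (auto simp: simple_components_def)
    have "G I \<noteq> {\<zero>\<^bsub>B\<^esub>}" using I' FG F0 by metis
    moreover have "J = G I" if "ideal J B" "J \<noteq> {\<zero>\<^bsub>B\<^esub>}" "J \<subseteq> G I" for J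
    proof -
      have "F J = I" using that min[OF F[OF that(1)]] F_mono[OF that(3)] FG[OF I'(1)] GF G0 by metis
      then show ?thesis using GF[OF that(1)] by simp
    qed
    ultimately show ?thesis using G[OF I'(1)] by (auto simp: simple_components_def)
  qed
  have "bij_betw F (simple_components B) (simple_components A)"
    by (rule bij_betwI[of _ _ _ G])
       (use F_simple G_simple FG GF in \<open>auto simp: simple_components_def\<close>)
  then show ?thesis by (simp add: F_def[abs_def])
qed

text \<open>The preimages of the summands are the simple components, and the matrix units of a
  summand pull back to a basis: four for a block, one for a scalar summand.\<close>

lemma simple_components_of_split:
  fixes A :: "('k::field, 'a) module"
  assumes A: "type_algebra A" and h: "h \<in> algebra_hom A (split_algebra m)"
    and bij: "bij_betw h (carrier A) (carrier (split_algebra m))"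
  obtains c where "bij_betw c (component_index m) (simple_components A)"
    and "\<And>k. k \<in> component_index m \<Longrightarrow> subspace_dim A (c k) = (case k of Inl _ \<Rightarrow> 4 | Inr _ \<Rightarrow> 1)"
proof -
  let ?P = "split_algebra m :: ('k, _) module"
  note P = type_algebra_split_algebra[of m, where 'r = 'k]
  note hD = algebra_homD[OF h]
  define c where "c k = {x \<in> carrier A. h x \<in> component m k}" for k
  have "bij_betw (component m) (component_index m) (simple_components ?P)"
    by (simp add: bij_betw_def inj_on_component simple_components_split_algebra)
  from bij_betw_trans[OF this simple_components_iso[OF A P h bij]]
  have 1: "bij_betw c (component_index m) (simple_components A)"
    by (simp add: c_def[abs_def] comp_def)
  obtain g where g: "g \<in> algebra_hom ?P A" and gh: "\<And>x. x \<in> carrier A \<Longrightarrow> g (h x) = x"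
    and hg: "\<And>y. y \<in> carrier ?P \<Longrightarrow> h (g y) = y"
    using algebra_iso_inverse[OF A h bij] by metis
  note gD = algebra_homD[OF g]
  have 2: "subspace_dim A (c k) = (case k of Inl _ \<Rightarrow> 4 | Inr _ \<Rightarrow> 1)" if k: "k \<in> component_index m" for k
  proof -
    \<comment> \<open>\<open>U\<close> is the set of indices of the matrix units that lie in the
      component \<open>k\<close>.\<close>
    obtain U :: "(nat * nat * nat + nat) set"
      where U_iff: "\<And>i r s. Inl (i, r, s) \<in> U \<longleftrightarrow> k = Inl i \<and> r < 2 \<and> s < 2" "\<And>j. Inr j \<in> U \<longleftrightarrow> k = Inr j"
        and U: "finite U" and cardU: "card U = (case k of Inl _ \<Rightarrow> 4 | Inr _ \<Rightarrow> 1)"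
    proof (cases k)
      case (Inl i)
      show thesis
        by (rule that[of "{Inl (i, 0, 0), Inl (i, 0, 1), Inl (i, 1, 0), Inl (i, 1, 1)}"])
           (auto simp: Inl less_2_cases_iff)
    next
      case (Inr j)
      show thesis by (rule that[of "{Inr j}"]) (auto simp: Inr)
    qed
    have UI: "U \<subseteq> split_index m"
    proof
      fix x assume "x \<in> U"
      then show "x \<in> split_index m"
        using k U_iff by (cases x) (auto simp: component_index_def split_index_def)
    qed
    have lc: "lin_comb ?P U (matrix_unit m) d =
        split_elem m (\<lambda>i r s. if Inl (i, r, s) \<in> U then d (Inl (i, r, s)) else 0)
          (\<lambda>j. if Inr j \<in> U then d (Inr j) else 0)" for d
      unfolding matrix_unit_def lin_comb_split_elem[OF U]
      by (intro split_elem_cong) (auto simp: U if_distrib[of "\<lambda>a. _ * a"] cong: if_cong)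
    have muc: "matrix_unit m x \<in> carrier ?P" for x by (simp add: matrix_unit_def)
    define b where "b x = g (matrix_unit m x)" for x
    have lcA: "h (lin_comb A U b d) = lin_comb ?P U (matrix_unit m) d" for d
    proof -
      have "b \<in> U \<rightarrow> carrier A" by (simp add: b_def gD(3) muc)
      then show ?thesis
        using lin_comb_image[OF A P hD(1), of "\<lambda>r. r" b U d] hD(4) by (simp add: b_def hg muc)
    qed
    have lcc: "lin_comb A U b d \<in> carrier A" for d
      by (rule lin_comb_closed[OF A]) (simp add: b_def gD(3) muc)
    have hz: "h \<zero>\<^bsub>A\<^esub> = \<zero>\<^bsub>?P\<^esub>"
    proof -
      interpret A: ring A by (rule type_algebraD(1)[OF A])
      interpret P: ring ?P by (rule type_algebraD(1)[OF P])
      have "h \<zero>\<^bsub>A\<^esub> \<oplus>\<^bsub>?P\<^esub> h \<zero>\<^bsub>A\<^esub> = h \<zero>\<^bsub>A\<^esub>" using hD(5)[of "\<zero>\<^bsub>A\<^esub>" "\<zero>\<^bsub>A\<^esub>"] by simp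
      then show ?thesis using hD(3)[of "\<zero>\<^bsub>A\<^esub>"] by simp
    qed
    have I: "ideal (component m k) ?P" by (rule ideal_component)
    interpret I: ideal "component m k" ?P by (rule I)
    have "subspace_dim A (c k) = card U"
    proof (rule subspace_dim_eqI[OF A])
      show "c k \<subseteq> carrier A" by (auto simp: c_def)
      interpret A: ring A by (rule type_algebraD(1)[OF A])
      show "\<zero>\<^bsub>A\<^esub> \<in> c k" by (simp add: c_def hz)
      show "x \<oplus>\<^bsub>A\<^esub> y \<in> c k" if "x \<in> c k" "y \<in> c k" for x y
        using that by (simp add: c_def hD(5))
      show "r \<odot>\<^bsub>A\<^esub> x \<in> c k" if x: "x \<in> c k" for r x
      proof -
        have "h x \<in> component m k" using x by (simp add: c_def)
        then have "r \<odot>\<^bsub>?P\<^esub> h x \<in> component m k"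
          by (elim component_cases) (simp add: split_elem_smult component_iff)
        then show ?thesis using x type_algebraD(3)[OF A] by (simp add: c_def hD(4))
      qed
      show "b \<in> U \<rightarrow> c k"
      proof
        fix x assume "x \<in> U"
        then have "matrix_unit m x \<in> (component m k :: ((nat \<Rightarrow> 'k mat) \<times> (nat \<Rightarrow> 'k)) set)"
          using U_iff unfolding matrix_unit_def component_iff by (cases x) auto
        then show "b x \<in> c k" by (simp add: c_def b_def hg gD(3) muc)
      qed
      show "\<exists>d. x = lin_comb A U b d" if x: "x \<in> c k" for x
      proof -
        have "h x \<in> component m k" and xc: "x \<in> carrier A" using x by (simp_all add: c_def)
        then obtain f z where fz: "h x = split_elem m f z" "\<forall>i r s. Inl i \<noteq> k \<longrightarrow> f i r s = 0"
          "\<forall>j. Inr j \<noteq> k \<longrightarrow> z j = 0" by (elim component_cases)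
        define d where "d = case_sum (\<lambda>(i, r, s). f i r s) z"
        have "h (lin_comb A U b d) = h x"
          unfolding lcA lc fz(1) using fz(2,3)
          by (intro split_elem_cong) (auto simp: d_def U_iff)
        then have "x = lin_comb A U b d" using xc lcc gh by metis
        then show ?thesis by blast
      qed
      have "d x = 0" if "lin_comb A U b d = \<zero>\<^bsub>A\<^esub>" and x: "x \<in> U" for d x
      proof -
        have "lin_comb ?P U (matrix_unit m) d = \<zero>\<^bsub>?P\<^esub>" using that(1) lcA[of d] hz by simp
        then show ?thesis
          using x UI unfolding lc split_elem_zero split_elem_eq_iff
          by (cases x) (force simp: split_index_def)+
      qed
      then show "\<forall>d. lin_comb A U b d = \<zero>\<^bsub>A\<^esub> \<longrightarrow> (\<forall>x\<in>U. d x = 0)" by blast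
    qed (rule U)
    then show ?thesis by (simp add: cardU)
  qed
  show thesis by (rule that[OF 1 2])
qed

section \<open>Functions that are polynomials in given nodes\<close>

text \<open>Invertibility of the Vandermonde matrix, by counting roots: a polynomial of degree less
  than \<open>q\<close> that vanishes at \<open>q\<close> distinct nodes is zero.\<close>

lemma power_sum_eq_0:
  fixes c w :: "nat \<Rightarrow> 'f::field"
  assumes inj: "inj_on w {..<q}" and zero: "\<And>i. i < q \<Longrightarrow> (\<Sum>e<q. c e * w i ^ e) = 0" and e: "e < q"
  shows "c e = 0"
proof -
  define p where "p = (\<Sum>e<q. monom (c e) e)"
  have eval: "poly p x = (\<Sum>e<q. c e * x ^ e)" for x by (simp add: p_def poly_sum poly_monom)
  have "coeff p e = (\<Sum>j<q. if j = e then c j else 0)" for e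
    unfolding p_def coeff_sum by (rule sum.cong) auto
  then have coeff: "coeff p e = (if e < q then c e else 0)" for e by simp
  have "p = 0"
  proof (rule ccontr)
    assume p: "p \<noteq> 0"
    then have "degree p < q" using coeff[of "degree p"] by (metis leading_coeff_0_iff)
    moreover have "q \<le> card {x. poly p x = 0}"
    proof -
      have "card (w ` {..<q}) \<le> card {x. poly p x = 0}"
        using zero by (intro card_mono poly_roots_finite[OF p]) (auto simp: eval)
      then show ?thesis using inj by (simp add: card_image)
    qed
    ultimately show False using card_poly_roots_bound[OF p] by simp
  qed
  then show ?thesis using coeff[of e] e by simp
qed

text \<open>For nodes with \<open>w^q = a w\<close> these functions are the image of
  \<open>R[w]\<close> modulo \<open>w^q - a w\<close> under evaluation. Over \<open>k[[t]]\<close>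
  this is a proper subring of all functions on the nodes, because interpolation divides by
  differences of nodes.\<close>

definition power_fun :: "nat \<Rightarrow> (nat \<Rightarrow> 'r::comm_ring_1) \<Rightarrow> (nat \<Rightarrow> 'r) \<Rightarrow> bool" where
  "power_fun q w v \<longleftrightarrow> (\<exists>c. \<forall>i<q. v i = (\<Sum>e<q. c e * w i ^ e))"

lemma power_fun_add: "power_fun q w v \<Longrightarrow> power_fun q w v' \<Longrightarrow> power_fun q w (\<lambda>i. v i + v' i)"
  unfolding power_fun_def
  by (elim exE, rule_tac x = "\<lambda>e. c e + ca e" in exI) (simp add: sum.distrib distrib_right)

lemma power_fun_smult: "power_fun q w v \<Longrightarrow> power_fun q w (\<lambda>i. r * v i)"
  unfolding power_fun_def
  by (elim exE, rule_tac x = "\<lambda>e. r * c e" in exI) (simp add: sum_distrib_left mult.assoc)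

lemma power_fun_const:
  assumes "q \<ge> 1"
  shows "power_fun q w (\<lambda>_. r)"
  unfolding power_fun_def
proof (rule exI[of _ "\<lambda>e. if e = 0 then r else 0"], intro allI impI)
  fix i
  have "(\<Sum>e<q. (if e = 0 then r else 0) * w i ^ e) = (\<Sum>e<q. if e = 0 then r else 0)"
    by (rule sum.cong) auto
  then show "r = (\<Sum>e<q. (if e = 0 then r else 0) * w i ^ e)" using assms by simp
qed

lemma power_fun_mult_node:
  assumes q: "q \<ge> 2" and wq: "\<And>i. i < q \<Longrightarrow> w i ^ q = a * w i" and v: "power_fun q w v"
  shows "power_fun q w (\<lambda>i. w i * v i)"
proof -
  obtain c where c: "\<And>i. i < q \<Longrightarrow> v i = (\<Sum>e<q. c e * w i ^ e)" using v by (auto simp: power_fun_def)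
  obtain p where p: "q = Suc p" "p > 0" using q by (cases q) auto
  \<comment> \<open>Multiplication by \<open>w\<close> shifts the coefficients by one. The top
    coefficient would land at exponent \<open>q\<close> and returns at exponent 1, multiplied by
    \<open>a\<close>, since \<open>w^q = a w\<close>; as \<open>q\<close> is at least 2, exponent 1
    is within range.\<close>
  define c' where "c' e = (if e = 0 then 0 else c (e - 1)) + (if e = 1 then c p * a else 0)" for e
  have "w i * v i = (\<Sum>e<q. c' e * w i ^ e)" if i: "i < q" for i
  proof -
    have "w i * v i = (\<Sum>e<p. c e * w i ^ Suc e) + c p * w i ^ q"
      using i by (simp add: c p(1) distrib_left sum_distrib_left mult_ac)
    also have "\<dots> = (\<Sum>e<p. c e * w i ^ Suc e) + c p * a * w i" using wq[OF i] by (simp add: mult.assoc)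
    also have "c p * a * w i = (\<Sum>e<p. (if e = 0 then c p * a * w i ^ Suc e else 0))"
      using p(2) by simp
    also have "(\<Sum>e<p. c e * w i ^ Suc e) + \<dots> = (\<Sum>e<p. c' (Suc e) * w i ^ Suc e)"
      unfolding sum.distrib[symmetric] by (rule sum.cong) (auto simp: c'_def distrib_right)
    also have "\<dots> = (\<Sum>e<q. c' e * w i ^ e)"
      unfolding p(1) sum.lessThan_Suc_shift by (simp add: c'_def)
    finally show ?thesis .
  qed
  then show ?thesis unfolding power_fun_def by blast
qed

lemma power_fun_mult:
  assumes q: "q \<ge> 2" and wq: "\<And>i. i < q \<Longrightarrow> w i ^ q = a * w i"
    and v: "power_fun q w v" and v': "power_fun q w v'"
  shows "power_fun q w (\<lambda>i. v i * v' i)"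
proof -
  obtain c where c: "\<And>i. i < q \<Longrightarrow> v i = (\<Sum>e<q. c e * w i ^ e)" using v by (auto simp: power_fun_def)
  have pow: "power_fun q w (\<lambda>i. w i ^ e * v' i)" for e
  proof (induction e)
    case (Suc e)
    then show ?case using power_fun_mult_node[OF q wq] by (simp add: mult.assoc)
  qed (use v' in simp)
  have "power_fun q w (\<lambda>i. \<Sum>e<n. c e * (w i ^ e * v' i))" for n
  proof (induction n)
    case 0
    then show ?case using power_fun_const[of q w 0] q by simp
  next
    case (Suc n)
    then show ?case using power_fun_add[OF Suc power_fun_smult[OF pow[of n], of "c n"]] by simp
  qed
  from this[of q] obtain d where d: "\<And>i. i < q \<Longrightarrow> (\<Sum>e<q. c e * (w i ^ e * v' i)) = (\<Sum>e<q. d e * w i ^ e)"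
    by (auto simp: power_fun_def)
  have "v i * v' i = (\<Sum>e<q. d e * w i ^ e)" if "i < q" for i
    using d[OF that] c[OF that] by (simp add: sum_distrib_right mult.assoc)
  then show ?thesis unfolding power_fun_def by blast
qed

lemma power_fun_node:
  assumes q: "q \<ge> 2" and wq: "\<And>i. i < q \<Longrightarrow> w i ^ q = a * w i"
  shows "power_fun q w w"
  using power_fun_mult_node[OF q wq power_fun_const[of q w 1]] q by simp

section \<open>Pencils in the split algebra\<close>

text \<open>
  \<open>pencil m w d V\<close> is the element \<open>V\<^sub>0 + V\<^sub>1 u + V\<^sub>2 v + V\<^sub>3 u v\<close>, where \<open>u\<close> and \<open>v\<close> are the matrices
  \<open>(0, 1; w\<^sub>i, w\<^sub>i)\<close> and \<open>(0, 1; 0, 0)\<close> in the \<open>i\<close>-th block, and run through the four points of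
  \<open>{0, d} \<times> {0, d}\<close> in the four one-dimensional components, which together form the fibre over the
  node \<open>w\<^sub>0 = 0\<close>.
\<close>

definition pencil ::
    "nat \<Rightarrow> (nat \<Rightarrow> 'r::comm_ring_1) \<Rightarrow> 'r \<Rightarrow> (nat \<Rightarrow> nat \<Rightarrow> 'r) \<Rightarrow> (nat \<Rightarrow> 'r mat) \<times> (nat \<Rightarrow> 'r)" where
  "pencil m w d V = split_elem m
     (\<lambda>i r s. if r = 0 then (if s = 0 then V 0 i else V 1 i + V 2 i)
        else (if s = 0 then w i * V 1 i else V 0 i + w i * (V 1 i + V 3 i)))
     (\<lambda>j. V 0 0 + (if j = 2 \<or> j = 4 then d * V 1 0 else 0) + (if j = 3 \<or> j = 4 then d * V 2 0 else 0)
        + (if j = 4 then d * (d * V 3 0) else 0))"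

text \<open>
  The product for the relations \<open>u\<^sup>2 = (w + g) u + w\<close>, \<open>v\<^sup>2 = g v\<close>, \<open>v u = u v + w v + w\<close>, \<open>w g = 0\<close>
  in characteristic two.
\<close>

definition pencil_prod ::
    "(nat \<Rightarrow> 'r::comm_ring_1) \<Rightarrow> (nat \<Rightarrow> 'r) \<Rightarrow> (nat \<Rightarrow> nat \<Rightarrow> 'r) \<Rightarrow> (nat \<Rightarrow> nat \<Rightarrow> 'r) \<Rightarrow> nat \<Rightarrow> nat \<Rightarrow> 'r" where
  "pencil_prod w g V V' k i =
    (if k = 0 then V 0 i * V' 0 i + w i * (V 1 i * V' 1 i) + w i * (V 2 i * V' 1 i)
     else if k = 1 then V 0 i * V' 1 i + V 1 i * V' 0 i + w i * (V 1 i * V' 1 i) + g i * (V 1 i * V' 1 i)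
       + w i * (V 3 i * V' 1 i)
     else if k = 2 then V 0 i * V' 2 i + V 2 i * V' 0 i + w i * (V 1 i * V' 3 i) + w i * (V 2 i * V' 1 i)
       + g i * (V 2 i * V' 2 i) + w i * (V 2 i * V' 3 i) + w i * (V 3 i * V' 1 i)
     else V 0 i * V' 3 i + V 3 i * V' 0 i + V 1 i * V' 2 i + w i * (V 1 i * V' 3 i) + g i * (V 1 i * V' 3 i)
       + V 2 i * V' 1 i + g i * (V 2 i * V' 3 i) + g i * (V 3 i * V' 1 i) + g i * (V 3 i * V' 2 i)
       + g i * (g i * (V 3 i * V' 3 i)) + w i * (V 3 i * V' 3 i))"

lemma pencil_cong:
  assumes "\<And>k i. k < 4 \<Longrightarrow> i \<le> m \<Longrightarrow> V k i = V' k i"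
  shows "pencil m w d V = pencil m w d V'"
  unfolding pencil_def using assms by (intro split_elem_cong) auto

lemma pencil_add: "pencil m w d V \<oplus>\<^bsub>split_algebra m\<^esub> pencil m w d V' = pencil m w d (\<lambda>k i. V k i + V' k i)"
  unfolding pencil_def split_elem_add by (intro split_elem_cong) (auto simp: algebra_simps)

lemma pencil_smult: "r \<odot>\<^bsub>split_algebra m\<^esub> pencil m w d V = pencil m w d (\<lambda>k i. r * V k i)"
  unfolding pencil_def split_elem_smult by (intro split_elem_cong) (auto simp: algebra_simps)

lemma pencil_one: "\<one>\<^bsub>split_algebra m\<^esub> = pencil m w d (\<lambda>k i. if k = 0 then 1 else 0)"
  unfolding pencil_def split_elem_one by (intro split_elem_cong) (auto dest!: less_2_cases)

text \<open>At a nonzero node the matrices satisfy the relations with \<open>g = 0\<close>; over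
  \<open>w = 0\<close> the relations say that \<open>u\<close> and \<open>v\<close> commute with
  \<open>u^2 = d u\<close> and \<open>v^2 = d v\<close>, so evaluation at the four points is
  multiplicative. The blocks use characteristic two, through the cancellation rules
  \<open>dbl\<close> and \<open>dbl'\<close>.\<close>

lemma pencil_mult:
  fixes w g :: "nat \<Rightarrow> 'r::comm_ring_1"
  assumes char2: "(1 + 1 :: 'r) = 0" and g: "\<And>i. i \<in> {1..m} \<Longrightarrow> g i = 0" "g 0 = d" and w: "w 0 = 0"
  shows "pencil m w d V \<otimes>\<^bsub>split_algebra m\<^esub> pencil m w d V' = pencil m w d (pencil_prod w g V V')"
proof -
  have dbl: "x + x = 0" for x :: 'r using char2 by (metis distrib_left mult.right_neutral mult_zero_right)
  then have dbl': "x + (x + y) = y" for x y :: 'r by (metis add.assoc add_0)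
  show ?thesis unfolding pencil_def split_elem_mult
  proof (intro split_elem_cong)
    fix i r s :: nat assume "i \<in> {1..m}" "r < 2" "s < 2"
    \<comment> \<open>The conditions \<open>0 = 0\<close> and \<open>1 = 0\<close> come from the
      middle index of the matrix product, which has been set to 0 and 1.\<close>
    then show "(if r = 0 then if 0 = (0 :: nat) then V 0 i else V 1 i + V 2 i
           else if 0 = (0 :: nat) then w i * V 1 i else V 0 i + w i * (V 1 i + V 3 i)) *
          (if 0 = (0 :: nat) then if s = 0 then V' 0 i else V' 1 i + V' 2 i
           else if s = 0 then w i * V' 1 i else V' 0 i + w i * (V' 1 i + V' 3 i)) +
          (if r = 0 then if 1 = (0 :: nat) then V 0 i else V 1 i + V 2 i
           else if 1 = (0 :: nat) then w i * V 1 i else V 0 i + w i * (V 1 i + V 3 i)) *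
          (if 1 = (0 :: nat) then if s = 0 then V' 0 i else V' 1 i + V' 2 i
           else if s = 0 then w i * V' 1 i else V' 0 i + w i * (V' 1 i + V' 3 i)) =
          (if r = 0 then if s = 0 then pencil_prod w g V V' 0 i
               else pencil_prod w g V V' 1 i + pencil_prod w g V V' 2 i
           else if s = 0 then w i * pencil_prod w g V V' 1 i
             else pencil_prod w g V V' 0 i + w i * (pencil_prod w g V V' 1 i + pencil_prod w g V V' 3 i))"
      using g(1)[of i]
      by (auto dest!: less_2_cases simp: pencil_prod_def algebra_simps dbl dbl')
  next
    fix j :: nat assume "j \<in> {1..4}"
    then consider "j = 1" | "j = 2" | "j = 3" | "j = 4" by fastforce
    then show "(V 0 0 + (if j = 2 \<or> j = 4 then d * V 1 0 else 0) + (if j = 3 \<or> j = 4 then d * V 2 0 else 0) +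
           (if j = 4 then d * (d * V 3 0) else 0)) *
         (V' 0 0 + (if j = 2 \<or> j = 4 then d * V' 1 0 else 0) + (if j = 3 \<or> j = 4 then d * V' 2 0 else 0) +
           (if j = 4 then d * (d * V' 3 0) else 0)) =
         pencil_prod w g V V' 0 0 + (if j = 2 \<or> j = 4 then d * pencil_prod w g V V' 1 0 else 0) +
         (if j = 3 \<or> j = 4 then d * pencil_prod w g V V' 2 0 else 0) +
         (if j = 4 then d * (d * pencil_prod w g V V' 3 0) else 0)"
      by cases (simp_all add: pencil_prod_def g(2) w algebra_simps)
  qed
qed

definition pencil_coeffs :: "nat \<Rightarrow> (nat \<Rightarrow> 'r::comm_ring_1) \<Rightarrow> (nat \<times> nat \<Rightarrow> 'r) \<Rightarrow> nat \<Rightarrow> nat \<Rightarrow> 'r" where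
  "pencil_coeffs q w c k i = (\<Sum>e<q. c (e, k) * w i ^ e)"

text \<open>The index \<open>(e, k)\<close> stands for \<open>w^e\<close> times the
  \<open>k\<close>-th of the elements \<open>1\<close>, \<open>u\<close>, \<open>v\<close>,
  \<open>u v\<close>.\<close>

definition pencil_basis :: "nat \<Rightarrow> (nat \<Rightarrow> 'r::comm_ring_1) \<Rightarrow> 'r \<Rightarrow> nat \<times> nat \<Rightarrow> (nat \<Rightarrow> 'r mat) \<times> (nat \<Rightarrow> 'r)" where
  "pencil_basis m w d x = pencil m w d (\<lambda>k i. if k = snd x then w i ^ fst x else 0)"

lemma lin_comb_pencil:
  fixes c :: "'i \<Rightarrow> 'r::comm_ring_1"
  assumes "finite I"
  shows "lin_comb (split_algebra m) I (\<lambda>x. pencil m w d (V x)) c = pencil m w d (\<lambda>k i. \<Sum>x\<in>I. c x * V x k i)"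
proof -
  interpret P: assoc_algebra "ring_of_type_algebra :: 'r ring" "split_algebra m"
    by (rule type_algebra_split_algebra)
  have closed: "pencil m w d V' \<in> carrier (split_algebra m)" for V' by (simp add: pencil_def)
  have zero: "\<zero>\<^bsub>split_algebra m\<^esub> = pencil m w d (\<lambda>_ _. 0)"
    by (auto simp: pencil_def split_elem_zero intro!: split_elem_cong)
  show ?thesis using assms
    by (induction I rule: finite_induct)
       (simp_all add: lin_comb_def pencil_smult pencil_add closed zero)
qed

lemma lin_comb_pencil_basis:
  "lin_comb (split_algebra m) ({..<q} \<times> {..<4}) (pencil_basis m w d) c = pencil m w d (pencil_coeffs q w c)"
proof -
  have "lin_comb (split_algebra m) ({..<q} \<times> {..<4}) (pencil_basis m w d) c =
    pencil m w d (\<lambda>k i. \<Sum>x\<in>{..<q} \<times> {..<4}. c x * (if k = snd x then w i ^ fst x else 0))"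
    unfolding pencil_basis_def by (rule lin_comb_pencil) simp
  also have "\<dots> = pencil m w d (pencil_coeffs q w c)"
  proof (rule pencil_cong)
    fix k i :: nat assume k: "k < 4"
    have "(\<Sum>x\<in>{..<q} \<times> {..<4}. c x * (if k = snd x then w i ^ fst x else 0)) =
        (\<Sum>e<q. \<Sum>l<4. if k = l then c (e, l) * w i ^ e else 0)"
      by (subst sum.cartesian_product) (auto intro!: sum.cong)
    then show "(\<Sum>x\<in>{..<q} \<times> {..<4}. c x * (if k = snd x then w i ^ fst x else 0)) = pencil_coeffs q w c k i"
      using k by (simp add: pencil_coeffs_def)
  qed
  finally show ?thesis .
qed

text \<open>A vanishing pencil has \<open>V 0 = ... = V 3 = 0\<close> at each node: at a nonzero
  node one divides by \<open>w i\<close>, at node 0 the four points give a triangular system solved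
  by dividing by \<open>d\<close>. The power sums are then zero at \<open>q\<close> distinct nodes,
  so all coefficients vanish; the number of elements \<open>4 q = 4 m + 4\<close> is the
  dimension.\<close>

lemma basis_family_pencil:
  fixes w :: "nat \<Rightarrow> 'f::field"
  assumes q: "q = m + 1" and inj: "inj_on w {..<q}" and w: "w 0 = 0" and d: "d \<noteq> 0"
  shows "basis_family (split_algebra m) ({..<q} \<times> {..<4}) (pencil_basis m w d)"
proof (rule basis_family_of_independent[OF type_algebra_split_algebra basis_family_split_algebra])
  show "card ({..<q} \<times> {..<4 :: nat}) = card (split_index m)"
    by (simp add: card_split_index card_cartesian_product q)
  show "pencil_basis m w d \<in> {..<q} \<times> {..<4} \<rightarrow> carrier (split_algebra m)"
    by (simp add: pencil_basis_def pencil_def)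
  have "c (e, k) = 0"
    if zero: "lin_comb (split_algebra m) ({..<q} \<times> {..<4}) (pencil_basis m w d) c = \<zero>\<^bsub>split_algebra m\<^esub>"
      and ek: "e < q" "k < 4" for c e k
  proof -
    let ?V = "pencil_coeffs q w c"
    have 0: "split_elem m (\<lambda>i r s. if r = 0 then (if s = 0 then ?V 0 i else ?V 1 i + ?V 2 i)
        else (if s = 0 then w i * ?V 1 i else ?V 0 i + w i * (?V 1 i + ?V 3 i)))
     (\<lambda>j. ?V 0 0 + (if j = 2 \<or> j = 4 then d * ?V 1 0 else 0) + (if j = 3 \<or> j = 4 then d * ?V 2 0 else 0)
        + (if j = 4 then d * (d * ?V 3 0) else 0)) = split_elem m (\<lambda>i r s. 0) (\<lambda>j. 0)"
      using zero unfolding lin_comb_pencil_basis pencil_def split_elem_zero .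
    have V: "?V 0 i = 0 \<and> ?V 1 i = 0 \<and> ?V 2 i = 0 \<and> ?V 3 i = 0" if i: "i < q" for i
    proof (cases "i = 0")
      case True
      have "\<forall>j\<in>{1..4 :: nat}. ?V 0 0 + (if j = 2 \<or> j = 4 then d * ?V 1 0 else 0)
        + (if j = 3 \<or> j = 4 then d * ?V 2 0 else 0) + (if j = 4 then d * (d * ?V 3 0) else 0) = 0"
        using 0 unfolding split_elem_eq_iff by blast
      from this[THEN bspec, of 1] this[THEN bspec, of 2] this[THEN bspec, of 3] this[THEN bspec, of 4]
      show ?thesis using d True by auto
    next
      case False
      then have im: "i \<in> {1..m}" using i q by auto
      have "w i \<noteq> 0" using inj_onD[OF inj, of i 0] i False w by auto
      moreover have "\<And>r s :: nat. (r :: nat) < 2 \<Longrightarrow> s < 2 \<Longrightarrow>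
        (if r = 0 then (if s = 0 then ?V 0 i else ?V 1 i + ?V 2 i)
         else (if s = 0 then w i * ?V 1 i else ?V 0 i + w i * (?V 1 i + ?V 3 i))) = 0"
        using 0 im unfolding split_elem_eq_iff by blast
      from this[of 0 0] this[of 0 1] this[of 1 0] this[of 1 1]
      have "?V 0 i = 0" "?V 1 i + ?V 2 i = 0" "w i * ?V 1 i = 0" "?V 0 i + w i * (?V 1 i + ?V 3 i) = 0"
        by simp_all
      ultimately show ?thesis by simp
    qed
    have "k = 0 \<or> k = 1 \<or> k = 2 \<or> k = 3" using ek(2) by auto
    then have "?V k i = 0" if "i < q" for i using V[OF that] by auto
    then show ?thesis
      using power_sum_eq_0[OF inj, of "\<lambda>e. c (e, k)" e] ek(1) by (simp add: pencil_coeffs_def)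
  qed
  note indep = this
  show "\<forall>c. lin_comb (split_algebra m) ({..<q} \<times> {..<4}) (pencil_basis m w d) c = \<zero>\<^bsub>split_algebra m\<^esub> \<longrightarrow>
      (\<forall>x\<in>{..<q} \<times> {..<4}. c x = 0)"
  proof (intro allI impI ballI)
    fix c x
    assume c: "lin_comb (split_algebra m) ({..<q} \<times> {..<4}) (pencil_basis m w d) c = \<zero>\<^bsub>split_algebra m\<^esub>"
      and x: "x \<in> {..<q} \<times> {..<4 :: nat}"
    obtain e k where "x = (e, k)" by (cases x)
    then show "c x = 0" using indep[OF c, of e k] x by simp
  qed
qed simp

section \<open>Transport of a multiplication and reduction modulo \<open>t\<close>\<close>

text \<open>The multiplication is pulled back along an injective linear map whose image is closed
  under products, and injectivity turns each axiom into an identity in \<open>P\<close>. Only the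
  fields for product and unit of the record change, as the notion of deformation prescribes.\<close>

lemma ex_transported_algebra:
  assumes M: "type_algebra M" and P: "type_algebra P"
    and \<psi>: "\<psi> \<in> hom (add_monoid M) (add_monoid P)"
    and smult: "\<And>r x. x \<in> carrier M \<Longrightarrow> \<psi> (r \<odot>\<^bsub>M\<^esub> x) = r \<odot>\<^bsub>P\<^esub> \<psi> x"
    and inj: "inj_on \<psi> (carrier M)"
    and one: "\<one>\<^bsub>P\<^esub> \<in> \<psi> ` carrier M"
    and mult: "\<And>x y. x \<in> carrier M \<Longrightarrow> y \<in> carrier M \<Longrightarrow> \<psi> x \<otimes>\<^bsub>P\<^esub> \<psi> y \<in> \<psi> ` carrier M"
  obtains m e where "type_algebra (M\<lparr>monoid.mult := m, one := e\<rparr>)"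
    and "\<psi> \<in> algebra_hom (M\<lparr>monoid.mult := m, one := e\<rparr>) P"
proof -
  define m where "m x y = inv_into (carrier M) \<psi> (\<psi> x \<otimes>\<^bsub>P\<^esub> \<psi> y)" for x y
  define e where "e = inv_into (carrier M) \<psi> \<one>\<^bsub>P\<^esub>"
  let ?L = "M\<lparr>monoid.mult := m, one := e\<rparr>"
  interpret M: ring M by (rule type_algebraD(1)[OF M])
  interpret P: ring P by (rule type_algebraD(1)[OF P])
  have \<psi>m: "\<psi> (m x y) = \<psi> x \<otimes>\<^bsub>P\<^esub> \<psi> y" and mc: "m x y \<in> carrier M"
    if "x \<in> carrier M" "y \<in> carrier M" for x y
    using mult[OF that] by (simp_all add: m_def f_inv_into_f inv_into_into)
  have \<psi>e: "\<psi> e = \<one>\<^bsub>P\<^esub>" and ec: "e \<in> carrier M"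
    using one by (simp_all add: e_def f_inv_into_f inv_into_into)
  have \<psi>c: "\<psi> x \<in> carrier P" and \<psi>a: "\<psi> (x \<oplus>\<^bsub>M\<^esub> y) = \<psi> x \<oplus>\<^bsub>P\<^esub> \<psi> y"
    if "x \<in> carrier M" "y \<in> carrier M" for x y
    using \<psi> that by (auto simp: hom_def)
  have eqI: "x = y" if "\<psi> x = \<psi> y" "x \<in> carrier M" "y \<in> carrier M" for x y
    using inj_onD[OF inj that(1,2,3)] .
  note MD = type_algebraD[OF M] and PD = type_algebraD[OF P]
  have "ring ?L"
  proof (intro ringI monoidI abelian_groupI)
    show "\<exists>y\<in>carrier ?L. y \<oplus>\<^bsub>?L\<^esub> x = \<zero>\<^bsub>?L\<^esub>" if "x \<in> carrier ?L" for x
      using that M.l_neg by auto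
  qed (auto simp: mc ec \<psi>m \<psi>e \<psi>a \<psi>c M.a_ac P.m_assoc P.l_distr P.r_distr intro!: eqI)
  then have "type_algebra ?L"
    by (rule type_algebraI)
       (auto simp: mc MD(3-7) PD(11,12) \<psi>m smult \<psi>c intro!: eqI)
  moreover have "\<psi> \<in> algebra_hom ?L P"
    by (rule algebra_homI) (simp_all add: \<psi>c \<psi>a \<psi>m \<psi>e smult)
  ultimately show thesis by (rule that)
qed

lemma quotient_algebra_simps [simp]:
  "carrier (quotient_algebra A I) = carrier (A Quot I)" "x \<otimes>\<^bsub>quotient_algebra A I\<^esub> y = x \<otimes>\<^bsub>A Quot I\<^esub> y"
  "\<one>\<^bsub>quotient_algebra A I\<^esub> = \<one>\<^bsub>A Quot I\<^esub>" "\<zero>\<^bsub>quotient_algebra A I\<^esub> = \<zero>\<^bsub>A Quot I\<^esub>"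
  "x \<oplus>\<^bsub>quotient_algebra A I\<^esub> y = x \<oplus>\<^bsub>A Quot I\<^esub> y"
  by (simp_all add: quotient_algebra_def)

text \<open>The union over representatives is a single coset, because an ideal is stable under
  scalars: \<open>r i = (r 1) i\<close>.\<close>

lemma quotient_algebra_smult:
  assumes A: "type_algebra A" and I: "ideal I A" and x: "x \<in> carrier A"
  shows "r \<odot>\<^bsub>quotient_algebra A I\<^esub> (I +>\<^bsub>A\<^esub> x) = I +>\<^bsub>A\<^esub> (r \<odot>\<^bsub>A\<^esub> x)"
proof -
  interpret I: ideal I A by (rule I)
  note AD = type_algebraD[OF A]
  have "I +>\<^bsub>A\<^esub> (r \<odot>\<^bsub>A\<^esub> y) = I +>\<^bsub>A\<^esub> (r \<odot>\<^bsub>A\<^esub> x)" if y: "y \<in> I +>\<^bsub>A\<^esub> x" for y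
  proof -
    obtain i where i: "i \<in> I" "y = i \<oplus>\<^bsub>A\<^esub> x" using y by (auto simp: a_r_coset_def')
    have ic: "i \<in> carrier A" using i(1) by (rule I.Icarr)
    have "r \<odot>\<^bsub>A\<^esub> i = (r \<odot>\<^bsub>A\<^esub> \<one>\<^bsub>A\<^esub>) \<otimes>\<^bsub>A\<^esub> i" using ic by (simp add: AD(11))
    also have "\<dots> \<in> I" using i(1) by (intro I.I_l_closed AD(3)) auto
    finally have ri: "r \<odot>\<^bsub>A\<^esub> i \<in> I" .
    have "r \<odot>\<^bsub>A\<^esub> y = r \<odot>\<^bsub>A\<^esub> i \<oplus>\<^bsub>A\<^esub> r \<odot>\<^bsub>A\<^esub> x" using i ic x by (simp add: AD(5))
    then have "r \<odot>\<^bsub>A\<^esub> y \<in> I +>\<^bsub>A\<^esub> (r \<odot>\<^bsub>A\<^esub> x)" using ri by (auto simp: a_r_coset_def')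
    then show ?thesis using AD(3)[OF x] I.a_repr_independence' by metis
  qed
  moreover have "x \<in> I +>\<^bsub>A\<^esub> x" by (rule I.a_rcos_self[OF x])
  ultimately have "(\<Union>y\<in>I +>\<^bsub>A\<^esub> x. I +>\<^bsub>A\<^esub> (r \<odot>\<^bsub>A\<^esub> y)) = I +>\<^bsub>A\<^esub> (r \<odot>\<^bsub>A\<^esub> x)" by blast
  then show ?thesis by (simp only: quotient_algebra_def with_smult_simps)
qed

lemma type_algebra_quotient:
  assumes A: "type_algebra A" and I: "ideal I A"
  shows "type_algebra (quotient_algebra A I)" "(+>\<^bsub>A\<^esub>) I \<in> algebra_hom A (quotient_algebra A I)"
proof -
  interpret I: ideal I A by (rule I)
  interpret Q: ring "A Quot I" by (rule I.quotient_is_ring)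
  interpret c: ring_hom_ring A "A Quot I" "(+>\<^bsub>A\<^esub>) I" by (rule I.rcos_ring_hom_ring)
  note AD = type_algebraD[OF A]
  note sm = quotient_algebra_smult[OF A I]
  have cases: thesis
    if "z \<in> carrier (A Quot I)" and "\<And>x. x \<in> carrier A \<Longrightarrow> z = I +>\<^bsub>A\<^esub> x \<Longrightarrow> thesis" for z thesis
    using that(1) unfolding carrier_FactRing by (elim imageE) (rule that(2))
  show "type_algebra (quotient_algebra A I)"
  proof (rule type_algebraI)
    show "ring (quotient_algebra A I)" unfolding quotient_algebra_def by (rule ring_with_smult) (rule Q.ring_axioms)
  qed (unfold quotient_algebra_simps; elim cases; simp add: sm AD(3-7,11,12) c.hom_add[symmetric]
      c.hom_mult[symmetric] del: c.hom_add c.hom_mult)+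
  show "(+>\<^bsub>A\<^esub>) I \<in> algebra_hom A (quotient_algebra A I)"
    by (rule algebra_homI) (simp_all add: sm)
qed

lemma restrict_scalars_simps [simp]:
  "carrier (restrict_scalars \<phi> A) = carrier A" "x \<otimes>\<^bsub>restrict_scalars \<phi> A\<^esub> y = x \<otimes>\<^bsub>A\<^esub> y"
  "\<one>\<^bsub>restrict_scalars \<phi> A\<^esub> = \<one>\<^bsub>A\<^esub>" "\<zero>\<^bsub>restrict_scalars \<phi> A\<^esub> = \<zero>\<^bsub>A\<^esub>"
  "x \<oplus>\<^bsub>restrict_scalars \<phi> A\<^esub> y = x \<oplus>\<^bsub>A\<^esub> y" "r \<odot>\<^bsub>restrict_scalars \<phi> A\<^esub> x = \<phi> r \<odot>\<^bsub>A\<^esub> x"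
  by (simp_all add: restrict_scalars_def)

lemma type_algebra_restrict_scalars:
  assumes "comm_ring_hom \<phi>" and A: "type_algebra A"
  shows "type_algebra (restrict_scalars \<phi> A)"
proof -
  interpret comm_ring_hom \<phi> by fact
  show ?thesis
    by (rule type_algebraI)
       (auto simp: hom_distribs type_algebraD(3-7,11,12)[OF A] restrict_scalars_def
         intro!: ring_with_smult type_algebraD(1)[OF A])
qed

text \<open>Scalars are central, so the multiples of \<open>t\<close> form an ideal already and
  generate nothing more.\<close>

lemma Idl_fps_X:
  fixes A :: "('k::field fps, 'a) module"
  assumes A: "type_algebra A"
  shows "Idl\<^bsub>A\<^esub> {fps_X \<odot>\<^bsub>A\<^esub> x | x. x \<in> carrier A} = {fps_X \<odot>\<^bsub>A\<^esub> x | x. x \<in> carrier A}" (is "_ = ?I")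
    and "ideal {fps_X \<odot>\<^bsub>A\<^esub> x | x. x \<in> carrier A} A"
proof -
  interpret A: ring A by (rule type_algebraD(1)[OF A])
  note AD = type_algebraD[OF A]
  show I: "ideal ?I A"
  proof (rule idealI[OF A.ring_axioms])
    show "subgroup ?I (add_monoid A)"
    proof (rule A.add.subgroupI)
      show "?I \<subseteq> carrier A" using AD(3) by blast
      show "?I \<noteq> {}" by blast
    next
      fix a assume "a \<in> ?I"
      then obtain x where "x \<in> carrier A" "a = fps_X \<odot>\<^bsub>A\<^esub> x" by blast
      moreover from this have "\<ominus>\<^bsub>A\<^esub> a = fps_X \<odot>\<^bsub>A\<^esub> (\<ominus>\<^bsub>A\<^esub> x)"
        using AD(5)[of "\<ominus>\<^bsub>A\<^esub> x" x fps_X]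
        by (intro A.minus_equality) (simp_all add: AD(3) A.l_neg AD(9))
      ultimately show "\<ominus>\<^bsub>A\<^esub> a \<in> ?I" by blast
    next
      fix a b assume "a \<in> ?I" "b \<in> ?I"
      then obtain x y where "x \<in> carrier A" "a = fps_X \<odot>\<^bsub>A\<^esub> x" "y \<in> carrier A" "b = fps_X \<odot>\<^bsub>A\<^esub> y" by blast
      then have "a \<oplus>\<^bsub>A\<^esub> b = fps_X \<odot>\<^bsub>A\<^esub> (x \<oplus>\<^bsub>A\<^esub> y)" "x \<oplus>\<^bsub>A\<^esub> y \<in> carrier A" by (simp_all add: AD(5))
      then show "a \<oplus>\<^bsub>A\<^esub> b \<in> ?I" by blast
    qed
  next
    fix a x assume "a \<in> ?I" and x: "x \<in> carrier A"
    then obtain y where "y \<in> carrier A" "a = fps_X \<odot>\<^bsub>A\<^esub> y" by blast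
    then have "x \<otimes>\<^bsub>A\<^esub> a = fps_X \<odot>\<^bsub>A\<^esub> (x \<otimes>\<^bsub>A\<^esub> y)" "a \<otimes>\<^bsub>A\<^esub> x = fps_X \<odot>\<^bsub>A\<^esub> (y \<otimes>\<^bsub>A\<^esub> x)"
      "x \<otimes>\<^bsub>A\<^esub> y \<in> carrier A" "y \<otimes>\<^bsub>A\<^esub> x \<in> carrier A"
      using x by (simp_all add: AD(11,12))
    then show "x \<otimes>\<^bsub>A\<^esub> a \<in> ?I" "a \<otimes>\<^bsub>A\<^esub> x \<in> ?I" by blast+
  qed
  have "?I \<subseteq> carrier A" using AD(3) by blast
  then show "Idl\<^bsub>A\<^esub> ?I = ?I"
    by (intro equalityI A.genideal_minimal[OF I] A.genideal_self) auto
qed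

text \<open>Spanning: a power series differs from its constant term by a multiple of
  \<open>t\<close>. Independence: a relation modulo \<open>t\<close> lifts to
  \<open>c j = t * d j\<close> with \<open>c j\<close> constant, which forces
  \<open>c j = 0\<close>.\<close>

lemma basis_family_mod_fps_X:
  fixes A :: "('k::field fps, 'a) module"
  assumes A: "type_algebra A" and basis: "basis_family A J b"
    and I: "I = {fps_X \<odot>\<^bsub>A\<^esub> x | x. x \<in> carrier A}"
  shows "basis_family (restrict_scalars fps_const (quotient_algebra A I)) J (\<lambda>j. I +>\<^bsub>A\<^esub> b j)"
proof -
  let ?Q = "restrict_scalars fps_const (quotient_algebra A I)"
  note AD = type_algebraD[OF A]
  note bD = basis_familyD[OF basis]
  have idl: "ideal I A" unfolding I by (rule Idl_fps_X(2)[OF A])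
  interpret I: ideal I A by (rule idl)
  note hom = type_algebra_quotient(2)[OF A idl]
  have QA: "type_algebra ?Q"
    by (intro type_algebra_restrict_scalars type_algebra_quotient A idl) (unfold_locales, auto)
  have lc: "I +>\<^bsub>A\<^esub> lin_comb A J b (\<lambda>j. fps_const (c j)) = lin_comb ?Q J (\<lambda>j. I +>\<^bsub>A\<^esub> b j) c" for c
  proof -
    have "I +>\<^bsub>A\<^esub> lin_comb A J b (\<lambda>j. fps_const (c j)) =
        lin_comb (quotient_algebra A I) J (\<lambda>j. I +>\<^bsub>A\<^esub> b j) (\<lambda>j. fps_const (c j))"
      using lin_comb_image[OF A type_algebra_quotient(1)[OF A idl] algebra_homD(1)[OF hom], of "\<lambda>r. r"]
        algebra_homD(4)[OF hom] bD(2) by simp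
    also have "\<dots> = lin_comb ?Q J (\<lambda>j. I +>\<^bsub>A\<^esub> b j) c"
      by (simp add: lin_comb_def restrict_scalars_def with_smult_def finsum_def finprod_def)
    finally show ?thesis .
  qed
  have mem_I: "a \<ominus>\<^bsub>A\<^esub> b \<in> I \<longleftrightarrow> I +>\<^bsub>A\<^esub> a = I +>\<^bsub>A\<^esub> b" if "a \<in> carrier A" "b \<in> carrier A" for a b
    by (rule I.quotient_eq_iff_same_a_r_cos[OF idl that])
  have "\<exists>c. z = lin_comb ?Q J (\<lambda>j. I +>\<^bsub>A\<^esub> b j) c" if "z \<in> carrier ?Q" for z
  proof -
    have "z \<in> (+>\<^bsub>A\<^esub>) I ` carrier A"
      using that unfolding restrict_scalars_simps quotient_algebra_simps carrier_FactRing .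
    then obtain x where x: "x \<in> carrier A" "z = I +>\<^bsub>A\<^esub> x" by (elim imageE)
    obtain c where c: "x = lin_comb A J b c" using bD(4)[OF x(1)] by blast
    have "x \<ominus>\<^bsub>A\<^esub> lin_comb A J b (\<lambda>j. fps_const (c j $ 0)) = lin_comb A J b (\<lambda>j. c j - fps_const (c j $ 0))"
      unfolding c by (rule lin_comb_diff[OF A bD(2), symmetric])
    also have "(\<lambda>j. c j - fps_const (c j $ 0)) = (\<lambda>j. fps_X * fps_shift 1 (c j))"
      by (rule ext, rule fps_ext) simp
    also have "lin_comb A J b \<dots> = fps_X \<odot>\<^bsub>A\<^esub> lin_comb A J b (\<lambda>j. fps_shift 1 (c j))"
      by (rule lin_comb_smult[OF A bD(2)])
    also have "\<dots> \<in> I"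
      unfolding I using lin_comb_closed[OF A bD(2), of "\<lambda>j. fps_shift 1 (c j)"] by blast
    finally have "I +>\<^bsub>A\<^esub> x = I +>\<^bsub>A\<^esub> lin_comb A J b (\<lambda>j. fps_const (c j $ 0))"
      by (rule mem_I[OF x(1) lin_comb_closed[OF A bD(2)], THEN iffD1])
    then show ?thesis unfolding x(2) lc by (rule exI[of _ "\<lambda>j. c j $ 0"])
  qed
  moreover have "c j = 0" if c: "lin_comb ?Q J (\<lambda>j. I +>\<^bsub>A\<^esub> b j) c = \<zero>\<^bsub>?Q\<^esub>" and j: "j \<in> J" for c j
  proof -
    have "I +>\<^bsub>A\<^esub> lin_comb A J b (\<lambda>j. fps_const (c j)) = I"
      using c unfolding lc[symmetric] by (simp add: FactRing_def)
    then have "lin_comb A J b (\<lambda>j. fps_const (c j)) \<in> I"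
      by (rule I.rcos_const_imp_mem[OF lin_comb_closed[OF A bD(2)]])
    then obtain x where x: "x \<in> carrier A" "lin_comb A J b (\<lambda>j. fps_const (c j)) = fps_X \<odot>\<^bsub>A\<^esub> x"
      unfolding I by blast
    obtain d where d: "x = lin_comb A J b d" using bD(4)[OF x(1)] by blast
    have "lin_comb A J b (\<lambda>j. fps_const (c j)) = lin_comb A J b (\<lambda>j. fps_X * d j)"
      unfolding x(2) d by (rule lin_comb_smult[OF A bD(2), symmetric])
    from lin_comb_unique[OF A basis this j] have "fps_const (c j) = fps_X * d j" .
    then have "fps_const (c j) $ 0 = (fps_X * d j) $ 0" by simp
    then show ?thesis by simp
  qed
  moreover have "(\<lambda>j. I +>\<^bsub>A\<^esub> b j) \<in> J \<rightarrow> carrier ?Q"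
    using bD(3) by (auto simp: carrier_FactRing)
  ultimately show ?thesis unfolding basis_family_def using bD(1) by blast
qed

text \<open>In characteristic two, \<open>(1 + z)^2 = 1 + z^2\<close>; squaring
  \<open>x^2 = 1 + \<omega> x\<close> repeatedly gives the formula because \<open>\<omega>\<close>
  and \<open>x\<close> commute. With \<open>2^k = q\<close> and \<open>\<omega>^q = 0\<close> it
  shows that \<open>x\<close> has the order required of a rotation.\<close>

lemma (in ring) pow_two_power:
  assumes char2: "\<And>z. z \<in> carrier R \<Longrightarrow> z \<oplus> z = \<zero>"
    and xw: "x \<in> carrier R" "\<omega> \<in> carrier R" and comm: "\<omega> \<otimes> x = x \<otimes> \<omega>"
    and sq: "x \<otimes> x = \<one> \<oplus> \<omega> \<otimes> x"
  shows "x [^] (2 ^ Suc k :: nat) = \<one> \<oplus> \<omega> [^] (2 ^ k :: nat) \<otimes> x [^] (2 ^ k :: nat)"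
proof (induction k)
  case 0
  have "x [^] (2 ^ Suc 0 :: nat) = x \<otimes> x" using xw by (simp add: numeral_2_eq_2)
  then show ?case using sq xw by simp
next
  case (Suc k)
  define a where "a = \<omega> [^] (2 ^ k :: nat)"
  define b where "b = x [^] (2 ^ k :: nat)"
  have ab: "a \<in> carrier R" "b \<in> carrier R" using xw by (simp_all add: a_def b_def)
  have sqr: "z [^] (2 ^ Suc k :: nat) = z [^] (2 ^ k :: nat) \<otimes> z [^] (2 ^ k :: nat)" if "z \<in> carrier R" for z k
    using that by (simp add: nat_pow_mult mult_2)
  have "b \<otimes> a = a \<otimes> b"
  proof -
    have "x [^] i \<otimes> \<omega> = \<omega> \<otimes> x [^] i" for i :: nat
      using xw comm by (intro group_commutes_pow) simp_all
    then have "\<omega> [^] j \<otimes> x [^] i = x [^] i \<otimes> \<omega> [^] j" for i j :: nat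
      using xw by (intro group_commutes_pow) simp_all
    then show ?thesis by (simp add: a_def b_def)
  qed
  then have "(a \<otimes> b) \<otimes> (a \<otimes> b) = (a \<otimes> a) \<otimes> (b \<otimes> b)"
    using ab by (metis m_assoc m_closed)
  have "x [^] (2 ^ Suc (Suc k) :: nat) = (\<one> \<oplus> a \<otimes> b) \<otimes> (\<one> \<oplus> a \<otimes> b)"
    using Suc sqr[OF xw(1), of "Suc k"] by (simp only: a_def b_def)
  also have "\<dots> = \<one> \<oplus> (a \<otimes> b \<oplus> a \<otimes> b) \<oplus> (a \<otimes> b) \<otimes> (a \<otimes> b)"
    using ab by (simp add: l_distr r_distr a_ac)
  also have "\<dots> = \<one> \<oplus> (a \<otimes> a) \<otimes> (b \<otimes> b)"
    using ab char2[of "a \<otimes> b"] \<open>(a \<otimes> b) \<otimes> (a \<otimes> b) = _\<close> by simp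
  also have "a \<otimes> a = \<omega> [^] (2 ^ Suc k :: nat)" using sqr[OF xw(2), of k] by (simp only: a_def)
  also have "b \<otimes> b = x [^] (2 ^ Suc k :: nat)" using sqr[OF xw(1), of k] by (simp only: b_def)
  finally show ?case .
qed

section \<open>Bases under change of family, index set and multiplication\<close>

lemma basis_family_cong:
  assumes A: "type_algebra A" and b: "basis_family A I b" and eq: "\<And>i. i \<in> I \<Longrightarrow> b' i = b i"
  shows "basis_family A I b'"
proof -
  have "lin_comb A I b' c = lin_comb A I b c" for c
    by (rule lin_comb_cong[OF A]) (use eq basis_familyD(3)[OF b] in auto)
  then show ?thesis using b eq unfolding basis_family_def by (simp add: Pi_iff)
qed

lemma basis_family_reindex:
  assumes A: "type_algebra A" and b: "basis_family A I b" and \<gamma>: "bij_betw \<gamma> J I"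
  shows "basis_family A J (\<lambda>j. b (\<gamma> j))"
proof -
  interpret A: ring A by (rule type_algebraD(1)[OF A])
  note bD = basis_familyD[OF b]
  define \<delta> where "\<delta> = inv_into J \<gamma>"
  have \<delta>: "\<delta> (\<gamma> j) = j" if "j \<in> J" for j
    using \<gamma> that by (simp add: \<delta>_def bij_betw_def)
  have \<gamma>\<delta>: "\<gamma> (\<delta> i) = i" and \<delta>J: "\<delta> i \<in> J" if "i \<in> I" for i
    using \<gamma> that f_inv_into_f[of i \<gamma> J] inv_into_into[of i \<gamma> J] by (simp_all add: \<delta>_def bij_betw_def)
  have \<gamma>I: "\<gamma> ` J = I" "inj_on \<gamma> J" using \<gamma> by (simp_all add: bij_betw_def)
  have lc: "lin_comb A J (\<lambda>j. b (\<gamma> j)) (\<lambda>j. c (\<gamma> j)) = lin_comb A I b c" for c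
    unfolding lin_comb_def \<gamma>I(1)[symmetric]
    using bD(2) \<gamma>I type_algebraD(3)[OF A] by (intro A.finsum_reindex[symmetric]) auto
  have bJ: "(\<lambda>j. b (\<gamma> j)) \<in> J \<rightarrow> carrier A" using bD(2) \<gamma>I by auto
  have "\<exists>c. x = lin_comb A J (\<lambda>j. b (\<gamma> j)) c" if x: "x \<in> carrier A" for x
  proof -
    obtain c where "x = lin_comb A I b c" using bD(4)[OF x] by blast
    then have "x = lin_comb A J (\<lambda>j. b (\<gamma> j)) (\<lambda>j. c (\<gamma> j))" by (simp add: lc)
    then show ?thesis by (rule exI[of _ "\<lambda>j. c (\<gamma> j)"])
  qed
  moreover have "c j = 0" if c: "lin_comb A J (\<lambda>j. b (\<gamma> j)) c = \<zero>\<^bsub>A\<^esub>" and j: "j \<in> J" for c j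
  proof -
    have "lin_comb A J (\<lambda>j. b (\<gamma> j)) c = lin_comb A J (\<lambda>j. b (\<gamma> j)) (\<lambda>j. c (\<delta> (\<gamma> j)))"
      using bJ \<delta> by (intro lin_comb_cong[OF A]) auto
    then have "lin_comb A I b (\<lambda>i. c (\<delta> i)) = \<zero>\<^bsub>A\<^esub>" using c lc[of "\<lambda>i. c (\<delta> i)"] by simp
    then have "c (\<delta> (\<gamma> j)) = 0" using bD(5)[of "\<lambda>i. c (\<delta> i)" "\<gamma> j"] j \<gamma>I by auto
    then show ?thesis using \<delta>[OF j] by simp
  qed
  moreover have "finite J" using bD(1) \<gamma>I by (metis finite_imageD)
  ultimately show ?thesis unfolding basis_family_def using bJ by blast
qed

text \<open>Linear combinations involve only addition and scalars, which the new multiplication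
  leaves untouched.\<close>

lemma basis_family_update:
  "basis_family (M\<lparr>monoid.mult := m, one := e\<rparr>) I b \<longleftrightarrow> basis_family M I b"
  by (simp add: basis_family_def lin_comb_def finsum_def finprod_def)

lemma ex_linear_map_of_basis:
  assumes M: "type_algebra M" and P: "type_algebra P" and b: "basis_family M I b"
    and f: "f \<in> I \<rightarrow> carrier P"
  obtains \<psi> where "\<psi> \<in> hom (add_monoid M) (add_monoid P)"
    and "\<And>r x. x \<in> carrier M \<Longrightarrow> \<psi> (r \<odot>\<^bsub>M\<^esub> x) = r \<odot>\<^bsub>P\<^esub> \<psi> x"
    and "\<And>c. \<psi> (lin_comb M I b c) = lin_comb P I f c"
proof -
  note bD = basis_familyD[OF b]
  define coord where "coord x = (SOME c. x = lin_comb M I b c)" for x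
  have coord: "x = lin_comb M I b (coord x)" if "x \<in> carrier M" for x
    unfolding coord_def using bD(4)[OF that] by (rule someI_ex)
  define \<psi> where "\<psi> x = lin_comb P I f (coord x)" for x
  have \<psi>: "\<psi> (lin_comb M I b c) = lin_comb P I f c" for c
    unfolding \<psi>_def using f lin_comb_unique[OF M b coord[OF lin_comb_closed[OF M bD(2)]], of _ c]
    by (intro lin_comb_cong[OF P]) auto
  show thesis
  proof (rule that)
    show "\<psi> \<in> hom (add_monoid M) (add_monoid P)"
    proof (rule homI)
      show "\<psi> x \<in> carrier (add_monoid P)" for x unfolding \<psi>_def using lin_comb_closed[OF P f] by simp
      fix x y assume "x \<in> carrier (add_monoid M)" "y \<in> carrier (add_monoid M)"
      then have xy: "x = lin_comb M I b (coord x)" "y = lin_comb M I b (coord y)" using coord by auto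
      have "\<psi> (x \<oplus>\<^bsub>M\<^esub> y) = \<psi> (lin_comb M I b (\<lambda>i. coord x i + coord y i))"
        using xy lin_comb_add[OF M bD(2)] by metis
      also have "\<dots> = \<psi> x \<oplus>\<^bsub>P\<^esub> \<psi> y" unfolding \<psi> lin_comb_add[OF P f] by (simp add: \<psi>_def)
      finally show "\<psi> (x \<otimes>\<^bsub>add_monoid M\<^esub> y) = \<psi> x \<otimes>\<^bsub>add_monoid P\<^esub> \<psi> y" by simp
    qed
    show "\<psi> (r \<odot>\<^bsub>M\<^esub> x) = r \<odot>\<^bsub>P\<^esub> \<psi> x" if "x \<in> carrier M" for r x
    proof -
      have "\<psi> (r \<odot>\<^bsub>M\<^esub> x) = \<psi> (lin_comb M I b (\<lambda>i. r * coord x i))"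
        using coord[OF that] lin_comb_smult[OF M bD(2)] by metis
      also have "\<dots> = r \<odot>\<^bsub>P\<^esub> \<psi> x" unfolding \<psi> lin_comb_smult[OF P f] by (simp add: \<psi>_def)
      finally show ?thesis .
    qed
  qed (rule \<psi>)
qed

lemma comm_ring_hom_fps_to_fls: "comm_ring_hom (fps_to_fls :: 'k::field fps \<Rightarrow> _)"
  by unfold_locales (simp_all add: fls_times_fps_to_fls)

lemma comm_ring_hom_fps_const: "comm_ring_hom (fps_const :: 'k::field \<Rightarrow> _)"
  by unfold_locales auto

section \<open>The order and its generic fibre\<close>

text \<open>Translation by 1 permutes \<open>F\<close>, so the sum over \<open>F\<close> is
  unchanged and the number \<open>2^s\<close> is zero in \<open>k\<close>. Multiplication by a
  nonzero \<open>x\<close> permutes the nonzero elements, so comparing their products gives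
  \<open>x^(2^s - 1) = 1\<close>.\<close>

lemma finite_subfield_two_power:
  assumes F: "subfield F (ring_of_type_algebra :: 'k::field ring)" and card: "card F = 2 ^ s" and s: "s \<ge> 1"
  obtains \<alpha> :: "nat \<Rightarrow> 'k::field" where "inj_on \<alpha> {..<2 ^ s}" "\<alpha> 0 = 0" "\<And>i. i < 2 ^ s \<Longrightarrow> \<alpha> i ^ 2 ^ s = \<alpha> i"
    and "(1 + 1 :: 'k) = 0"
proof -
  let ?q = "2 ^ s :: nat"
  interpret R: field "ring_of_type_algebra :: 'k ring" by (rule field_from_type_algebra)
  note S = subringE[OF subfieldE(1)[OF F]]
  have zero: "0 \<in> F" and one: "1 \<in> F" using S(2,3) by simp_all
  have add: "x + y \<in> F" and mult: "x * y \<in> F" if "x \<in> F" "y \<in> F" for x y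
    using S(6,7)[OF that] by simp_all
  have fin: "finite F" using card by (metis card.infinite power_not_zero zero_neq_numeral)
  have "(\<lambda>x. x + 1) ` F = F"
    using fin one add by (intro endo_inj_surj) (auto simp: inj_on_def)
  then have "(\<Sum>x\<in>F. x) = (\<Sum>x\<in>F. x + 1)"
    by (metis (no_types, lifting) add_right_imp_eq inj_onI sum.reindex_cong)
  then have "of_nat ?q = (0 :: 'k)" by (simp add: sum.distrib card)
  then have char2: "(1 + 1 :: 'k) = 0" by simp
  have pow: "x ^ ?q = x" if x: "x \<in> F" for x
  proof (cases "x = 0")
    case False
    let ?F = "F - {0}"
    have "(*) x ` ?F = ?F"
      using fin x mult False by (intro endo_inj_surj) (auto simp: inj_on_def)
    moreover have "inj_on ((*) x) ?F" using False by (auto simp: inj_on_def)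
    ultimately have "(\<Prod>y\<in>?F. y) = (\<Prod>y\<in>?F. x * y)"
      by (metis (no_types, lifting) prod.reindex_cong)
    also have "\<dots> = x ^ card ?F * (\<Prod>y\<in>?F. y)" by (simp add: prod.distrib)
    finally have "x ^ card ?F = 1" using fin by auto
    moreover have "card F = Suc (card ?F)" using zero fin by (metis card.remove)
    ultimately show ?thesis by (metis card power_Suc mult.right_neutral)
  qed simp
  have "card (F - {0}) = ?q - 1" using fin zero card by simp
  \<comment> \<open>The nonzero elements are numbered from 1, which reserves index 0 for the zero of
    the field: the matrix blocks sit at the nonzero nodes, the four scalars at the node 0.\<close>
  then obtain \<beta> where \<beta>: "bij_betw \<beta> {1..<?q} (F - {0})"
    using finite_same_card_bij[of "{1..<?q}" "F - {0}"] fin by auto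
  define \<alpha> where "\<alpha> i = (if i = 0 then 0 else \<beta> i)" for i
  have \<beta>F: "\<beta> i \<in> F - {0}" if "i \<in> {1..<?q}" for i using \<beta> that by (auto simp: bij_betw_def)
  have "inj_on \<alpha> {..<?q}"
  proof (rule inj_onI)
    fix i j assume ij: "i \<in> {..<?q}" "j \<in> {..<?q}" "\<alpha> i = \<alpha> j"
    show "i = j"
    proof (cases "i = 0 \<or> j = 0")
      case True
      then show ?thesis using ij \<beta>F[of i] \<beta>F[of j] by (auto simp: \<alpha>_def split: if_splits)
    next
      case False
      then show ?thesis using ij \<beta> inj_onD[of \<beta> "{1..<?q}" i j] by (auto simp: \<alpha>_def bij_betw_def)
    qed
  qed
  moreover have "\<alpha> i ^ ?q = \<alpha> i" if "i < ?q" for i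
    using pow[of "\<alpha> i"] \<beta>F[of i] zero that by (auto simp: \<alpha>_def)
  ultimately show thesis using char2 that[of \<alpha>] by (simp add: \<alpha>_def)
qed

text \<open>
  The nodes \<open>w\<^sub>i = t \<alpha>\<^sub>i\<close> are the zeros of \<open>w\<^sup>q + t\<^sup>q\<^sup>-\<^sup>1 w\<close> when the \<open>\<alpha>\<^sub>i\<close> run through the field with
  \<open>q\<close> elements, and \<open>g = t (w\<^sup>q\<^sup>-\<^sup>1 + t\<^sup>q\<^sup>-\<^sup>1)\<close> vanishes at all of them except \<open>0\<close>.
\<close>

locale order_nodes =
  fixes q m :: nat and \<alpha> :: "nat \<Rightarrow> 'k::field"
  assumes q2: "q \<ge> 2" and m: "q = m + 1" and char2: "(1 + 1 :: 'k) = 0"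
    and inj: "inj_on \<alpha> {..<q}" and \<alpha>0: "\<alpha> 0 = 0" and pow: "\<And>i. i < q \<Longrightarrow> \<alpha> i ^ q = \<alpha> i"
begin

definition w :: "nat \<Rightarrow> 'k fps" where "w i = fps_X * fps_const (\<alpha> i)"
definition d :: "'k fps" where "d = fps_X ^ q"
text \<open>The quotient \<open>g / t\<close>, which is itself a polynomial in \<open>w\<close>.
  Keeping it explicit exhibits every term with \<open>g\<close> as \<open>t\<close> times an element
  of the order.\<close>

definition g' :: "nat \<Rightarrow> 'k fps" where "g' i = w i ^ (q - 1) + fps_X ^ (q - 1)"
definition g :: "nat \<Rightarrow> 'k fps" where "g i = fps_X * g' i"

abbreviation "J \<equiv> {..<q} \<times> {..<4 :: nat}"

lemma fps_char2: "(1 + 1 :: 'k fps) = 0"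
proof -
  have "(1 + 1 :: 'k fps) = fps_const (1 + 1)" by (simp flip: fps_const_add)
  then show ?thesis by (simp only: char2 fps_const_0_eq_0)
qed

lemma fps_dbl: "x + x = 0" for x :: "'k fps"
  using fps_char2 by (metis distrib_left mult.right_neutral mult_zero_right)

lemma w0: "w 0 = 0" by (simp add: w_def \<alpha>0)

lemma wq: "i < q \<Longrightarrow> w i ^ q = fps_X ^ (q - 1) * w i"
proof -
  assume i: "i < q"
  have "w i ^ q = fps_X ^ q * fps_const (\<alpha> i)"
    by (simp add: w_def power_mult_distrib fps_const_power pow[OF i])
  also have "fps_X ^ q = fps_X ^ (q - 1) * (fps_X :: 'k fps)"
    using q2 by (metis Suc_diff_1 less_le_trans pos2 power_Suc2)
  finally show ?thesis by (simp add: w_def mult.assoc)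
qed

lemma g_zero: "i \<in> {1..m} \<Longrightarrow> g i = 0"
proof -
  assume i: "i \<in> {1..m}"
  then have iq: "i < q" using m by simp
  have "\<alpha> i \<noteq> 0" using inj_onD[OF inj, of i 0] i iq \<alpha>0 q2 by auto
  moreover have "\<alpha> i ^ (q - 1) * \<alpha> i = \<alpha> i"
    using pow[OF iq] q2 by (metis Suc_diff_1 less_le_trans pos2 power_Suc2)
  ultimately have "\<alpha> i ^ (q - 1) = 1" by simp
  then show ?thesis
    by (simp add: g_def g'_def w_def power_mult_distrib fps_const_power fps_dbl)
qed

lemma g_0: "g 0 = d"
proof -
  have "fps_X * fps_X ^ (q - 1) = (fps_X ^ q :: 'k fps)"
    using q2 by (metis Suc_diff_1 less_le_trans pos2 power_Suc)
  moreover have "(0 :: 'k fps) ^ (q - 1) = 0" using q2 by (intro zero_power) simp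
  ultimately show ?thesis by (simp only: g_def g'_def w0 d_def add_0)
qed

text \<open>The coefficient vectors of elements of the order: each of the four coefficients is a
  polynomial in \<open>w\<close> over \<open>k[[t]]\<close>, and not just any function of the
  node.\<close>

definition admissible :: "(nat \<Rightarrow> nat \<Rightarrow> 'k fps) \<Rightarrow> bool" where
  "admissible V \<longleftrightarrow> (\<forall>k<4. power_fun q w (V k))"

lemma pf_mult: "power_fun q w v \<Longrightarrow> power_fun q w v' \<Longrightarrow> power_fun q w (\<lambda>i. v i * v' i)"
  by (rule power_fun_mult[OF q2 wq])

lemma pf_w: "power_fun q w w" by (rule power_fun_node[OF q2 wq])

lemma pf_const: "power_fun q w (\<lambda>_. r)" using q2 by (intro power_fun_const) simp

lemma pf_power: "power_fun q w v \<Longrightarrow> power_fun q w (\<lambda>i. v i ^ n)"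
  by (induction n) (auto intro: pf_const pf_mult)

lemma pf_g': "power_fun q w g'"
  unfolding g'_def[abs_def] by (intro power_fun_add pf_power pf_w pf_const)

lemma pf_g: "power_fun q w g"
  unfolding g_def[abs_def] by (intro power_fun_smult pf_g')

lemma less_4_cases: "k < 4 \<Longrightarrow> k = 0 \<or> k = 1 \<or> k = 2 \<or> k = (3 :: nat)" by auto

text \<open>The order is closed under multiplication because the structure constants in
  \<open>pencil_prod\<close> are built from \<open>w\<close> and \<open>g\<close>, both polynomials
  in \<open>w\<close>, and because such polynomials are closed under products thanks to
  \<open>w^q = t^(q-1) w\<close>.\<close>

lemma admissible_prod:
  assumes "admissible V" "admissible V'"
  shows "admissible (pencil_prod w g V V')"
proof -
  have V: "power_fun q w (V 0)" "power_fun q w (V (Suc 0))" "power_fun q w (V 2)" "power_fun q w (V 3)"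
    and V': "power_fun q w (V' 0)" "power_fun q w (V' (Suc 0))" "power_fun q w (V' 2)" "power_fun q w (V' 3)"
    using assms by (simp_all add: admissible_def)
  note intros = power_fun_add pf_mult V V' pf_w pf_g
  have "power_fun q w (pencil_prod w g V V' 0)"
    unfolding pencil_prod_def[abs_def] by simp (rule intros)+
  moreover have "power_fun q w (pencil_prod w g V V' 1)"
    unfolding pencil_prod_def[abs_def] by simp (rule intros)+
  moreover have "power_fun q w (pencil_prod w g V V' 2)"
    unfolding pencil_prod_def[abs_def] by simp (rule intros)+
  moreover have "power_fun q w (pencil_prod w g V V' 3)"
    unfolding pencil_prod_def[abs_def] by simp (rule intros)+
  ultimately have "power_fun q w (pencil_prod w g V V' k)" if "k < 4" for k
    using less_4_cases[OF that] by (elim disjE) simp_all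
  then show ?thesis unfolding admissible_def by blast
qed

lemma admissible_add: "admissible V \<Longrightarrow> admissible V' \<Longrightarrow> admissible (\<lambda>k i. V k i + V' k i)"
  unfolding admissible_def by (auto intro: power_fun_add)

lemma admissible_smult: "admissible V \<Longrightarrow> admissible (\<lambda>k i. r * V k i)"
  unfolding admissible_def by (auto intro: power_fun_smult)

lemma order_pencil_mult:
  "pencil m w d V \<otimes>\<^bsub>split_algebra m\<^esub> pencil m w d V' = pencil m w d (pencil_prod w g V V')"
  by (rule pencil_mult) (use fps_char2 g_zero g_0 w0 in auto)

definition vec4 where "vec4 a b c e = (\<lambda>k :: nat. if k = 0 then a else if k = 1 then b else if k = 2 then c else e)"

lemma vec4_simps [simp]: "vec4 a b c e 0 = a" "vec4 a b c e 1 = b" "vec4 a b c e (Suc 0) = b"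
  "vec4 a b c e 2 = c" "vec4 a b c e 3 = e"
  by (simp_all add: vec4_def)

lemma admissible_vec4:
  "power_fun q w a \<Longrightarrow> power_fun q w b \<Longrightarrow> power_fun q w c \<Longrightarrow> power_fun q w e \<Longrightarrow> admissible (vec4 a b c e)"
  unfolding admissible_def by (auto dest!: less_4_cases)

lemma pencil_coeffs_admissible: "admissible (pencil_coeffs q w c)"
  unfolding admissible_def power_fun_def pencil_coeffs_def
  by (intro allI impI, rule_tac x = "\<lambda>e. c (e, k)" in exI) simp

lemma admissible_coeffs:
  assumes "admissible V"
  obtains c where "pencil m w d V = pencil m w d (pencil_coeffs q w c)"
proof -
  obtain c where c: "\<And>k i. k < 4 \<Longrightarrow> i < q \<Longrightarrow> V k i = (\<Sum>e<q. c k e * w i ^ e)"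
    using assms unfolding admissible_def power_fun_def by metis
  have "pencil m w d V = pencil m w d (pencil_coeffs q w (\<lambda>(e, k). c k e))"
    using c m by (intro pencil_cong) (simp add: pencil_coeffs_def)
  then show thesis by (rule that)
qed

lemma fls_nodes:
  "basis_family (split_algebra m) J (pencil_basis m (\<lambda>i. fps_to_fls (w i)) (fps_to_fls d))"
proof (rule basis_family_pencil)
  show "inj_on (\<lambda>i. fps_to_fls (w i)) {..<q}"
    using inj by (auto simp: inj_on_def w_def)
  show "fps_to_fls d \<noteq> 0" by (simp add: d_def)
qed (simp_all add: m w0)

end

text \<open>The module of \<open>\<Lambda>\<close> is dictated by the notion of deformation, so the
  order enters only up to isomorphism: all that is known of \<open>\<Lambda>\<close> is read off
  from its embedding \<open>\<psi>\<close> into the split algebra.\<close>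

locale order = order_nodes +
  fixes \<Lambda> :: "('a fps, 'b) module" and \<psi> b
  assumes \<Lambda>: "type_algebra \<Lambda>" and basis: "basis_family \<Lambda> J b"
    and \<psi>: "\<psi> \<in> algebra_hom \<Lambda> (split_algebra m)" and \<psi>_inj: "inj_on \<psi> (carrier \<Lambda>)"
    and \<psi>_img: "\<psi> ` carrier \<Lambda> = {pencil m w d V | V. admissible V}"
    and \<psi>_b: "\<And>x. x \<in> J \<Longrightarrow> \<psi> (b x) = pencil_basis m w d x"

text \<open>The given basis is sent linearly to the elements \<open>w^e u^i v^j\<close>. The map is
  injective since these stay independent over \<open>k((t))\<close>, and its image is a subring, so
  the multiplication can be pulled back.\<close>

lemma (in order_nodes) ex_order:
  assumes M: "type_algebra M" and b: "basis_family M J b"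
  obtains mu e \<psi> where "order q m \<alpha> (M\<lparr>monoid.mult := mu, one := e\<rparr>) \<psi> b"
proof -
  let ?P = "split_algebra m :: ('k fps, _) module" and ?K = "split_algebra m :: ('k fls, _) module"
  note P = type_algebra_split_algebra[of m, where 'r = "'k fps"]
  note K = type_algebra_split_algebra[of m, where 'r = "'k fls"]
  note bD = basis_familyD[OF b]
  have pbc: "pencil_basis m w d \<in> J \<rightarrow> carrier ?P" by (simp add: pencil_basis_def pencil_def)
  obtain \<psi> where \<psi>: "\<psi> \<in> hom (add_monoid M) (add_monoid ?P)"
    and \<psi>_smult: "\<And>r x. x \<in> carrier M \<Longrightarrow> \<psi> (r \<odot>\<^bsub>M\<^esub> x) = r \<odot>\<^bsub>?P\<^esub> \<psi> x"
    and \<psi>_lc: "\<And>c. \<psi> (lin_comb M J b c) = lin_comb ?P J (pencil_basis m w d) c"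
    using ex_linear_map_of_basis[OF M P b pbc] by blast
  have \<psi>_lc': "\<psi> (lin_comb M J b c) = pencil m w d (pencil_coeffs q w c)" for c
    unfolding \<psi>_lc by (rule lin_comb_pencil_basis)
  have img: "\<psi> ` carrier M = {pencil m w d V | V. admissible V}"
  proof
    show "\<psi> ` carrier M \<subseteq> {pencil m w d V | V. admissible V}"
      using bD(4) \<psi>_lc' pencil_coeffs_admissible by fastforce
    show "{pencil m w d V | V. admissible V} \<subseteq> \<psi> ` carrier M"
    proof
      fix y assume "y \<in> {pencil m w d V | V. admissible V}"
      then obtain V where V: "y = pencil m w d V" "admissible V" by blast
      then obtain c where "pencil m w d V = \<psi> (lin_comb M J b c)"
        using admissible_coeffs \<psi>_lc' by metis
      then show "y \<in> \<psi> ` carrier M" unfolding V(1) using lin_comb_closed[OF M bD(2)] by blast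
    qed
  qed
  obtain j where j: "j \<in> Ring.ring_hom ?P ?K"
    and j_elem: "\<And>f z. j (split_elem m f z) = split_elem m (\<lambda>i r s. fps_to_fls (f i r s)) (\<lambda>j. fps_to_fls (z j))"
    using algebra_hom_map_split_algebra[OF comm_ring_hom_fps_to_fls] by blast
  interpret \<phi>: comm_ring_hom "fps_to_fls :: 'k fps \<Rightarrow> _" by (rule comm_ring_hom_fps_to_fls)
  have j_pencil: "j (pencil m w d V) = pencil m (\<lambda>i. fps_to_fls (w i)) (fps_to_fls d) (\<lambda>k i. fps_to_fls (V k i))" for V
    unfolding pencil_def j_elem by (rule split_elem_cong) (auto simp: fls_times_fps_to_fls)
  have inj: "inj_on \<psi> (carrier M)"
  proof (rule inj_onI)
    fix x y assume xy: "x \<in> carrier M" "y \<in> carrier M" "\<psi> x = \<psi> y"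
    obtain c c' where c: "x = lin_comb M J b c" "y = lin_comb M J b c'" using bD(4) xy(1,2) by meson
    \<comment> \<open>Following \<open>\<psi>\<close> by the inclusion of \<open>k[[t]]\<close> into
      \<open>k((t))\<close> turns a linear combination into one with the same coefficients in a
      basis over the field, where the coefficients are determined.\<close>
    have map: "j (\<psi> (lin_comb M J b c)) =
        lin_comb ?K J (pencil_basis m (\<lambda>i. fps_to_fls (w i)) (fps_to_fls d)) (\<lambda>x. fps_to_fls (c x))" for c
      unfolding \<psi>_lc' j_pencil lin_comb_pencil_basis
      by (simp add: pencil_coeffs_def[abs_def] \<phi>.hom_sum fls_times_fps_to_fls fps_to_fls_power)
    have "fps_to_fls (c i) = fps_to_fls (c' i)" if "i \<in> J" for i
      using lin_comb_unique[OF K fls_nodes _ that, of "\<lambda>x. fps_to_fls (c x)" "\<lambda>x. fps_to_fls (c' x)"]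
        map[of c] map[of c'] xy(3) unfolding c by metis
    then show "x = y" unfolding c by (intro lin_comb_cong[OF M bD(2)]) auto
  qed
  have one: "\<one>\<^bsub>?P\<^esub> \<in> \<psi> ` carrier M"
  proof -
    have "admissible (\<lambda>k i. if k = 0 then 1 else 0)"
      unfolding admissible_def by (auto intro: pf_const)
    then show ?thesis unfolding img pencil_one[of m w d] by blast
  qed
  have mult: "\<psi> x \<otimes>\<^bsub>?P\<^esub> \<psi> y \<in> \<psi> ` carrier M" if "x \<in> carrier M" "y \<in> carrier M" for x y
  proof -
    have "\<psi> x \<in> {pencil m w d V | V. admissible V}" "\<psi> y \<in> {pencil m w d V | V. admissible V}"
      using that img by blast+
    then obtain V V' where V: "\<psi> x = pencil m w d V" "admissible V" "\<psi> y = pencil m w d V'" "admissible V'" by blast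
    then show ?thesis
      unfolding img V(1,3) order_pencil_mult using admissible_prod[OF V(2,4)] by blast
  qed
  obtain mu e where L: "type_algebra (M\<lparr>monoid.mult := mu, one := e\<rparr>)"
    and \<psi>L: "\<psi> \<in> algebra_hom (M\<lparr>monoid.mult := mu, one := e\<rparr>) ?P"
    using ex_transported_algebra[OF M P \<psi> \<psi>_smult inj one mult] by metis
  have \<psi>b: "\<psi> (b x) = pencil_basis m w d x" if "x \<in> J" for x
  proof -
    have "\<psi> (1 \<odot>\<^bsub>M\<^esub> b x) = 1 \<odot>\<^bsub>?P\<^esub> pencil_basis m w d x"
      using \<psi>_lc[of "\<lambda>y. if y = x then 1 else 0"] lin_comb_delta[OF M bD(1) that bD(2)]
        lin_comb_delta[OF P bD(1) that pbc] by simp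
    moreover have "pencil_basis m w d x \<in> carrier ?P" using pbc that by auto
    ultimately show ?thesis using type_algebraD(7)[OF M bD(3)[OF that]] type_algebraD(7)[OF P] by simp
  qed
  have "basis_family (M\<lparr>monoid.mult := mu, one := e\<rparr>) J b" using b by (simp only: basis_family_update)
  moreover have "inj_on \<psi> (carrier (M\<lparr>monoid.mult := mu, one := e\<rparr>))"
    "\<psi> ` carrier (M\<lparr>monoid.mult := mu, one := e\<rparr>) = {pencil m w d V | V. admissible V}"
    using inj img by simp_all
  ultimately have "order q m \<alpha> (M\<lparr>monoid.mult := mu, one := e\<rparr>) \<psi> b"
    using L \<psi>L \<psi>b by (intro order.intro order_axioms.intro order_nodes_axioms)
  then show thesis by (rule that)
qed

text \<open>The inclusions of \<open>\<Lambda>\<close> into the split algebra over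
  \<open>k[[t]]\<close> and then over \<open>k((t))\<close> send a basis over \<open>k[[t]]\<close>
  to a basis over \<open>k((t))\<close>, which is all that \<open>base_change_iso\<close> asks
  for.\<close>

lemma (in order) generic_fibre:
  fixes K :: "('a fls, _) module"
  defines "K \<equiv> split_algebra m"
  obtains h where "h \<in> algebra_hom (base_change fps_to_fls \<Lambda>) K"
    "bij_betw h (carrier (base_change fps_to_fls \<Lambda>)) (carrier K)"
    and "type_algebra (base_change fps_to_fls \<Lambda>)"
proof -
  let ?P = "split_algebra m :: ('a fps, _) module"
  note K = type_algebra_split_algebra[of m, where 'r = "'a fls"]
  note \<psi>D = algebra_homD[OF \<psi>]
  interpret bc: base_change_algebra "fps_to_fls :: 'a fps \<Rightarrow> _" \<Lambda>
    by (intro base_change_algebra.intro comm_ring_hom_fps_to_fls \<Lambda>)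
  obtain j where j: "j \<in> Ring.ring_hom ?P (split_algebra m)"
    and j_elem: "\<And>f z. j (split_elem m f z) = split_elem m (\<lambda>i r s. fps_to_fls (f i r s)) (\<lambda>j. fps_to_fls (z j))"
    using algebra_hom_map_split_algebra[OF comm_ring_hom_fps_to_fls] by blast
  have j_pencil: "j (pencil m w d V) = pencil m (\<lambda>i. fps_to_fls (w i)) (fps_to_fls d) (\<lambda>k i. fps_to_fls (V k i))" for V
    unfolding pencil_def j_elem by (rule split_elem_cong) (auto simp: fls_times_fps_to_fls)
  have hom: "(\<lambda>x. j (\<psi> x)) \<in> Ring.ring_hom \<Lambda> (split_algebra m)"
    using ring_hom_trans[OF \<psi>D(2) j] by (simp add: comp_def)
  have smult: "j (\<psi> (r \<odot>\<^bsub>\<Lambda>\<^esub> x)) = fps_to_fls r \<odot>\<^bsub>split_algebra m\<^esub> j (\<psi> x)" if x: "x \<in> carrier \<Lambda>" for r x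
  proof -
    obtain f z where "\<psi> x = split_elem m f z" using \<psi>D(3)[OF x] by (rule split_elem_cases)
    then show ?thesis by (simp add: \<psi>D(4)[OF x] split_elem_smult j_elem fls_times_fps_to_fls)
  qed
  have "j (\<psi> (b x)) = pencil_basis m (\<lambda>i. fps_to_fls (w i)) (fps_to_fls d) x" if "x \<in> J" for x
    unfolding \<psi>_b[OF that] pencil_basis_def j_pencil
    by (rule pencil_cong) (simp add: fps_to_fls_power)
  then have "basis_family (split_algebra m) J (\<lambda>x. j (\<psi> (b x)))"
    using fls_nodes lin_comb_cong[OF K, of "\<lambda>x. j (\<psi> (b x))" J _ _ "pencil_basis m (\<lambda>i. fps_to_fls (w i)) (fps_to_fls d)"]
      basis_familyD(3)[OF fls_nodes]
    unfolding basis_family_def by (simp add: Pi_iff)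
  from bc.base_change_iso[OF K hom smult basis this] obtain h
    where "h \<in> algebra_hom (base_change fps_to_fls \<Lambda>) (split_algebra m)"
      "bij_betw h (carrier (base_change fps_to_fls \<Lambda>)) (carrier (split_algebra m))" by metis
  then show thesis using that bc.type_algebra_base_change unfolding K_def by blast
qed

section \<open>The special fibre\<close>

context order
begin

text \<open>\<open>lam V\<close> is the element of \<open>\<Lambda>\<close> whose image is the
  pencil of \<open>V\<close>, and \<open>\<xi> V\<close> below is its class modulo \<open>t\<close>.
  Both are meaningful for admissible \<open>V\<close> only.\<close>

definition lam where "lam V = inv_into (carrier \<Lambda>) \<psi> (pencil m w d V)"
definition tideal where "tideal = {fps_X \<odot>\<^bsub>\<Lambda>\<^esub> x | x. x \<in> carrier \<Lambda>}"
definition fibre where "fibre = restrict_scalars fps_const (quotient_algebra \<Lambda> tideal)"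
definition \<xi> where "\<xi> V = tideal +>\<^bsub>\<Lambda>\<^esub> lam V"

lemma lam: "admissible V \<Longrightarrow> lam V \<in> carrier \<Lambda>" "admissible V \<Longrightarrow> \<psi> (lam V) = pencil m w d V"
proof -
  assume "admissible V"
  then have "pencil m w d V \<in> \<psi> ` carrier \<Lambda>" unfolding \<psi>_img by blast
  then show "lam V \<in> carrier \<Lambda>" "\<psi> (lam V) = pencil m w d V"
    by (simp_all add: lam_def inv_into_into f_inv_into_f)
qed

lemma lam_eqI: "x \<in> carrier \<Lambda> \<Longrightarrow> admissible V \<Longrightarrow> \<psi> x = pencil m w d V \<Longrightarrow> lam V = x"
  using inj_onD[OF \<psi>_inj, of "lam V" x] lam by simp

lemma ideal_tideal: "ideal tideal \<Lambda>"
  unfolding tideal_def by (rule Idl_fps_X(2)[OF \<Lambda>])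

lemma type_algebra_fibre: "type_algebra fibre"
  unfolding fibre_def
  by (intro type_algebra_restrict_scalars comm_ring_hom_fps_const type_algebra_quotient \<Lambda> ideal_tideal)

sublocale fibre: ring fibre by (rule type_algebraD(1)[OF type_algebra_fibre])

lemmas coset_hom = algebra_homD[OF type_algebra_quotient(2)[OF \<Lambda> ideal_tideal]]

lemma fibre_simps:
  "x \<oplus>\<^bsub>fibre\<^esub> y = x \<oplus>\<^bsub>quotient_algebra \<Lambda> tideal\<^esub> y" "x \<otimes>\<^bsub>fibre\<^esub> y = x \<otimes>\<^bsub>quotient_algebra \<Lambda> tideal\<^esub> y"
  "\<one>\<^bsub>fibre\<^esub> = \<one>\<^bsub>quotient_algebra \<Lambda> tideal\<^esub>" "\<zero>\<^bsub>fibre\<^esub> = tideal" "carrier fibre = carrier (quotient_algebra \<Lambda> tideal)"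
  by (simp_all add: fibre_def FactRing_def)

lemma \<xi>_closed: "admissible V \<Longrightarrow> \<xi> V \<in> carrier fibre"
  unfolding \<xi>_def fibre_simps by (intro coset_hom(3) lam)

lemma \<xi>_cong: "(\<And>k i. k < 4 \<Longrightarrow> i \<le> m \<Longrightarrow> V k i = V' k i) \<Longrightarrow> \<xi> V = \<xi> V'"
proof -
  assume "\<And>k i. k < 4 \<Longrightarrow> i \<le> m \<Longrightarrow> V k i = V' k i"
  then have "pencil m w d V = pencil m w d V'" by (rule pencil_cong)
  then show ?thesis by (simp only: \<xi>_def lam_def)
qed

lemma \<xi>_add:
  assumes "admissible V" "admissible V'"
  shows "\<xi> V \<oplus>\<^bsub>fibre\<^esub> \<xi> V' = \<xi> (\<lambda>k i. V k i + V' k i)"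
proof -
  interpret L: ring \<Lambda> by (rule type_algebraD(1)[OF \<Lambda>])
  have "lam (\<lambda>k i. V k i + V' k i) = lam V \<oplus>\<^bsub>\<Lambda>\<^esub> lam V'"
    using assms lam by (intro lam_eqI admissible_add) (simp_all add: algebra_homD(5)[OF \<psi>] pencil_add)
  then show ?thesis unfolding \<xi>_def fibre_simps using coset_hom(5)[OF lam(1) lam(1)] assms by simp
qed

lemma \<xi>_mult:
  assumes "admissible V" "admissible V'"
  shows "\<xi> V \<otimes>\<^bsub>fibre\<^esub> \<xi> V' = \<xi> (pencil_prod w g V V')"
proof -
  interpret L: ring \<Lambda> by (rule type_algebraD(1)[OF \<Lambda>])
  have "lam (pencil_prod w g V V') = lam V \<otimes>\<^bsub>\<Lambda>\<^esub> lam V'"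
    using assms lam
    by (intro lam_eqI admissible_prod) (simp_all add: algebra_homD(6)[OF \<psi>] order_pencil_mult)
  then show ?thesis unfolding \<xi>_def fibre_simps using coset_hom(6)[OF lam(1) lam(1)] assms by simp
qed

definition wvec :: "nat \<Rightarrow> nat \<Rightarrow> nat \<Rightarrow> nat \<Rightarrow> 'a fps" where
  "wvec e k = (\<lambda>k' i. if k' = k then w i ^ e else 0)"

lemma admissible_wvec: "admissible (wvec e k)"
  unfolding admissible_def wvec_def
proof (intro allI impI)
  show "power_fun q w (\<lambda>i. if k' = k then w i ^ e else 0)" for k'
    by (cases "k' = k") (simp_all add: pf_const pf_power pf_w)
qed

lemma \<xi>_one: "\<xi> (wvec 0 0) = \<one>\<^bsub>fibre\<^esub>"
proof -
  interpret L: ring \<Lambda> by (rule type_algebraD(1)[OF \<Lambda>])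
  have "pencil m w d (wvec 0 0) = \<one>\<^bsub>split_algebra m\<^esub>"
    unfolding pencil_one[of m w d] by (rule pencil_cong) (simp add: wvec_def)
  then have "lam (wvec 0 0) = \<one>\<^bsub>\<Lambda>\<^esub>"
    by (intro lam_eqI admissible_wvec) (simp_all add: algebra_homD(7)[OF \<psi>])
  then show ?thesis by (simp add: \<xi>_def fibre_simps(3) coset_hom(7))
qed

lemma \<xi>_null:
  assumes "admissible V"
  shows "\<xi> (\<lambda>k i. fps_X * V k i) = \<zero>\<^bsub>fibre\<^esub>"
proof -
  interpret L: ring \<Lambda> by (rule type_algebraD(1)[OF \<Lambda>])
  have "lam (\<lambda>k i. fps_X * V k i) = fps_X \<odot>\<^bsub>\<Lambda>\<^esub> lam V"
    using assms lam type_algebraD(3)[OF \<Lambda>]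
    by (intro lam_eqI admissible_smult) (simp_all add: algebra_homD(4)[OF \<psi>] pencil_smult)
  also have "\<dots> \<in> tideal" unfolding tideal_def using lam(1)[OF assms] by blast
  finally show ?thesis unfolding \<xi>_def fibre_simps by (rule L.a_rcos_zero[OF ideal_tideal])
qed

text \<open>The rule for computing in the special fibre: coefficients may be changed by
  \<open>t\<close> times an admissible vector. Admissibility of \<open>V''\<close> is essential. The
  function \<open>w = t \<alpha>\<close> is divisible by \<open>t\<close> at every node, yet its
  class \<open>\<omega>\<close> is not zero, since \<open>\<alpha>\<close> is not a polynomial in
  \<open>w\<close> over \<open>k[[t]]\<close>.\<close>

lemma \<xi>_eqI:
  assumes "admissible V'" "admissible V''"
    and "\<And>k i. k < 4 \<Longrightarrow> i \<le> m \<Longrightarrow> V k i = V' k i + fps_X * V'' k i"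
  shows "\<xi> V = \<xi> V'"
proof -
  have "\<xi> V = \<xi> (\<lambda>k i. V' k i + fps_X * V'' k i)" using assms(3) by (rule \<xi>_cong)
  also have "\<dots> = \<xi> V' \<oplus>\<^bsub>fibre\<^esub> \<xi> (\<lambda>k i. fps_X * V'' k i)"
    by (rule \<xi>_add[symmetric]) (intro assms admissible_smult)+
  finally show ?thesis using \<xi>_closed[OF assms(1)] by (simp add: \<xi>_null[OF assms(2)])
qed

lemma fibre_char2: "z \<in> carrier fibre \<Longrightarrow> z \<oplus>\<^bsub>fibre\<^esub> z = \<zero>\<^bsub>fibre\<^esub>"
  using type_algebraD(4)[OF type_algebra_fibre, of z 1 1] type_algebraD(7,8)[OF type_algebra_fibre, of z]
  by (simp only: char2)

section \<open>The dihedral relations in the special fibre\<close>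

abbreviation "one_f \<equiv> (\<lambda>_ :: nat. 1 :: 'a fps)"
abbreviation "zero_f \<equiv> (\<lambda>_ :: nat. 0 :: 'a fps)"

lemma fps_two: "(2 :: 'a fps) = 0" using fps_char2 by simp

lemma fps_dbl': "x + (x + y) = y" for x y :: "'a fps"
  by (metis add.assoc add_0 fps_dbl)

definition xvec where "xvec = vec4 one_f one_f zero_f zero_f"
definition yvec where "yvec = vec4 one_f zero_f one_f zero_f"

lemma admissible_xy: "admissible xvec" "admissible yvec"
  unfolding xvec_def yvec_def by (intro admissible_vec4 pf_const)+

definition "x = \<xi> xvec"
definition "y = \<xi> yvec"
definition "\<omega> = \<xi> (wvec 1 0)"

lemma xy_closed: "x \<in> carrier fibre" "y \<in> carrier fibre" "\<omega> \<in> carrier fibre"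
  by (simp_all add: x_def y_def \<omega>_def \<xi>_closed admissible_xy admissible_wvec)

lemmas vec_simps = pencil_prod_def wvec_def xvec_def yvec_def g_def fps_two fps_dbl fps_dbl' distrib_left

text \<open>With \<open>x = 1 + u\<close> one has
  \<open>x^2 = 1 + u^2 = 1 + w (1 + u) + g u\<close>, and the error \<open>g u\<close> is
  \<open>t\<close> times \<open>g' u\<close>.\<close>

lemma fibre_xx: "x \<otimes>\<^bsub>fibre\<^esub> x = \<one>\<^bsub>fibre\<^esub> \<oplus>\<^bsub>fibre\<^esub> \<omega> \<otimes>\<^bsub>fibre\<^esub> x"
proof -
  have "\<one>\<^bsub>fibre\<^esub> \<oplus>\<^bsub>fibre\<^esub> \<omega> \<otimes>\<^bsub>fibre\<^esub> x = \<xi> (\<lambda>k i. wvec 0 0 k i + pencil_prod w g (wvec 1 0) xvec k i)"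
    unfolding x_def \<omega>_def \<xi>_one[symmetric]
    by (simp add: \<xi>_mult \<xi>_add admissible_wvec admissible_xy admissible_prod)
  moreover have "x \<otimes>\<^bsub>fibre\<^esub> x = \<xi> (pencil_prod w g xvec xvec)"
    by (simp add: x_def \<xi>_mult admissible_xy)
  moreover have "\<xi> (pencil_prod w g xvec xvec) = \<xi> (\<lambda>k i. wvec 0 0 k i + pencil_prod w g (wvec 1 0) xvec k i)"
  proof (rule \<xi>_eqI)
    show "admissible (\<lambda>k i. wvec 0 0 k i + pencil_prod w g (wvec 1 0) xvec k i)"
      by (intro admissible_add admissible_prod admissible_wvec admissible_xy)
    show "admissible (vec4 zero_f g' zero_f zero_f)" by (intro admissible_vec4 pf_const pf_g')
    show "pencil_prod w g xvec xvec k i =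
        wvec 0 0 k i + pencil_prod w g (wvec 1 0) xvec k i + fps_X * vec4 zero_f g' zero_f zero_f k i"
      if "k < 4" for k i
      using less_4_cases[OF that] by (elim disjE) (simp_all add: vec_simps)
  qed
  ultimately show ?thesis by simp
qed

lemma fibre_yy: "y \<otimes>\<^bsub>fibre\<^esub> y = \<one>\<^bsub>fibre\<^esub>"
proof -
  have "\<xi> (pencil_prod w g yvec yvec) = \<xi> (wvec 0 0)"
  proof (rule \<xi>_eqI)
    show "admissible (wvec 0 0)" by (rule admissible_wvec)
    show "admissible (vec4 zero_f zero_f g' zero_f)" by (intro admissible_vec4 pf_const pf_g')
    show "pencil_prod w g yvec yvec k i = wvec 0 0 k i + fps_X * vec4 zero_f zero_f g' zero_f k i"
      if "k < 4" for k i
      using less_4_cases[OF that] by (elim disjE) (simp_all add: vec_simps)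
  qed
  then show ?thesis by (simp add: y_def \<xi>_mult admissible_xy \<xi>_one)
qed

text \<open>In the order \<open>y x = (x + w) y\<close> holds exactly and
  \<open>x (x + w) = 1 + g u\<close>. The error is therefore \<open>g u y = g u + g u v\<close>,
  which explains the two entries \<open>g'\<close> of the correction vector.\<close>

lemma fibre_xyx: "x \<otimes>\<^bsub>fibre\<^esub> y \<otimes>\<^bsub>fibre\<^esub> x = y"
proof -
  have "\<xi> (pencil_prod w g (pencil_prod w g xvec yvec) xvec) = \<xi> yvec"
  proof (rule \<xi>_eqI)
    show "admissible yvec" by (rule admissible_xy)
    show "admissible (vec4 zero_f g' zero_f g')" by (intro admissible_vec4 pf_const pf_g')
    show "pencil_prod w g (pencil_prod w g xvec yvec) xvec k i = yvec k i + fps_X * vec4 zero_f g' zero_f g' k i"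
      if "k < 4" for k i
      using less_4_cases[OF that] by (elim disjE) (simp_all add: vec_simps)
  qed
  then show ?thesis by (simp add: x_def y_def \<xi>_mult admissible_xy admissible_prod)
qed

lemma fibre_comm: "\<omega> \<otimes>\<^bsub>fibre\<^esub> x = x \<otimes>\<^bsub>fibre\<^esub> \<omega>"
proof -
  have "\<xi> (pencil_prod w g (wvec 1 0) xvec) = \<xi> (pencil_prod w g xvec (wvec 1 0))"
  proof (rule \<xi>_cong)
    fix k i :: nat assume k: "k < 4"
    show "pencil_prod w g (wvec 1 0) xvec k i = pencil_prod w g xvec (wvec 1 0) k i"
      using less_4_cases[OF k] by (elim disjE) (simp_all add: vec_simps)
  qed
  then show ?thesis by (simp add: x_def \<omega>_def \<xi>_mult admissible_xy admissible_wvec)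
qed

lemma \<xi>_wvec_mult: "\<xi> (wvec e 0) \<otimes>\<^bsub>fibre\<^esub> \<xi> (wvec e' k) = \<xi> (wvec (e + e') k)" if "k < 4"
proof -
  have "\<xi> (pencil_prod w g (wvec e 0) (wvec e' k)) = \<xi> (wvec (e + e') k)"
  proof (rule \<xi>_cong)
    fix k' i :: nat assume k': "k' < 4"
    show "pencil_prod w g (wvec e 0) (wvec e' k) k' i = wvec (e + e') k k' i"
      using less_4_cases[OF k'] less_4_cases[OF that]
      by (elim disjE) (simp_all add: pencil_prod_def wvec_def power_add)
  qed
  then show ?thesis by (simp add: \<xi>_mult admissible_wvec)
qed

lemma \<omega>_pow: "\<omega> [^]\<^bsub>fibre\<^esub> (e :: nat) = \<xi> (wvec e 0)"
proof (induction e)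
  case 0
  then show ?case by (simp add: \<xi>_one)
next
  case (Suc e)
  then show ?case using \<xi>_wvec_mult[of 0 e 1] by (simp add: \<omega>_def)
qed

lemma \<omega>_nilpotent: "\<omega> [^]\<^bsub>fibre\<^esub> q = \<zero>\<^bsub>fibre\<^esub>"
proof -
  \<comment> \<open>From \<open>w^q = t^(q-1) w\<close> one factor \<open>t\<close> is split off,
    possible because \<open>q\<close> is at least 2; the remaining \<open>t^(q-2) w\<close> is still
    admissible.\<close>
  let ?V = "\<lambda>k i. fps_X ^ (q - 2) * wvec 1 0 k i"
  have "q - 1 = Suc (q - 2)" using q2 by simp
  then have Xq: "(fps_X :: 'a fps) ^ (q - 1) = fps_X * fps_X ^ (q - 2)" by (metis power_Suc)
  have "wvec q 0 k i = fps_X * ?V k i" if "i \<le> m" for k i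
  proof -
    have "w i ^ q = fps_X * (fps_X ^ (q - 2) * w i)"
      using wq[of i] that m unfolding Xq mult.assoc by simp
    then show ?thesis by (simp add: wvec_def)
  qed
  then have "\<xi> (wvec q 0) = \<xi> (\<lambda>k i. fps_X * ?V k i)" by (intro \<xi>_cong) simp
  then show ?thesis
    using \<xi>_null[of ?V] admissible_smult[OF admissible_wvec] by (simp add: \<omega>_pow)
qed

lemma x_eq: "x = \<one>\<^bsub>fibre\<^esub> \<oplus>\<^bsub>fibre\<^esub> \<xi> (wvec 0 1)" and y_eq: "y = \<one>\<^bsub>fibre\<^esub> \<oplus>\<^bsub>fibre\<^esub> \<xi> (wvec 0 2)"
proof -
  have "xvec k i = wvec 0 0 k i + wvec 0 1 k i" "yvec k i = wvec 0 0 k i + wvec 0 2 k i" if "k < 4" for k i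
    using less_4_cases[OF that] by (elim disjE; simp add: wvec_def xvec_def yvec_def)+
  then have "x = \<xi> (\<lambda>k i. wvec 0 0 k i + wvec 0 1 k i)" "y = \<xi> (\<lambda>k i. wvec 0 0 k i + wvec 0 2 k i)"
    unfolding x_def y_def by (intro \<xi>_cong; simp)+
  then show "x = \<one>\<^bsub>fibre\<^esub> \<oplus>\<^bsub>fibre\<^esub> \<xi> (wvec 0 1)" "y = \<one>\<^bsub>fibre\<^esub> \<oplus>\<^bsub>fibre\<^esub> \<xi> (wvec 0 2)"
    by (simp_all add: \<xi>_add[symmetric] admissible_wvec \<xi>_one)
qed

lemma \<xi>_uv: "\<xi> (wvec 0 1) \<otimes>\<^bsub>fibre\<^esub> \<xi> (wvec 0 2) = \<xi> (wvec 0 3)"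
proof -
  have "\<xi> (pencil_prod w g (wvec 0 1) (wvec 0 2)) = \<xi> (wvec 0 3)"
  proof (rule \<xi>_cong)
    fix k i :: nat assume k: "k < 4"
    show "pencil_prod w g (wvec 0 1) (wvec 0 2) k i = wvec 0 3 k i"
      using less_4_cases[OF k] by (elim disjE) (simp_all add: pencil_prod_def wvec_def)
  qed
  then show ?thesis by (simp add: \<xi>_mult admissible_wvec)
qed

lemma basis_family_fibre: "basis_family fibre J (\<lambda>p. \<xi> (wvec (fst p) (snd p)))"
proof (rule basis_family_cong[OF type_algebra_fibre])
  show "basis_family fibre J (\<lambda>p. tideal +>\<^bsub>\<Lambda>\<^esub> b p)"
    unfolding fibre_def by (rule basis_family_mod_fps_X[OF \<Lambda> basis tideal_def])
  fix p assume p: "p \<in> J"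
  have "lam (wvec (fst p) (snd p)) = b p"
    using basis_familyD(3)[OF basis p] \<psi>_b[OF p]
    by (intro lam_eqI admissible_wvec) (simp_all add: pencil_basis_def wvec_def)
  then show "\<xi> (wvec (fst p) (snd p)) = tideal +>\<^bsub>\<Lambda>\<^esub> b p" by (simp add: \<xi>_def)
qed

text \<open>The map from the group algebra is surjective because its image \<open>R\<close> contains
  \<open>x\<close> and \<open>y\<close>, hence \<open>\<omega>\<close>, \<open>u\<close>,
  \<open>v\<close> and with them a basis. The group elements then form a spanning family of length
  \<open>4 q\<close>, the dimension of the fibre, so they map to a basis and the map is
  bijective.\<close>

lemma special_fibre:
  assumes q: "q = 2 ^ s" and D: "dihedral_pair D (2 * q) \<sigma> \<tau>"
    and bij: "bij_betw (\<lambda>(e, l). \<sigma> [^]\<^bsub>D\<^esub> e \<otimes>\<^bsub>D\<^esub> \<tau> [^]\<^bsub>D\<^esub> l) ({..<2 * q} \<times> {..<2 :: nat}) (carrier D)"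
  shows "(monoid_algebra D :: ('a, _) module) \<simeq>\<^sub>a\<^sub>l\<^sub>g
    restrict_scalars fps_const (quotient_algebra \<Lambda> (Idl\<^bsub>\<Lambda>\<^esub> {fps_X \<odot>\<^bsub>\<Lambda>\<^esub> x | x. x \<in> carrier \<Lambda>}))"
proof -
  let ?A = "monoid_algebra D :: ('a, _) module"
  note xyc [simp] = xy_closed
  note Q = type_algebra_fibre
  interpret D: dihedral_pair D "2 * q" \<sigma> \<tau> by (rule D)
  have xN: "x [^]\<^bsub>fibre\<^esub> (2 * q) = \<one>\<^bsub>fibre\<^esub>"
    using fibre.pow_two_power[OF fibre_char2 xyc(1,3) fibre_comm fibre_xx, of s, unfolded power_Suc, folded q] \<omega>_nilpotent
    by simp
  interpret xy: dihedral_pair fibre "2 * q" x y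
    by unfold_locales (use D.N xN fibre_yy fibre_xyx in \<open>simp_all add: numeral_2_eq_2\<close>)
  obtain \<rho> where \<rho>: "\<rho> \<in> carrier D \<rightarrow> carrier fibre"
    and \<rho>_mult: "\<And>g h. g \<in> carrier D \<Longrightarrow> h \<in> carrier D \<Longrightarrow> \<rho> (g \<otimes>\<^bsub>D\<^esub> h) = \<rho> g \<otimes>\<^bsub>fibre\<^esub> \<rho> h"
    and \<rho>_one: "\<rho> \<one>\<^bsub>D\<^esub> = \<one>\<^bsub>fibre\<^esub>"
    and \<rho>_pow: "\<And>(e :: nat) (l :: nat). \<rho> (\<sigma> [^]\<^bsub>D\<^esub> e \<otimes>\<^bsub>D\<^esub> \<tau> [^]\<^bsub>D\<^esub> l) = x [^]\<^bsub>fibre\<^esub> e \<otimes>\<^bsub>fibre\<^esub> y [^]\<^bsub>fibre\<^esub> l"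
    using ex_dihedral_hom[OF D bij xy.dihedral_pair_axioms] by blast
  have "finite (carrier D)" using bij_betw_finite[OF bij] by simp
  then interpret D: finite_monoid D by unfold_locales
  define h where "h = lin_comb fibre (carrier D) \<rho>"
  have h: "h \<in> algebra_hom ?A fibre"
    unfolding h_def by (rule D.ex_monoid_algebra_hom[OF Q \<rho>]) (erule (1) \<rho>_mult, rule \<rho>_one)
  note hD = algebra_homD[OF h]
  have A: "type_algebra ?A" by (rule D.monoid_algebra)
  interpret A: ring ?A by (rule type_algebraD(1)[OF A])
  have h_mono: "h (monomial a 1) = \<rho> a" if a: "a \<in> carrier D" for a
  proof -
    have "h (monomial a 1) = 1 \<odot>\<^bsub>fibre\<^esub> \<rho> a"
      unfolding h_def monomial_def by (rule lin_comb_delta[OF Q _ a \<rho>]) simp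
    then show ?thesis using type_algebraD(7)[OF Q, of "\<rho> a"] \<rho> a by auto
  qed
  define R where "R = h ` carrier ?A"
  have R_add: "a \<oplus>\<^bsub>fibre\<^esub> b \<in> R" and R_mult: "a \<otimes>\<^bsub>fibre\<^esub> b \<in> R" if ab: "a \<in> R" "b \<in> R" for a b
  proof -
    obtain f f' where f: "f \<in> carrier ?A" "a = h f" "f' \<in> carrier ?A" "b = h f'" using ab unfolding R_def by blast
    then have "a \<oplus>\<^bsub>fibre\<^esub> b = h (f \<oplus>\<^bsub>?A\<^esub> f')" "a \<otimes>\<^bsub>fibre\<^esub> b = h (f \<otimes>\<^bsub>?A\<^esub> f')"
      using hD(5,6) by simp_all
    then show "a \<oplus>\<^bsub>fibre\<^esub> b \<in> R" "a \<otimes>\<^bsub>fibre\<^esub> b \<in> R"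
      unfolding R_def using A.a_closed[OF f(1,3)] A.m_closed[OF f(1,3)] by blast+
  qed
  have R_one: "\<one>\<^bsub>fibre\<^esub> \<in> R" unfolding R_def using hD(7) A.one_closed by (metis imageI)
  have R_pow: "a [^]\<^bsub>fibre\<^esub> (e :: nat) \<in> R" if "a \<in> R" for a e
    using that by (induction e) (simp_all add: R_one R_mult)
  have R_\<rho>: "\<rho> a \<in> R" if "a \<in> carrier D" for a
    using h_mono[OF that] monomial_closed[OF that] unfolding R_def by (metis imageI)
  have Rx: "x \<in> R" using R_\<rho>[of \<sigma>] \<rho>_pow[of 1 0] by simp
  have Ry: "y \<in> R" using R_\<rho>[of \<tau>] \<rho>_pow[of 0 1] by simp
  have cancel: "a \<oplus>\<^bsub>fibre\<^esub> (a \<oplus>\<^bsub>fibre\<^esub> b) = b" if "a \<in> carrier fibre" "b \<in> carrier fibre" for a b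
    using that by (simp add: fibre.a_assoc[symmetric] fibre_char2)
  have R\<omega>: "\<omega> \<in> R"
  proof - \<comment> \<open>\<open>x\<^sup>2 = 1 + \<omega> x\<close> gives \<open>\<omega> = x + x\<^sup>-\<^sup>1\<close>\<close>
    have "x \<otimes>\<^bsub>fibre\<^esub> (x \<oplus>\<^bsub>fibre\<^esub> \<omega>) = \<omega> \<otimes>\<^bsub>fibre\<^esub> x \<oplus>\<^bsub>fibre\<^esub> (\<omega> \<otimes>\<^bsub>fibre\<^esub> x \<oplus>\<^bsub>fibre\<^esub> \<one>\<^bsub>fibre\<^esub>)"
      by (simp add: fibre.r_distr fibre_xx fibre_comm[symmetric] fibre.a_ac)
    also have "\<dots> = \<one>\<^bsub>fibre\<^esub>" by (simp add: cancel)
    finally have inv: "x \<otimes>\<^bsub>fibre\<^esub> (x \<oplus>\<^bsub>fibre\<^esub> \<omega>) = \<one>\<^bsub>fibre\<^esub>" .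
    have "x [^]\<^bsub>fibre\<^esub> (2 * q - 1) \<otimes>\<^bsub>fibre\<^esub> x = \<one>\<^bsub>fibre\<^esub>"
      using xN D.N fibre.nat_pow_Suc[of x "2 * q - 1"] by simp
    then have "x \<oplus>\<^bsub>fibre\<^esub> \<omega> = (x [^]\<^bsub>fibre\<^esub> (2 * q - 1) \<otimes>\<^bsub>fibre\<^esub> x) \<otimes>\<^bsub>fibre\<^esub> (x \<oplus>\<^bsub>fibre\<^esub> \<omega>)" by simp
    also have "\<dots> = x [^]\<^bsub>fibre\<^esub> (2 * q - 1)" by (simp add: fibre.m_assoc inv del: fibre.nat_pow_Suc)
    finally have "\<omega> = x \<oplus>\<^bsub>fibre\<^esub> x [^]\<^bsub>fibre\<^esub> (2 * q - 1)" using cancel[of x \<omega>] by simp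
    then show ?thesis using R_add[OF Rx R_pow[OF Rx]] by simp
  qed
  have "\<xi> (wvec 0 1) = \<one>\<^bsub>fibre\<^esub> \<oplus>\<^bsub>fibre\<^esub> x" "\<xi> (wvec 0 2) = \<one>\<^bsub>fibre\<^esub> \<oplus>\<^bsub>fibre\<^esub> y"
    unfolding x_eq y_eq by (simp_all add: cancel \<xi>_closed admissible_wvec)
  then have Ru: "\<xi> (wvec 0 1) \<in> R" and Rv: "\<xi> (wvec 0 2) \<in> R" using R_add R_one Rx Ry by simp_all
  have R0: "\<xi> (wvec 0 k) \<in> R" if "k < 4" for k
    using less_4_cases[OF that] R_one Ru Rv R_mult[OF Ru Rv, unfolded \<xi>_uv]
    by (elim disjE) (simp_all add: \<xi>_one)
  have Rb: "\<xi> (wvec e k) \<in> R" if "k < 4" for e k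
    using R_mult[OF R_pow[OF R\<omega>, of e] R0[OF that]] \<xi>_wvec_mult[OF that, of e 0] by (simp add: \<omega>_pow)
  \<comment> \<open>Preimages of the basis elements are fixed, so that a linear combination in the
    fibre can be lifted term by term.\<close>
  have "\<exists>a. \<forall>p\<in>J. a p \<in> carrier ?A \<and> h (a p) = \<xi> (wvec (fst p) (snd p))"
  proof (rule bchoice, rule ballI)
    fix p assume "p \<in> J"
    then have "\<xi> (wvec (fst p) (snd p)) \<in> R" by (intro Rb) auto
    then show "\<exists>a. a \<in> carrier ?A \<and> h a = \<xi> (wvec (fst p) (snd p))" unfolding R_def by auto
  qed
  then obtain a where "\<forall>p\<in>J. a p \<in> carrier ?A \<and> h (a p) = \<xi> (wvec (fst p) (snd p))" by (rule exE)
  note a = this[THEN bspec, THEN conjunct1] this[THEN bspec, THEN conjunct2]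
  have span: "\<exists>c. z = lin_comb fibre (carrier D) \<rho> c" if z: "z \<in> carrier fibre" for z
  proof -
    obtain c where c: "z = lin_comb fibre J (\<lambda>p. \<xi> (wvec (fst p) (snd p))) c"
      using basis_familyD(4)[OF basis_family_fibre z] by blast
    have aJ: "a \<in> J \<rightarrow> carrier ?A" using a(1) by (intro Pi_I)
    have "h (lin_comb ?A J a c) = lin_comb fibre J (\<lambda>p. h (a p)) c"
      by (rule lin_comb_image[OF A Q hD(1) hD(4) aJ])
    also have "\<dots> = z"
      unfolding c by (rule lin_comb_cong[OF Q _ refl a(2)]) (intro Pi_I hD(3) a(1))
    finally show ?thesis unfolding h_def by (intro exI) (rule sym)
  qed
  have "card (carrier D) = card J"
    using bij_betw_same_card[OF bij] by (simp add: card_cartesian_product)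
  then have "basis_family fibre (carrier D) \<rho>"
    using basis_family_of_spanning[OF Q basis_family_fibre _ _ \<rho> span] by simp
  then have hb: "basis_family fibre (carrier D) (\<lambda>a. h (monomial a 1))"
    by (rule basis_family_cong[OF Q _ h_mono])
  have "bij_betw h (carrier ?A) (carrier fibre)"
  proof (rule bij_betw_of_basis(1)[where h = h and b = "\<lambda>g. monomial g 1", OF A Q hD(1) hD(4) _ _ hb])
    show "(\<lambda>g. monomial g 1) \<in> carrier D \<rightarrow> carrier ?A"
      by (rule basis_familyD(2)[OF D.basis_family_monoid_algebra])
    show "\<exists>c. z = lin_comb ?A (carrier D) (\<lambda>g. monomial g 1) c" if "z \<in> carrier ?A" for z
      by (rule basis_familyD(4)[OF D.basis_family_monoid_algebra that])
  qed
  then show ?thesis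
    unfolding algebra_iso_def Idl_fps_X(1)[OF \<Lambda>] using h unfolding fibre_def tideal_def by blast
qed

end

section \<open>The complex group algebra of a dihedral group\<close>

text \<open>The classical irreducible representations are written down: in block \<open>i\<close>
  the rotation acts as \<open>diag(\<zeta>^i, \<zeta>^-i)\<close> and the reflection exchanges the
  two coordinates, and the scalars carry the four characters. Bijectivity is the inversion of a
  Fourier transform on the cyclic group of order \<open>N\<close>.\<close>

lemma complex_group_algebra_split:
  assumes D: "dihedral_pair D N \<sigma> \<tau>" and N: "N = 2 * (m + 1)"
    and bij: "bij_betw (\<lambda>(e, l). \<sigma> [^]\<^bsub>D\<^esub> e \<otimes>\<^bsub>D\<^esub> \<tau> [^]\<^bsub>D\<^esub> l) ({..<N} \<times> {..<2 :: nat}) (carrier D)"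
  obtains h where "h \<in> algebra_hom (monoid_algebra D :: (complex, _) module) (split_algebra m)"
    "bij_betw h (carrier (monoid_algebra D :: (complex, _) module)) (carrier (split_algebra m :: (complex, _) module))"
proof -
  let ?P = "split_algebra m :: (complex, _) module" and ?A = "monoid_algebra D :: (complex, _) module"
  note P = type_algebra_split_algebra[of m, where 'r = complex]
  interpret D: dihedral_pair D N \<sigma> \<tau> by (rule D)
  interpret P: ring ?P by (rule type_algebraD(1)[OF P])
  define \<zeta> where "\<zeta> = cis (2 * pi / real N)"
  have Npos: "N > 0" using N by simp
  have \<zeta>_pow: "\<zeta> ^ i = cis (2 * pi * real i / real N)" for i
    by (simp add: \<zeta>_def DeMoivre mult_ac)
  have \<zeta>N: "\<zeta> ^ N = 1" using Npos by (simp add: \<zeta>_pow)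
  have \<zeta>_half: "\<zeta> ^ (m + 1) = - 1"
  proof -
    have "2 * pi * real (m + 1) / real N = pi" by (simp add: N field_simps)
    then show ?thesis by (simp only: \<zeta>_pow cis_pi)
  qed
  have inj: "inj_on (\<lambda>i. \<zeta> ^ i) {..<N}"
    using bij_betw_roots_unity[OF Npos] by (simp add: \<zeta>_pow bij_betw_def)
  \<comment> \<open>The exponent \<open>-i\<close> is represented by \<open>N - i\<close>, so that
    all exponents remain natural numbers.\<close>
  define ex where "ex r i = (if r = 0 then i else N - i)" for r i :: nat
  \<comment> \<open>For \<open>j = 1, 2, 3, 4\<close> the pair \<open>(zx j, zy j)\<close> is
    \<open>(1, 1)\<close>, \<open>(1, -1)\<close>, \<open>(-1, 1)\<close>,
    \<open>(-1, -1)\<close>.\<close>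
  define zx zy :: "nat \<Rightarrow> complex" where "zx j = (if j \<le> 2 then 1 else - 1)" and "zy j = (if odd j then 1 else - 1)" for j
  define x where "x = split_elem m (\<lambda>i r s. if r = s then \<zeta> ^ ex r i else 0) zx"
  define y where "y = split_elem m (\<lambda>i r s. if r \<noteq> s then 1 else 0) zy"
  have xc: "x \<in> carrier ?P" and yc: "y \<in> carrier ?P" by (simp_all add: x_def y_def)
  have x_pow: "x [^]\<^bsub>?P\<^esub> e = split_elem m (\<lambda>i r s. if r = s then \<zeta> ^ (ex r i * e) else 0) (\<lambda>j. zx j ^ e)" for e :: nat
  proof (induction e)
    case 0
    show ?case by (simp add: split_elem_one cong: if_cong)
  next
    case (Suc e)
    show ?case unfolding P.nat_pow_Suc Suc unfolding x_def split_elem_mult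
      by (intro split_elem_cong) (auto dest!: less_2_cases simp: power_add mult_ac)
  qed
  have yy: "y \<otimes>\<^bsub>?P\<^esub> y = \<one>\<^bsub>?P\<^esub>"
    unfolding y_def split_elem_mult split_elem_one
    by (intro split_elem_cong) (auto dest!: less_2_cases simp: zy_def)
  interpret xy: dihedral_pair ?P N x y
  proof unfold_locales
    show "x [^]\<^bsub>?P\<^esub> N = \<one>\<^bsub>?P\<^esub>"
      unfolding x_pow split_elem_one
    proof (intro split_elem_cong)
      fix i r s :: nat
      have "\<zeta> ^ (ex r i * N) = (\<zeta> ^ N) ^ ex r i" by (simp flip: power_mult add: mult.commute)
      then have "\<zeta> ^ (ex r i * N) = 1" by (simp add: \<zeta>N)
      then show "(if r = s then \<zeta> ^ (ex r i * N) else 0) = (if r = s then 1 else 0)" by auto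
    qed (simp add: zx_def N)
    show "y [^]\<^bsub>?P\<^esub> (2 :: nat) = \<one>\<^bsub>?P\<^esub>" using yy yc by (simp add: numeral_2_eq_2)
    show "x \<otimes>\<^bsub>?P\<^esub> y \<otimes>\<^bsub>?P\<^esub> x = y"
      unfolding x_def y_def split_elem_mult
    proof (intro split_elem_cong)
      fix i r s :: nat assume i: "i \<in> {1..m}" and "r < 2" "s < 2"
      then have "ex 0 i + ex 1 i = N" using N by (simp add: ex_def)
      then have "\<zeta> ^ ex 0 i * \<zeta> ^ ex 1 i = 1" by (metis \<zeta>N power_add)
      then have *: "\<zeta> ^ ex 0 i * \<zeta> ^ ex (Suc 0) i = 1" "\<zeta> ^ ex (Suc 0) i * \<zeta> ^ ex 0 i = 1"
        by (simp_all add: mult.commute)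
      have r: "r = 0 \<or> r = 1" and s: "s = 0 \<or> s = 1" using \<open>r < 2\<close> \<open>s < 2\<close> by auto
      show "((if r = 0 then \<zeta> ^ ex r i else 0) * (if 0 \<noteq> (0 :: nat) then 1 else 0) +
            (if r = 1 then \<zeta> ^ ex r i else 0) * (if 1 \<noteq> (0 :: nat) then 1 else 0)) *
           (if 0 = s then \<zeta> ^ ex 0 i else 0) +
           ((if r = 0 then \<zeta> ^ ex r i else 0) * (if 0 \<noteq> (1 :: nat) then 1 else 0) +
            (if r = 1 then \<zeta> ^ ex r i else 0) * (if 1 \<noteq> (1 :: nat) then 1 else 0)) *
           (if 1 = s then \<zeta> ^ ex 1 i else 0) = (if r \<noteq> s then 1 else 0)"
        using r s * by auto
    qed (simp add: zx_def zy_def)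
  qed (use Npos xc yc in simp_all)
  obtain \<rho> where \<rho>: "\<rho> \<in> carrier D \<rightarrow> carrier ?P"
    and \<rho>_mult: "\<And>g h. g \<in> carrier D \<Longrightarrow> h \<in> carrier D \<Longrightarrow> \<rho> (g \<otimes>\<^bsub>D\<^esub> h) = \<rho> g \<otimes>\<^bsub>?P\<^esub> \<rho> h"
    and \<rho>_one: "\<rho> \<one>\<^bsub>D\<^esub> = \<one>\<^bsub>?P\<^esub>"
    and \<rho>_pow: "\<And>(e :: nat) (l :: nat). \<rho> (\<sigma> [^]\<^bsub>D\<^esub> e \<otimes>\<^bsub>D\<^esub> \<tau> [^]\<^bsub>D\<^esub> l) = x [^]\<^bsub>?P\<^esub> e \<otimes>\<^bsub>?P\<^esub> y [^]\<^bsub>?P\<^esub> l"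
    using ex_dihedral_hom[OF D bij xy.dihedral_pair_axioms] by blast
  have "finite (carrier D)" using bij_betw_finite[OF bij] by simp
  then interpret D: finite_monoid D by unfold_locales
  define h where "h = lin_comb ?P (carrier D) \<rho>"
  have h: "h \<in> algebra_hom ?A ?P"
    unfolding h_def by (rule D.ex_monoid_algebra_hom[OF P \<rho>]) (erule (1) \<rho>_mult, rule \<rho>_one)
  let ?I = "{..<N} \<times> {..<2 :: nat}" and ?\<gamma> = "\<lambda>(e, l). \<sigma> [^]\<^bsub>D\<^esub> e \<otimes>\<^bsub>D\<^esub> \<tau> [^]\<^bsub>D\<^esub> l"
  have A: "type_algebra ?A" by (rule D.monoid_algebra)
  have \<rho>_elem: "\<rho> (?\<gamma> p) = split_elem m
      (\<lambda>i r s. if (if snd p = 0 then r = s else r \<noteq> s) then \<zeta> ^ (ex r i * fst p) else 0)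
      (\<lambda>j. zx j ^ fst p * (if snd p = 0 then 1 else zy j))" if p: "p \<in> ?I" for p
  proof -
    obtain e l where el: "p = (e, l)" by (cases p)
    have "l = 0 \<or> l = 1" using p el by auto
    then show ?thesis
    proof
      assume l: "l = 0"
      then have "\<rho> (?\<gamma> p) = x [^]\<^bsub>?P\<^esub> e" using \<rho>_pow[of e 0] xc by (simp add: el)
      then show ?thesis unfolding el l x_pow fst_conv snd_conv by simp
    next
      assume l: "l = 1"
      then have "\<rho> (?\<gamma> p) = x [^]\<^bsub>?P\<^esub> e \<otimes>\<^bsub>?P\<^esub> y" using \<rho>_pow[of e 1] yc by (simp add: el)
      then show ?thesis
        unfolding x_pow y_def split_elem_mult el l
        by (auto dest!: less_2_cases intro!: split_elem_cong)
    qed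
  qed
  have indep: "c (e, l) = 0"
    if zero: "lin_comb ?P ?I (\<lambda>p. \<rho> (?\<gamma> p)) c = \<zero>\<^bsub>?P\<^esub>" and e: "e < N" and l: "l < 2" for c e l
  proof -
    \<comment> \<open>The Fourier coefficient at \<open>\<zeta>^k\<close> of the function
      \<open>e \<mapsto> c (e, l)\<close>. It suffices that it vanishes for every
      \<open>k < N\<close>.\<close>
    define S where "S l k = (\<Sum>e<N. c (e, l) * (\<zeta> ^ k) ^ e)" for l k :: nat
    have two: "(\<Sum>p\<in>?I. f p) = (\<Sum>e<N. f (e, 0)) + (\<Sum>e<N. f (e, 1))" for f :: "nat \<times> nat \<Rightarrow> complex"
      by (simp add: sum.cartesian_product' numeral_2_eq_2 sum.distrib)
    have "lin_comb ?P ?I (\<lambda>p. \<rho> (?\<gamma> p)) c = split_elem m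
        (\<lambda>i r s. \<Sum>p\<in>?I. c p * (if (if snd p = 0 then r = s else r \<noteq> s) then \<zeta> ^ (ex r i * fst p) else 0))
        (\<lambda>j. \<Sum>p\<in>?I. c p * (zx j ^ fst p * (if snd p = 0 then 1 else zy j)))"
      by (subst lin_comb_split_elem[symmetric], simp, rule lin_comb_cong[OF P])
         (auto simp: \<rho>_elem simp del: split_paired_All)
    with zero have eq0: "split_elem m
        (\<lambda>i r s. \<Sum>p\<in>?I. c p * (if (if snd p = 0 then r = s else r \<noteq> s) then \<zeta> ^ (ex r i * fst p) else 0))
        (\<lambda>j. \<Sum>p\<in>?I. c p * (zx j ^ fst p * (if snd p = 0 then 1 else zy j)))
        = split_elem m (\<lambda>i r s. 0) (\<lambda>j. 0)" by (simp only: split_elem_zero)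
    have block: "S (if r = s then 0 else 1) (ex r i) = 0" if "i \<in> {1..m}" "r < 2" "s < 2" for i r s
    proof -
      have "(\<Sum>p\<in>?I. c p * (if (if snd p = 0 then r = s else r \<noteq> s) then \<zeta> ^ (ex r i * fst p) else 0)) = 0"
        using eq0 that unfolding split_elem_eq_iff by blast
      then show ?thesis unfolding two fst_conv snd_conv by (cases "r = s") (simp_all add: S_def power_mult)
    qed
    have point: "(\<Sum>e<N. c (e, 0) * zx j ^ e) + (\<Sum>e<N. c (e, 1) * zx j ^ e) * zy j = 0" if "j \<in> {1..4}" for j
    proof -
      have "(\<Sum>p\<in>?I. c p * (zx j ^ fst p * (if snd p = 0 then 1 else zy j))) = 0"
        using eq0 that unfolding split_elem_eq_iff by blast
      then show ?thesis unfolding two fst_conv snd_conv by (simp add: sum_distrib_right mult.assoc)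
    qed
    have S0: "S 0 0 + S 1 0 = 0" "S 0 0 - S 1 0 = 0"
      using point[of 1] point[of 2] by (simp_all add: S_def zx_def zy_def)
    have Sq: "S 0 (m + 1) + S 1 (m + 1) = 0" "S 0 (m + 1) - S 1 (m + 1) = 0"
      using point[of 3] point[of 4] unfolding S_def \<zeta>_half by (simp_all add: zx_def zy_def)
    have S: "S l k = 0" if k: "k < N" for k
    proof -
      have ll: "l = 0 \<or> l = 1" using l by auto
      \<comment> \<open>The frequencies 0 and \<open>m + 1 = N / 2\<close> come from the four
        characters, which give the sum and the difference of the two transforms; the others come in
        pairs \<open>k\<close>, \<open>N - k\<close> from the two rows of a block.\<close>
      consider "k = 0" | "k \<in> {1..m}" | "k = m + 1" | "m + 1 < k" by fastforce
      then show ?thesis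
      proof cases
        case 1
        then show ?thesis using ll S0 by auto
      next
        case 2
        then show ?thesis using ll block[of k 0 0] block[of k 0 1] by (auto simp: ex_def)
      next
        case 3
        then show ?thesis using ll Sq by auto
      next
        case 4
        then have "N - k \<in> {1..m}" "N - (N - k) = k" using k N by auto
        then show ?thesis using ll block[of "N - k" 1 1] block[of "N - k" 1 0] by (auto simp: ex_def)
      qed
    qed
    show ?thesis
      using power_sum_eq_0[OF inj, of "\<lambda>e. c (e, l)" e] S e unfolding S_def by simp
  qed
  have Pbasis: "basis_family ?P ?I (\<lambda>p. \<rho> (?\<gamma> p))"
  proof (rule basis_family_of_independent[OF P basis_family_split_algebra])
    show "card ?I = card (split_index m)" by (simp add: card_split_index card_cartesian_product N)
    show "(\<lambda>p. \<rho> (?\<gamma> p)) \<in> ?I \<rightarrow> carrier ?P" by (simp add: \<rho>_elem Pi_iff del: split_paired_All)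
    show "\<forall>c. lin_comb ?P ?I (\<lambda>p. \<rho> (?\<gamma> p)) c = \<zero>\<^bsub>?P\<^esub> \<longrightarrow> (\<forall>p\<in>?I. c p = 0)"
    proof (intro allI impI ballI)
      fix c p assume c: "lin_comb ?P ?I (\<lambda>p. \<rho> (?\<gamma> p)) c = \<zero>\<^bsub>?P\<^esub>" and p: "p \<in> ?I"
      obtain e l where "p = (e, l)" by (cases p)
      then show "c p = 0" using indep[OF c, of e l] p by simp
    qed
  qed simp
  define \<delta> where "\<delta> = inv_into ?I ?\<gamma>"
  have \<delta>: "bij_betw \<delta> (carrier D) ?I" unfolding \<delta>_def by (rule bij_betw_inv_into[OF bij])
  have \<gamma>\<delta>: "?\<gamma> (\<delta> g) = g" if "g \<in> carrier D" for g
    unfolding \<delta>_def using bij that by (intro f_inv_into_f) (simp add: bij_betw_def)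
  have h_mono: "h (monomial g 1) = \<rho> g" if g: "g \<in> carrier D" for g
  proof -
    have "h (monomial g 1) = 1 \<odot>\<^bsub>?P\<^esub> \<rho> g"
      unfolding h_def monomial_def by (rule lin_comb_delta[OF P _ g \<rho>]) simp
    then show ?thesis using type_algebraD(7)[OF P, of "\<rho> g"] \<rho> g by auto
  qed
  have "basis_family ?P (carrier D) (\<lambda>g. \<rho> (?\<gamma> (\<delta> g)))"
    by (rule basis_family_reindex[OF P Pbasis \<delta>])
  moreover have "h (monomial g 1) = \<rho> (?\<gamma> (\<delta> g))" if "g \<in> carrier D" for g
    using h_mono[OF that] \<gamma>\<delta>[OF that] by simp
  ultimately have hb: "basis_family ?P (carrier D) (\<lambda>g. h (monomial g 1))"
    by (rule basis_family_cong[OF P])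
  have "bij_betw h (carrier ?A) (carrier ?P)"
  proof (rule bij_betw_of_basis(1)[where h = h and b = "\<lambda>g. monomial g 1", OF A P algebra_homD(1)[OF h] algebra_homD(4)[OF h] _ _ hb])
    show "(\<lambda>g. monomial g 1) \<in> carrier D \<rightarrow> carrier ?A"
      by (rule basis_familyD(2)[OF D.basis_family_monoid_algebra])
    show "\<exists>c. z = lin_comb ?A (carrier D) (\<lambda>g. monomial g 1) c" if "z \<in> carrier ?A" for z
      by (rule basis_familyD(4)[OF D.basis_family_monoid_algebra that])
  qed
  then show thesis using h that by blast
qed

section \<open>Extension of scalars\<close>

text \<open>Matrix units have entries 0 and 1, which every homomorphism of scalars fixes. Pulled
  back to \<open>A\<close>, they form a basis that is sent to the matrix units over the new
  scalars.\<close>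

lemma base_change_split:
  assumes A: "type_algebra A" and \<phi>: "comm_ring_hom \<phi>" and h: "h \<in> algebra_hom A (split_algebra m)"
    and bij: "bij_betw h (carrier A) (carrier (split_algebra m))"
  obtains k where "k \<in> algebra_hom (base_change \<phi> A) (split_algebra m)"
    "bij_betw k (carrier (base_change \<phi> A)) (carrier (split_algebra m))"
    and "type_algebra (base_change \<phi> A)"
proof -
  interpret \<phi>: comm_ring_hom \<phi> by fact
  interpret bc: base_change_algebra \<phi> A by (intro base_change_algebra.intro \<phi> A)
  note hD = algebra_homD[OF h]
  obtain j where j: "j \<in> Ring.ring_hom (split_algebra m) (split_algebra m)"
    and j_elem: "\<And>f z. j (split_elem m f z) = split_elem m (\<lambda>i r s. \<phi> (f i r s)) (\<lambda>j. \<phi> (z j))"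
    using algebra_hom_map_split_algebra[OF \<phi>] by blast
  obtain g where g: "g \<in> algebra_hom (split_algebra m) A"
      "bij_betw g (carrier (split_algebra m)) (carrier A)"
    and hg: "\<And>y. y \<in> carrier (split_algebra m) \<Longrightarrow> h (g y) = y"
    by (rule algebra_iso_inverse[OF A h bij]) (rule that)
  have hom: "(\<lambda>x. j (h x)) \<in> Ring.ring_hom A (split_algebra m)"
    using ring_hom_trans[OF hD(2) j] by (simp add: comp_def)
  have smult: "j (h (r \<odot>\<^bsub>A\<^esub> x)) = \<phi> r \<odot>\<^bsub>split_algebra m\<^esub> j (h x)" if x: "x \<in> carrier A" for r x
  proof -
    obtain f z where "h x = split_elem m f z" using hD(3)[OF x] by (rule split_elem_cases)
    then show ?thesis by (simp add: hD(4)[OF x] split_elem_smult j_elem hom_distribs)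
  qed
  have basis: "basis_family A (split_index m) (\<lambda>i. g (matrix_unit m i))"
    by (rule basis_family_image[OF type_algebra_split_algebra A algebra_homD(1,4)[OF g(1)] g(2)
          basis_family_split_algebra])
  have "j (h (g (matrix_unit m i))) = matrix_unit m i" if "i \<in> split_index m" for i
    unfolding hg[OF basis_familyD(3)[OF basis_family_split_algebra that]]
    unfolding matrix_unit_def j_elem by (rule split_elem_cong) simp_all
  then have "basis_family (split_algebra m) (split_index m) (\<lambda>i. j (h (g (matrix_unit m i))))"
    by (rule basis_family_cong[OF type_algebra_split_algebra basis_family_split_algebra])
  from bc.base_change_iso[OF type_algebra_split_algebra hom smult basis this] obtain k
    where "k \<in> algebra_hom (base_change \<phi> A) (split_algebra m)"
      "bij_betw k (carrier (base_change \<phi> A)) (carrier (split_algebra m))" by metis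
  then show thesis using that bc.type_algebra_base_change by blast
qed

lemma (in finite_monoid) basis_family_base_change_monoid_algebra:
  fixes \<phi> :: "'r::comm_ring_1 \<Rightarrow> 's::comm_ring_1"
  assumes \<phi>: "comm_ring_hom \<phi>"
  obtains b where "basis_family (base_change \<phi> (monoid_algebra G)) (carrier G) b"
    and "type_algebra (base_change \<phi> (monoid_algebra G))"
proof -
  interpret \<phi>: comm_ring_hom \<phi> by fact
  interpret bc: base_change_algebra \<phi> "monoid_algebra G"
    by (intro base_change_algebra.intro \<phi> monoid_algebra)
  have "(\<lambda>x. \<phi> (monomial g 1 x)) = monomial g 1" for g :: 'a
    by (auto simp: monomial_def)
  then have "basis_family (monoid_algebra G :: ('s, _) module) (carrier G) (\<lambda>g x. \<phi> (monomial g 1 x))"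
    using basis_family_monoid_algebra by simp
  moreover have "(\<lambda>x. \<phi> ((r \<odot>\<^bsub>monoid_algebra G\<^esub> f) x)) = \<phi> r \<odot>\<^bsub>monoid_algebra G\<^esub> (\<lambda>x. \<phi> (f x))"
    for r and f :: "'a \<Rightarrow> 'r"
    by (simp add: hom_distribs)
  ultimately obtain b where "basis_family (base_change \<phi> (monoid_algebra G)) (carrier G) b"
    using bc.base_change_iso[OF monoid_algebra ring_hom_map_monoid_algebra[OF \<phi>] _ basis_family_monoid_algebra]
    by metis
  then show thesis using that bc.type_algebra_base_change by blast
qed

section \<open>The algebraic closure and the comparison of dimensions\<close>

lemma comm_ring_hom_to_ac: "comm_ring_hom to_ac"
  by unfold_locales simp_all

text \<open>Both sets of components are enumerated by the same indices, and the dimension depends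
  only on the kind of index. The base fields may differ, which allows the comparison with the
  complex numbers.\<close>

lemma simple_components_same_dims:
  fixes A :: "('k::field, 'a) module" and B :: "('l::field, 'b) module"
  assumes A: "type_algebra A" "h \<in> algebra_hom A (split_algebra m)"
      "bij_betw h (carrier A) (carrier (split_algebra m))"
    and B: "type_algebra B" "k \<in> algebra_hom B (split_algebra m)"
      "bij_betw k (carrier B) (carrier (split_algebra m))"
  shows "\<exists>f. bij_betw f (simple_components A) (simple_components B) \<and>
    (\<forall>I\<in>simple_components A. subspace_dim B (f I) = subspace_dim A I)"
proof -
  obtain c where c: "bij_betw c (component_index m) (simple_components A)"
    and c_dim: "\<And>k. k \<in> component_index m \<Longrightarrow> subspace_dim A (c k) = (case k of Inl _ \<Rightarrow> 4 | Inr _ \<Rightarrow> 1)"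
    by (rule simple_components_of_split[OF A]) (rule that)
  obtain c' where c': "bij_betw c' (component_index m) (simple_components B)"
    and c'_dim: "\<And>k. k \<in> component_index m \<Longrightarrow> subspace_dim B (c' k) = (case k of Inl _ \<Rightarrow> 4 | Inr _ \<Rightarrow> 1)"
    by (rule simple_components_of_split[OF B]) (rule that)
  let ?i = "inv_into (component_index m) c"
  show ?thesis
  proof (intro exI conjI ballI)
    show "bij_betw (c' \<circ> ?i) (simple_components A) (simple_components B)"
      by (rule bij_betw_trans[OF bij_betw_inv_into[OF c] c'])
    fix I assume I: "I \<in> simple_components A"
    then have i: "?i I \<in> component_index m" "c (?i I) = I"
      using c by (auto simp: bij_betw_def inv_into_into f_inv_into_f)
    then show "subspace_dim B ((c' \<circ> ?i) I) = subspace_dim A I"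
      using c_dim[OF i(1)] c'_dim[OF i(1)] by simp
  qed
qed

theorem mainTheorem2:
  fixes n :: nat and D :: "'g monoid"
  assumes "n \<ge> 3"
    and "is_dihedral n D"
    and "\<exists>F. subfield F (ring_of_type_algebra :: 'k::field ring) \<and> card F = 2 ^ (n - 2)"
  shows "\<exists>D\<^sub>t.
    is_deformation (group_algebra D :: ('k, 'g \<Rightarrow> 'k) module) D\<^sub>t \<and>
    separable_algebra D\<^sub>t \<and>
    base_change (to_ac :: 'k fls \<Rightarrow> 'k fls alg_closure) D\<^sub>t \<simeq>\<^sub>a\<^sub>l\<^sub>g
      algebra_sum {1..2 ^ (n - 2) - 1 :: nat} (\<lambda>_. matrix_algebra 2) \<oplus>\<^sub>a\<^sub>l\<^sub>g
      algebra_sum {1..4 :: nat} (\<lambda>_. algebra_of_hom (\<lambda>c. c)) \<and>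
    (\<exists>f. bij_betw f
           (simple_components (base_change (to_ac :: 'k fls \<Rightarrow> 'k fls alg_closure) D\<^sub>t))
           (simple_components (group_algebra D :: (complex, 'g \<Rightarrow> complex) module)) \<and>
         (\<forall>I \<in> simple_components (base_change (to_ac :: 'k fls \<Rightarrow> 'k fls alg_closure) D\<^sub>t).
            subspace_dim (group_algebra D :: (complex, 'g \<Rightarrow> complex) module) (f I) =
            subspace_dim (base_change (to_ac :: 'k fls \<Rightarrow> 'k fls alg_closure) D\<^sub>t) I))"
proof -
  define s where "s = n - 2"
  \<comment> \<open>\<open>q\<close> is at once the number of elements of the subfield, the number
    of nodes and half of the exponent \<open>2^(n-1)\<close> in the relation for the
    rotation.\<close>
  define q :: nat where "q = 2 ^ s"
  define m where "m = q - 1"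
  have s1: "s \<ge> 1" using assms(1) by (simp add: s_def)
  have q2: "q \<ge> 2" using s1 unfolding q_def by (metis one_le_numeral power_increasing power_one_right)
  have m: "q = m + 1" using q2 by (simp add: m_def)
  have "n - 1 = Suc s" using assms(1) by (simp add: s_def)
  then have N: "2 ^ (n - 1) = 2 * q" by (simp add: q_def)
  have "n \<ge> 1" using assms(1) by simp
  then obtain \<sigma> \<tau> where D: "dihedral_pair D (2 * q) \<sigma> \<tau>"
    and bij: "bij_betw (\<lambda>(e, l). \<sigma> [^]\<^bsub>D\<^esub> e \<otimes>\<^bsub>D\<^esub> \<tau> [^]\<^bsub>D\<^esub> l) ({..<2 * q} \<times> {..<2 :: nat}) (carrier D)"
    using is_dihedral_generators[OF assms(2)] unfolding N by blast
  obtain F where "subfield F (ring_of_type_algebra :: 'k ring)" "card F = 2 ^ s"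
    using assms(3) unfolding s_def by blast
  then obtain \<alpha> :: "nat \<Rightarrow> 'k" where "order_nodes q m \<alpha>"
    using finite_subfield_two_power[OF _ _ s1] q2 m unfolding order_nodes_def q_def by metis
  then interpret order_nodes q m \<alpha> .
  interpret D: dihedral_pair D "2 * q" \<sigma> \<tau> by (rule D)
  have "finite (carrier D)" using bij_betw_finite[OF bij] by simp
  then interpret fin: finite_monoid D by unfold_locales
  let ?A = "monoid_algebra D :: ('k, _) module" and ?C = "monoid_algebra D :: (complex, _) module"
  let ?M = "base_change fps_const ?A"
  obtain b where M: "type_algebra ?M" and b: "basis_family ?M (carrier D) b"
    using fin.basis_family_base_change_monoid_algebra[OF comm_ring_hom_fps_const] by blast
  have "card J = card (carrier D)"
    using bij_betw_same_card[OF bij] by (simp add: card_cartesian_product)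
  \<comment> \<open>Any bijection will do: it only carries the new multiplication to the prescribed
    module, and the tie to the group is established afterwards by the special fibre.\<close>
  then obtain \<gamma> where "bij_betw \<gamma> J (carrier D)"
    using \<open>finite (carrier D)\<close> finite_same_card_bij[of J "carrier D"] by auto
  then have "basis_family ?M J (\<lambda>p. b (\<gamma> p))" by (rule basis_family_reindex[OF M b])
  from ex_order[OF M this] obtain mu e \<psi>
    where "order q m \<alpha> (?M\<lparr>monoid.mult := mu, one := e\<rparr>) \<psi> (\<lambda>p. b (\<gamma> p))" .
  then interpret order q m \<alpha> "?M\<lparr>monoid.mult := mu, one := e\<rparr>" \<psi> "\<lambda>p. b (\<gamma> p)" .
  let ?\<Lambda> = "?M\<lparr>monoid.mult := mu, one := e\<rparr>"
  let ?D = "base_change fps_to_fls ?\<Lambda>"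
  obtain h where h: "h \<in> algebra_hom ?D (split_algebra m)"
      "bij_betw h (carrier ?D) (carrier (split_algebra m))" and Dt: "type_algebra ?D"
    by (rule generic_fibre)
  obtain k where k: "k \<in> algebra_hom (base_change to_ac ?D) (split_algebra m)"
      "bij_betw k (carrier (base_change to_ac ?D)) (carrier (split_algebra m))"
      and acD: "type_algebra (base_change to_ac ?D)"
    by (rule base_change_split[OF Dt comm_ring_hom_to_ac h])
  obtain l where l: "l \<in> algebra_hom ?C (split_algebra m)"
      "bij_betw l (carrier ?C) (carrier (split_algebra m))"
    by (rule complex_group_algebra_split[OF D _ bij]) (simp_all add: m)
  have "is_deformation ?A ?D"
    unfolding is_deformation_def using \<Lambda> special_fibre[OF q_def D bij] by blast
  moreover have "separable_algebra ?D" by (rule separable_of_split[OF Dt h])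
  moreover have "base_change to_ac ?D \<simeq>\<^sub>a\<^sub>l\<^sub>g split_algebra m"
    unfolding algebra_iso_def using k by blast
  moreover have "\<exists>f. bij_betw f (simple_components (base_change to_ac ?D)) (simple_components ?C) \<and>
      (\<forall>I\<in>simple_components (base_change to_ac ?D).
        subspace_dim ?C (f I) = subspace_dim (base_change to_ac ?D) I)"
    by (rule simple_components_same_dims[OF acD k D.monoid_algebra l])
  ultimately show ?thesis
    unfolding split_algebra_def m_def q_def s_def by blast
qed

end
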